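(* Let $G$ be the labelled snake graph of a diagonal $\gamma=(i,j)$ in a triangulated polygon (with the default orientation with respect to the direction $i\to j$), let $\overline{G}$ be the labelled dual snake graph, and let $x_{ij}$ be the super $\lambda$-length of $\gamma$. Then $$x_{ij}=\frac{1}{\mathrm{cross}(i,j)}\sum_{P\in L(\overline{G})}\mathrm{wt}(P).$$
   Context: **Triangulation.** Triangles of the triangulation not met by $\gamma$ may be removed, so that $\gamma$ crosses all diagonals. Let $n\ge2$ be the number of triangles; draw the polygon with $i$ at the bottom and $j$ at the top. Let $x_1,\dots,x_{n-1}$ be the diagonals in the order crossed by $\gamma$ from $i$ to $j$, $\Delta_1,\dots,\Delta_n$ the triangles in the order met; $\Delta_m$ carries an odd variable ($\mu$-invariant) $\theta_m$. Each edge carries a commuting positive even variable ($\lambda$-length), denoted by the same symbol; odd variables anticommute and square to zero; square roots and inverses of even variables are adjoined. $\mathrm{cross}(i,j)=x_1\cdots x_{n-1}$. **Fan centers, default orientation, positive order.** For $2\le m\le n-1$ the fan center of $\Delta_m$ is the common vertex of $x_{m-1}$ and $x_m$; $\Delta_1$ and $\Delta_n$ have the same fan center as $\Delta_2$ and $\Delta_{n-1}$ respectively (if $n=2$, a chosen endpoint of $x_1$ is the only fan center). Let $c_1,\dots,c_N$ be the distinct fan centers in order from $i$ to $j$. Default orientation: the diagonal joining $c_s,c_{s+1}$ is oriented $c_s\to c_{s+1}$; every other diagonal is oriented away from the fan center which is its endpoint. Positive order: for each $m<n$, if $x_m$ is oriented so that $\Delta_m$ is on its right, then $\theta_m>\theta_s$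 for all $s>m$; otherwise $\theta_m<\theta_s$ for all $s>m$. Products of odd variables in the positive order are written left to right with decreasing variables. **Super $\lambda$-lengths.** In a quadrilateral whose flipped diagonal $e$ is drawn horizontally, oriented left to right, with sides $a$ (upper left), $b$ (upper right), $c$ (lower right), $d$ (lower left), and $\mu$-invariants $\theta$ (upper triangle), $\sigma$ (lower triangle), replacing $e$ by the other diagonal $f$, oriented bottom to top, gives $$ef=ac+bd+\sqrt{abcd}\,\sigma\theta,\quad \theta'=\frac{\theta\sqrt{bd}+\sigma\sqrt{ac}}{\sqrt{ef}},\quad \sigma'=\frac{\sigma\sqrt{bd}-\theta\sqrt{ac}}{\sqrt{ef}},$$ where $\theta'$ (resp. $\sigma'$) belongs to the new left (resp. right) triangle; the orientation of $b$ is reversed and those of $a,c,d$ are unchanged. The super $\lambda$-length of an arc is obtained by applying flips to the given triangulation until the arc appears; it is independent of the flip sequence. **Labelled snake graph $G=G_\gamma$.** One square tile $T_m$ for each $x_m$. Let $x_m=(p,q)$ with $p$ left of $\gamma$ and $q$ right, $u$ the third vertex of $\Delta_m$, $v$ the third vertex of $\Delta_{m+1}$. If $m$ is odd, the left, bottom, top, right sides of $T_m$ are labelled $(u,p),(u,q),(p,v),(q,v)$; if $m$ is even, $(u,q),(u,p),(q,v),(p,v)$. The third side of $\Delta_{m+1}$ (other than $x_m,x_{m+1}$) labels the right or top side of $T_m$; accordingly $T_{m+1}$ is attached to the right of, or on top of, $T_m$. The word $W(G)=w_1\cdots w_{n-2}$ has $w_m=\mathrm R$ if $T_{m+1}$ is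 to the right of $T_m$ and $w_m=\mathrm U$ if it is above. **Dual snake graph $\overline G$.** Its word is obtained from $W(G)$ by exchanging $\mathrm R\leftrightarrow\mathrm U$ in the odd-numbered letters. Its tile $\overline T_m$ has the same labels as $T_m$ except that, for $m$ odd, the top and right labels are swapped, and for $m$ even, the bottom and left labels are swapped. The bottom-left (resp. top-right) corner of $\overline T_m$ carries $\theta_m$ (resp. $\theta_{m+1}$). **Double lattice paths.** A lattice path on a snake graph is a path along edges from the bottom-left corner of the first tile to the top-right corner of the last tile with every step going right or up. A double lattice path is a multiset of edges which is the multiset union of (the edge sets of) two lattice paths; $L(\overline G)$ is the set of these. The edges used exactly once form cycles: writing $P$ as a union of two non-crossing lattice paths, each cycle is the boundary of the union of a maximal run of consecutive tiles $\overline T_s,\dots,\overline T_t$ lying between the two paths; it contributes the odd variables $\theta_s\theta_{t+1}$ (its beginning and its end). $\mathrm{wt}(P)$ is the product of the square roots of the labels of all edges of $P$ (with multiplicity) times the product of the odd variables contributed by all cycles of $P$, taken in the positive order. *)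

theory Defs
  imports Complex_Main "HOL-Library.Multiset"
begin

text \<open>
  Even variables take values in an ordered field in which positive elements have square roots.
  Besides the reals this includes real closed fields containing formal indeterminates (ordered so
  that the indeterminates are positive), so an identity for arbitrary positive elements of
  such fields is in particular the identity for formal variables with square roots and
  inverses adjoined.
\<close>

class sqrt_field = linordered_field +
  assumes ex_sqrt: "0 < a \<Longrightarrow> \<exists>b. b * b = a"

instance real :: sqrt_field
proof
  fix a :: real assume "0 < a"
  then show "\<exists>b. b * b = a" by (intro exI[of _ "sqrt a"]) simp
qed

definition psqrt :: "'k::sqrt_field \<Rightarrow> 'k" where
  "psqrt a = (THE b. 0 < b \<and> b * b = a)"

text \<open>
  The Grassmann algebra on anticommuting generators indexed by nat: an element is given by
  its coefficients at the monomials, where a finite set A of indices stands for the product of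
  its generators with increasing indices.
\<close>

typedef (overloaded) 'k grassmann =
  "{f :: nat set \<Rightarrow> 'k::zero. finite {A. f A \<noteq> 0} \<and> (\<forall>A. f A \<noteq> 0 \<longrightarrow> finite A)}"
  morphisms coeff Abs_grassmann
  by (rule exI[of _ "\<lambda>_. 0"]) simp

setup_lifting type_definition_grassmann

definition inversions :: "nat set \<Rightarrow> nat set \<Rightarrow> nat" where
  "inversions A B = card {(a, b). a \<in> A \<and> b \<in> B \<and> b < a}"

lemma inversions_Un_left:
  assumes "finite A" "finite B" "finite C" "A \<inter> B = {}"
  shows "inversions (A \<union> B) C = inversions A C + inversions B C"
proof -
  have "{(a, b). a \<in> A \<union> B \<and> b \<in> C \<and> b < a} =
      {(a, b). a \<in> A \<and> b \<in> C \<and> b < a} \<union> {(a, b). a \<in> B \<and> b \<in> C \<and> b < a}" by auto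
  moreover have "finite {(a, b). a \<in> A \<and> b \<in> C \<and> b < a}"
    by (rule finite_subset[of _ "A \<times> C"]) (use assms in auto)
  moreover have "finite {(a, b). a \<in> B \<and> b \<in> C \<and> b < a}"
    by (rule finite_subset[of _ "B \<times> C"]) (use assms in auto)
  ultimately show ?thesis
    unfolding inversions_def using assms(4) by (subst card_Un_disjoint[symmetric]) auto
qed

lemma inversions_Un_right:
  assumes "finite A" "finite B" "finite C" "A \<inter> B = {}"
  shows "inversions C (A \<union> B) = inversions C A + inversions C B"
proof -
  have "{(a, b). a \<in> C \<and> b \<in> A \<union> B \<and> b < a} =
      {(a, b). a \<in> C \<and> b \<in> A \<and> b < a} \<union> {(a, b). a \<in> C \<and> b \<in> B \<and> b < a}" by auto
  moreover have "finite {(a, b). a \<in> C \<and> b \<in> A \<and> b < a}"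
    by (rule finite_subset[of _ "C \<times> A"]) (use assms in auto)
  moreover have "finite {(a, b). a \<in> C \<and> b \<in> B \<and> b < a}"
    by (rule finite_subset[of _ "C \<times> B"]) (use assms in auto)
  ultimately show ?thesis
    unfolding inversions_def using assms(4) by (subst card_Un_disjoint[symmetric]) auto
qed

lemma inversions_empty [simp]: "inversions {} B = 0" "inversions A {} = 0"
  by (simp_all add: inversions_def)

instantiation grassmann :: (comm_ring_1) ring_1
begin

lift_definition zero_grassmann :: "'a grassmann" is "\<lambda>_. 0" by simp

lift_definition one_grassmann :: "'a grassmann" is "\<lambda>A. if A = {} then 1 else 0" by simp

lift_definition plus_grassmann :: "'a grassmann \<Rightarrow> 'a grassmann \<Rightarrow> 'a grassmann"
  is "\<lambda>f g A. f A + g A"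
proof goal_cases
  case (1 f g)
  then have "finite ({A. f A \<noteq> 0} \<union> {A. g A \<noteq> 0})" by simp
  then have "finite {A. f A + g A \<noteq> 0}" by (rule rev_finite_subset) auto
  with 1 show ?case by (metis (lifting) add_0_left)
qed

lift_definition uminus_grassmann :: "'a grassmann \<Rightarrow> 'a grassmann" is "\<lambda>f A. - f A" by simp

lift_definition minus_grassmann :: "'a grassmann \<Rightarrow> 'a grassmann \<Rightarrow> 'a grassmann"
  is "\<lambda>f g A. f A - g A"
proof goal_cases
  case (1 f g)
  then have "finite ({A. f A \<noteq> 0} \<union> {A. g A \<noteq> 0})" by simp
  then have "finite {A. f A - g A \<noteq> 0}" by (rule rev_finite_subset) auto
  with 1 show ?case by (metis (lifting) diff_self)
qed

lift_definition times_grassmann :: "'a grassmann \<Rightarrow> 'a grassmann \<Rightarrow> 'a grassmann"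
  is "\<lambda>f g S. \<Sum>A\<in>Pow S. (- 1) ^ inversions A (S - A) * f A * g (S - A)"
proof goal_cases
  case (1 f g)
  let ?h = "\<lambda>S. \<Sum>A\<in>Pow S. (- 1) ^ inversions A (S - A) * f A * g (S - A)"
  have nz: "\<exists>A\<subseteq>S. f A \<noteq> 0 \<and> g (S - A) \<noteq> 0" if "?h S \<noteq> 0" for S
  proof (rule ccontr)
    assume "\<not> ?thesis"
    then have "?h S = 0" by (intro sum.neutral) auto
    with that show False by simp
  qed
  have "finite ((\<lambda>(A, B). A \<union> B) ` ({A. f A \<noteq> 0} \<times> {A. g A \<noteq> 0}))" using 1 by simp
  moreover have "{S. ?h S \<noteq> 0} \<subseteq> (\<lambda>(A, B). A \<union> B) ` ({A. f A \<noteq> 0} \<times> {A. g A \<noteq> 0})"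
  proof
    fix S assume "S \<in> {S. ?h S \<noteq> 0}"
    then obtain A where "A \<subseteq> S" "f A \<noteq> 0" "g (S - A) \<noteq> 0" using nz by blast
    then show "S \<in> (\<lambda>(A, B). A \<union> B) ` ({A. f A \<noteq> 0} \<times> {A. g A \<noteq> 0})"
      by (intro image_eqI[of _ _ "(A, S - A)"]) auto
  qed
  ultimately have "finite {S. ?h S \<noteq> 0}" by (rule finite_subset[rotated])
  moreover have "finite S" if S: "?h S \<noteq> 0" for S
  proof -
    obtain A where "A \<subseteq> S" "f A \<noteq> 0" "g (S - A) \<noteq> 0" using nz[OF S] by blast
    with 1 have "finite A" "finite (S - A)" by auto
    with \<open>A \<subseteq> S\<close> show ?thesis by (metis Diff_partition finite_UnI)
  qed
  ultimately show ?case by blast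
qed

instance
proof
  fix a b c :: "'a grassmann"
  show "a + b + c = a + (b + c)" by transfer (simp add: add.assoc)
  show "a + b = b + a" by transfer (simp add: add.commute)
  show "0 + a = a" by transfer simp
  show "- a + a = 0" by transfer simp
  show "a - b = a + - b" by transfer simp
  show "(a + b) * c = a * c + b * c"
    by transfer (simp add: algebra_simps sum.distrib)
  show "a * (b + c) = a * b + a * c"
    by transfer (simp add: algebra_simps sum.distrib)
  show "(0::'a grassmann) \<noteq> 1" by transfer (metis zero_neq_one)
  show "1 * a = a"
  proof transfer
    fix a :: "nat set \<Rightarrow> 'a"
    assume a: "finite {A. a A \<noteq> 0} \<and> (\<forall>A. a A \<noteq> 0 \<longrightarrow> finite A)"
    have "(\<Sum>A\<in>Pow S. (- 1) ^ inversions A (S - A) * (if A = {} then 1 else 0) * a (S - A)) = a S" for S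
    proof (cases "finite S")
      case True
      have "(\<Sum>A\<in>Pow S. (- 1) ^ inversions A (S - A) * (if A = {} then 1 else 0) * a (S - A))
          = (\<Sum>A\<in>Pow S. if A = {} then a S else 0)" by (rule sum.cong) auto
      also have "\<dots> = a S" using True by (subst sum.delta) auto
      finally show ?thesis .
    qed (use a in auto)
    then show "(\<lambda>S. \<Sum>A\<in>Pow S. (- 1) ^ inversions A (S - A) * (if A = {} then 1 else 0) * a (S - A)) = a" by auto
  qed
  show "a * 1 = a"
  proof transfer
    fix a :: "nat set \<Rightarrow> 'a"
    assume a: "finite {A. a A \<noteq> 0} \<and> (\<forall>A. a A \<noteq> 0 \<longrightarrow> finite A)"
    have "(\<Sum>A\<in>Pow S. (- 1) ^ inversions A (S - A) * a A * (if S - A = {} then 1 else 0)) = a S" for S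
    proof (cases "finite S")
      case True
      have "(\<Sum>A\<in>Pow S. (- 1) ^ inversions A (S - A) * a A * (if S - A = {} then 1 else 0))
          = (\<Sum>A\<in>Pow S. if A = S then a S else 0)" by (rule sum.cong) auto
      also have "\<dots> = a S" using True by (subst sum.delta) auto
      finally show ?thesis .
    qed (use a in auto)
    then show "(\<lambda>S. \<Sum>A\<in>Pow S. (- 1) ^ inversions A (S - A) * a A * (if S - A = {} then 1 else 0)) = a" by auto
  qed
  show "a * b * c = a * (b * c)"
  proof transfer
    fix f g h :: "nat set \<Rightarrow> 'a"
    let ?s = "\<lambda>A B. (- 1 :: 'a) ^ inversions A B"
    have "(\<Sum>C\<in>Pow S. ?s C (S - C) * (\<Sum>A\<in>Pow C. ?s A (C - A) * f A * g (C - A)) * h (S - C)) =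
          (\<Sum>A\<in>Pow S. ?s A (S - A) * f A *
             (\<Sum>B\<in>Pow (S - A). ?s B (S - A - B) * g B * h (S - A - B)))" for S
    proof (cases "finite S")
      case fin: True
      have sgn: "?s C (S - C) * ?s A (C - A) = ?s A (S - A) * ?s (C - A) (S - C)"
        if "C \<subseteq> S" "A \<subseteq> C" for A C
      proof -
        have f: "finite A" "finite (C - A)" "finite (S - C)"
          using fin that by (auto intro: finite_subset)
        have "inversions C (S - C) = inversions A (S - C) + inversions (C - A) (S - C)"
          using inversions_Un_left[OF f] that by (metis Diff_disjoint Diff_partition)
        moreover have "S - A = (C - A) \<union> (S - C)" using that by auto
        then have "inversions A (S - A) = inversions A (C - A) + inversions A (S - C)"
          using inversions_Un_right[OF f(2,3,1)] by (simp add: Diff_Int_distrib) blast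
        ultimately show ?thesis by (simp add: power_add algebra_simps)
      qed
      have "(\<Sum>C\<in>Pow S. ?s C (S - C) * (\<Sum>A\<in>Pow C. ?s A (C - A) * f A * g (C - A)) * h (S - C)) =
        (\<Sum>C\<in>Pow S. \<Sum>A\<in>Pow C. (?s C (S - C) * ?s A (C - A)) * (f A * g (C - A) * h (S - C)))"
        by (simp add: sum_distrib_left sum_distrib_right algebra_simps)
      also have "\<dots> = (\<Sum>(C, A)\<in>(SIGMA C:Pow S. Pow C).
          (?s C (S - C) * ?s A (C - A)) * (f A * g (C - A) * h (S - C)))"
        using fin by (subst sum.Sigma) (auto intro: finite_subset)
      also have "\<dots> = (\<Sum>(A, B)\<in>(SIGMA A:Pow S. Pow (S - A)).
          (?s A (S - A) * ?s B (S - A - B)) * (f A * g B * h (S - A - B)))"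
      proof (rule sum.reindex_bij_witness[of _ "\<lambda>(A, B). (A \<union> B, A)" "\<lambda>(C, A). (A, C - A)"], goal_cases)
        case (5 x)
        then obtain C A where x: "x = (C, A)" "C \<subseteq> S" "A \<subseteq> C" by auto
        then have "S - A - (C - A) = S - C" by auto
        with sgn[OF x(2,3)] show ?case by (simp add: x(1))
      qed auto
      also have "\<dots> = (\<Sum>A\<in>Pow S. \<Sum>B\<in>Pow (S - A).
          (?s A (S - A) * ?s B (S - A - B)) * (f A * g B * h (S - A - B)))"
        using fin by (subst sum.Sigma) auto
      also have "\<dots> = (\<Sum>A\<in>Pow S. ?s A (S - A) * f A *
             (\<Sum>B\<in>Pow (S - A). ?s B (S - A - B) * g B * h (S - A - B)))"
        by (simp add: sum_distrib_left algebra_simps)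
      finally show ?thesis .
    qed auto
    then show "(\<lambda>S. \<Sum>C\<in>Pow S. ?s C (S - C) *
          (\<Sum>A\<in>Pow C. ?s A (C - A) * f A * g (C - A)) * h (S - C)) =
       (\<lambda>S. \<Sum>A\<in>Pow S. ?s A (S - A) * f A *
          (\<Sum>B\<in>Pow (S - A). ?s B (S - A - B) * g B * h (S - A - B)))" by blast
  qed
qed

end

lift_definition scal :: "'k::zero \<Rightarrow> 'k grassmann" is "\<lambda>c A. if A = {} then c else 0" by simp

lift_definition gen :: "nat \<Rightarrow> 'k::zero_neq_one grassmann" is "\<lambda>m A. if A = {m} then 1 else 0"
  by simp

lemma coeff_gen_gen:
  "coeff (gen a * gen b :: 'k::comm_ring_1 grassmann) S =
     (if a \<noteq> b \<and> S = {a, b} then if b < a then - 1 else 1 else 0)"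
proof -
  have eq: "coeff (gen a * gen b :: 'k grassmann) S =
      (\<Sum>A\<in>Pow S. if A = {a} then if S - {a} = {b} then (- 1) ^ inversions {a} {b} else 0 else 0)"
    unfolding times_grassmann.rep_eq gen.rep_eq by (rule sum.cong) auto
  have inv: "inversions {a} {b} = (if b < a then 1 else 0)"
  proof -
    have "{(x, y). x \<in> {a} \<and> y \<in> {b} \<and> y < x} = (if b < a then {(a, b)} else {})" by auto
    then show ?thesis unfolding inversions_def by simp
  qed
  show ?thesis
  proof (cases "finite S")
    case True
    then have "coeff (gen a * gen b :: 'k grassmann) S =
        (if a \<in> S \<and> S - {a} = {b} then (- 1) ^ inversions {a} {b} else 0)"
      unfolding eq by (subst sum.delta) auto
    moreover have "a \<in> S \<and> S - {a} = {b} \<longleftrightarrow> a \<noteq> b \<and> S = {a, b}" by auto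
    ultimately show ?thesis by (auto simp: inv)
  qed (auto simp: eq)
qed

lemma gen_anticommute: "gen a * gen b = - (gen b * gen a :: 'k::comm_ring_1 grassmann)"
proof -
  have "coeff (gen a * gen b :: 'k grassmann) = coeff (- (gen b * gen a))"
    by (rule ext) (auto simp: coeff_gen_gen uminus_grassmann.rep_eq insert_commute)
  then show ?thesis by (simp add: coeff_inject)
qed

lemma gen_square: "gen a * gen a = (0 :: 'k::comm_ring_1 grassmann)"
proof -
  have "coeff (gen a * gen a :: 'k grassmann) = coeff 0"
    by (rule ext) (simp add: coeff_gen_gen zero_grassmann.rep_eq)
  then show ?thesis by (simp add: coeff_inject)
qed

instantiation grassmann :: (comm_ring_1) inverse
begin

definition inverse_grassmann :: "'a grassmann \<Rightarrow> 'a grassmann" where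
  "inverse (x :: 'a grassmann) = (if \<exists>y. x * y = 1 \<and> y * x = 1 then THE y. x * y = 1 \<and> y * x = 1 else 0)"

definition divide_grassmann :: "'a grassmann \<Rightarrow> 'a grassmann \<Rightarrow> 'a grassmann" where
  "x div y = x * inverse (y :: 'a grassmann)"

instance ..

end

definition even_elem :: "'k::zero grassmann \<Rightarrow> bool" where
  "even_elem x \<longleftrightarrow> (\<forall>A. coeff x A \<noteq> 0 \<longrightarrow> even (card A))"

definition body :: "'k::zero grassmann \<Rightarrow> 'k" where
  "body x = coeff x {}"

text \<open>
  The square root of an even element with positive body: the binomial series in its nilpotent
  part terminates, and requiring a positive body fixes the sign.
\<close>

definition gsqrt :: "'k::sqrt_field grassmann \<Rightarrow> 'k grassmann" where
  "gsqrt x = (THE y. even_elem y \<and> 0 < body y \<and> y * y = x)"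

text \<open>
  The vertices of the N-gon are 0, ..., N - 1, numbered counterclockwise. Edges are two-element
  sets of vertices and triangles are three-element sets.
\<close>

definition ccw :: "nat \<Rightarrow> nat \<Rightarrow> nat \<Rightarrow> bool" where
  "ccw a b c \<longleftrightarrow> a < b \<and> b < c \<or> b < c \<and> c < a \<or> c < a \<and> a < b"

text \<open>
  Since the vertices are in convex position, ccw s v t says that v lies strictly to the right of
  the line from s to t.
\<close>

definition sides :: "nat \<Rightarrow> nat set set" where
  "sides N = {{a, Suc a} | a. Suc a < N} \<union> {{0, N - 1}}"

definition diagonals :: "nat \<Rightarrow> nat set set" where
  "diagonals N = {{a, b} | a b. a < N \<and> b < N \<and> a \<noteq> b} - sides N"

definition crosses :: "nat set \<Rightarrow> nat set \<Rightarrow> bool" where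
  "crosses e f \<longleftrightarrow> (\<exists>a b c d. e = {a, b} \<and> f = {c, d} \<and> ccw a c b \<and> ccw b d a)"

definition triangulation :: "nat \<Rightarrow> nat set set \<Rightarrow> bool" where
  "triangulation N T \<longleftrightarrow> T \<subseteq> diagonals N \<and> (\<forall>e\<in>T. \<forall>f\<in>T. \<not> crosses e f) \<and>
     (\<forall>d\<in>diagonals N. (\<forall>e\<in>T. \<not> crosses d e) \<longrightarrow> d \<in> T)"

text \<open>
  A decorated triangulation. Each edge e is oriented towards its endpoint \<open>head e\<close>;
  \<open>lam\<close> gives the lambda-lengths of the edges and \<open>mu\<close> the mu-invariants of the triangles. Only
  the values at sides, at members of \<open>diags\<close> and at triangles of the triangulation are meaningful.
  The orientation of a side never influences a lambda-length or mu-invariant.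
\<close>

record (overloaded) 'k decorated =
  diags :: "nat set set"
  head :: "nat set \<Rightarrow> nat"
  lam :: "nat set \<Rightarrow> 'k grassmann"
  mu :: "nat set \<Rightarrow> 'k grassmann"

text \<open>
  The flipped diagonal is directed from l (left) to r (right); t and s are the top and bottom
  vertices of the quadrilateral.
\<close>

definition flip :: "nat \<Rightarrow> 'k::sqrt_field decorated \<Rightarrow> 'k decorated \<Rightarrow> bool" where
  "flip N D D' \<longleftrightarrow> (\<exists>l r s t.
     {l, r} \<in> diags D \<and> head D {l, r} = r \<and> ccw l s r \<and> ccw r t l \<and>
     {{l, t}, {t, r}, {r, s}, {s, l}} \<subseteq> diags D \<union> sides N \<and>
     (let a = lam D {l, t}; b = lam D {t, r}; c = lam D {r, s}; d = lam D {s, l};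
          e = lam D {l, r}; \<theta> = mu D {l, r, t}; \<sigma> = mu D {l, r, s};
          f = (a * c + b * d + gsqrt (a * b * c * d) * \<sigma> * \<theta>) / e
      in D' = \<lparr>diags = insert {s, t} (diags D - {{l, r}}),
               head = (head D)({s, t} := t,
                               {t, r} := (if head D {t, r} = t then r else t)),
               lam = (lam D)({s, t} := f),
               mu = (mu D)({l, s, t} := (\<theta> * gsqrt (b * d) + \<sigma> * gsqrt (a * c)) / gsqrt (e * f),
                           {r, s, t} := (\<sigma> * gsqrt (b * d) - \<theta> * gsqrt (a * c)) / gsqrt (e * f))\<rparr>))"

definition super_lambda :: "nat \<Rightarrow> 'k::sqrt_field decorated \<Rightarrow> nat set \<Rightarrow> 'k grassmann" where
  "super_lambda N D e = (THE x. \<exists>D'. (flip N)\<^sup>*\<^sup>* D D' \<and> e \<in> diags D' \<and> lam D' e = x)"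

datatype step = Rt | Up

datatype side = Lft | Bot | Top | Rgt

type_synonym point = "nat \<times> nat"

text \<open>
  The tiles of the snake graph of a word w are numbered from 1; tile m is the unit square whose
  bottom-left corner is \<open>tile_pos w m\<close>. Edges of the grid are pairs (starting point, end point),
  directed right or up.
\<close>

definition tile_pos :: "(nat \<Rightarrow> step) \<Rightarrow> nat \<Rightarrow> point" where
  "tile_pos w m = (card {k \<in> {1..<m}. w k = Rt}, card {k \<in> {1..<m}. w k = Up})"

fun side_edge :: "point \<Rightarrow> side \<Rightarrow> point \<times> point" where
  "side_edge (a, b) Lft = ((a, b), (a, Suc b))"
| "side_edge (a, b) Bot = ((a, b), (Suc a, b))"
| "side_edge (a, b) Top = ((a, Suc b), (Suc a, Suc b))"
| "side_edge (a, b) Rgt = ((Suc a, b), (Suc a, Suc b))"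

context
  fixes w :: "nat \<Rightarrow> step" and k :: nat \<comment> \<open>word and number of tiles of a snake graph\<close>
begin

definition snake_edges :: "(point \<times> point) set" where
  "snake_edges = {side_edge (tile_pos w m) s | m s. m \<in> {1..k}}"

definition path_edges :: "point list \<Rightarrow> (point \<times> point) multiset" where
  "path_edges vs = mset (zip vs (tl vs))"

definition lattice_path :: "point list \<Rightarrow> bool" where
  "lattice_path vs \<longleftrightarrow> vs \<noteq> [] \<and> hd vs = (0, 0) \<and>
     last vs = snd (side_edge (tile_pos w k) Top) \<and> set_mset (path_edges vs) \<subseteq> snake_edges"

definition double_paths :: "(point \<times> point) multiset set" where
  "double_paths = {path_edges A + path_edges B | A B. lattice_path A \<and> lattice_path B}"

definition tile_below :: "nat \<Rightarrow> point list \<Rightarrow> bool" where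
  "tile_below m vs \<longleftrightarrow> (case tile_pos w m of (a, b) \<Rightarrow> \<exists>(x, y)\<in>set vs. x \<le> a \<and> Suc b \<le> y)"

definition tile_above :: "nat \<Rightarrow> point list \<Rightarrow> bool" where
  "tile_above m vs \<longleftrightarrow> (case tile_pos w m of (a, b) \<Rightarrow> \<exists>(x, y)\<in>set vs. Suc a \<le> x \<and> y \<le> b)"

definition weakly_above :: "point list \<Rightarrow> point list \<Rightarrow> bool" where
  "weakly_above A B \<longleftrightarrow> (\<forall>m\<in>{1..k}. tile_below m B \<longrightarrow> tile_below m A)"

text \<open>
  The tiles between the two paths of a decomposition of P into non-crossing paths; the
  decomposition is unique up to the order of the two paths.
\<close>

definition tiles_between :: "(point \<times> point) multiset \<Rightarrow> nat set" where
  "tiles_between P = {m \<in> {1..k}. \<exists>A B. lattice_path A \<and> lattice_path B \<and>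
     P = path_edges A + path_edges B \<and> weakly_above A B \<and> tile_below m A \<and> tile_above m B}"

definition cycles :: "(point \<times> point) multiset \<Rightarrow> (nat \<times> nat) set" where
  "cycles P = {(s, t). s \<le> t \<and> {s..t} \<subseteq> tiles_between P \<and>
     s - 1 \<notin> tiles_between P \<and> Suc t \<notin> tiles_between P}"

text \<open>
  Distinct cycles are separated by at least one tile, so no index is contributed twice.
\<close>

definition odd_indices :: "(point \<times> point) multiset \<Rightarrow> nat set" where
  "odd_indices P = (\<Union>(s, t)\<in>cycles P. {s, Suc t})"

text \<open>
  For the labels of the dual snake graph, neighbouring tiles agree on their common edge.
\<close>

definition edge_label :: "(nat \<Rightarrow> side \<Rightarrow> 'l) \<Rightarrow> point \<times> point \<Rightarrow> 'l" where
  "edge_label lab e = (THE l. \<exists>m\<in>{1..k}. \<exists>s. e = side_edge (tile_pos w m) s \<and> l = lab m s)"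

definition weight ::
    "(nat \<Rightarrow> side \<Rightarrow> 'k::sqrt_field) \<Rightarrow> (nat \<Rightarrow> nat \<Rightarrow> bool) \<Rightarrow> (point \<times> point) multiset \<Rightarrow> 'k grassmann"
  where
  "weight lab gt P = scal (\<Prod>e\<in>#P. psqrt (edge_label lab e)) *
     prod_list (map gen (THE ms. set ms = odd_indices P \<and> sorted_wrt gt ms))"

end

text \<open>
  The triangulated polygon has n triangles, i is drawn at the bottom and j at the top, and
  the arc from i to j crosses the diagonals \<open>{p 1, q 1}, \<dots>, {p (n - 1), q (n - 1)}\<close> in this
  order, where the endpoints \<open>p m\<close> lie to its left and the \<open>q m\<close> to its right.
\<close>

context
  fixes n i j :: nat and p q :: "nat \<Rightarrow> nat"
begin

definition diag :: "nat \<Rightarrow> nat set" where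
  "diag m = {p m, q m}"

definition crossing_sequence :: "nat set set \<Rightarrow> bool" where
  "crossing_sequence T \<longleftrightarrow> T = diag ` {1..<n} \<and>
     (\<forall>m\<in>{1..<n}. ccw i (q m) j \<and> ccw j (p m) i) \<and>
     (\<forall>m\<in>{1..<n}. \<forall>m'\<in>{1..<n}. m < m' \<longrightarrow> diag m \<noteq> diag m' \<and>
        (q m = q m' \<or> ccw i (q m) (q m')) \<and> (p m = p m' \<or> ccw (p m') (p m) i))"

text \<open>
  Consecutive crossed diagonals share an endpoint and bound a triangle together with the third
  side joining their other endpoints.
\<close>

definition triangle :: "nat \<Rightarrow> nat set" where
  "triangle m = (if m = 1 then {i} else diag (m - 1)) \<union> (if m = n then {j} else diag m)"

text \<open>
  The argument c is the chosen endpoint of the only diagonal in the case n = 2, and is irrelevant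
  otherwise.
\<close>

definition fan_center :: "nat \<Rightarrow> nat \<Rightarrow> nat" where
  "fan_center c m = (if n = 2 then c
     else let m' = (if m = 1 then 2 else if m = n then n - 1 else m)
          in THE v. v \<in> diag (m' - 1) \<inter> diag m')"

definition fan_centers :: "nat \<Rightarrow> nat list" where
  "fan_centers c = remdups_adj (map (fan_center c) [1..<n + 1])"

definition default_orientation :: "nat \<Rightarrow> (nat set \<Rightarrow> nat) \<Rightarrow> bool" where
  "default_orientation c h \<longleftrightarrow> (let cs = fan_centers c in
     (\<forall>m\<in>{1..<n}. h (diag m) \<in> diag m) \<and>
     (\<forall>s. Suc s < length cs \<longrightarrow> h {cs ! s, cs ! Suc s} = cs ! Suc s) \<and>
     (\<forall>m\<in>{1..<n}. (\<forall>s. Suc s < length cs \<longrightarrow> diag m \<noteq> {cs ! s, cs ! Suc s}) \<longrightarrow>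
        h (diag m) \<notin> set cs))"

definition apex_before :: "nat \<Rightarrow> nat" where
  "apex_before m = (THE u. u \<in> triangle m - diag m)"

definition apex_after :: "nat \<Rightarrow> nat" where
  "apex_after m = (THE v. v \<in> triangle (Suc m) - diag m)"

definition preceding_on_right :: "(nat set \<Rightarrow> nat) \<Rightarrow> nat \<Rightarrow> bool" where
  "preceding_on_right h m \<longleftrightarrow>
     (\<exists>s t. diag m = {s, t} \<and> h (diag m) = t \<and> ccw s (apex_before m) t)"

definition positive_order :: "(nat set \<Rightarrow> nat) \<Rightarrow> nat \<Rightarrow> nat \<Rightarrow> bool" \<comment> \<open>first index is greater\<close>
  where
  "positive_order h m s \<longleftrightarrow>
     m < s \<and> preceding_on_right h m \<or> s < m \<and> \<not> preceding_on_right h s"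

fun snake_label :: "nat \<Rightarrow> side \<Rightarrow> nat set" where
  "snake_label m Lft = {apex_before m, if odd m then p m else q m}"
| "snake_label m Bot = {apex_before m, if odd m then q m else p m}"
| "snake_label m Top = {if odd m then p m else q m, apex_after m}"
| "snake_label m Rgt = {if odd m then q m else p m, apex_after m}"

definition third_side :: "nat \<Rightarrow> nat set" where
  "third_side m = (THE e. e \<subseteq> triangle (Suc m) \<and> card e = 2 \<and> e \<noteq> diag m \<and> e \<noteq> diag (Suc m))"

definition snake_word :: "nat \<Rightarrow> step" where
  "snake_word m = (if snake_label m Rgt = third_side m then Rt else Up)"

definition dual_word :: "nat \<Rightarrow> step" where
  "dual_word m = (if odd m then (case snake_word m of Rt \<Rightarrow> Up | Up \<Rightarrow> Rt) else snake_word m)"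

definition dual_label :: "nat \<Rightarrow> side \<Rightarrow> nat set" where
  "dual_label m s = snake_label m
     (if odd m then (case s of Top \<Rightarrow> Rgt | Rgt \<Rightarrow> Top | _ \<Rightarrow> s)
      else (case s of Bot \<Rightarrow> Lft | Lft \<Rightarrow> Bot | _ \<Rightarrow> s))"

end

end

theory Submission
  imports Defs
begin

text \<open>
  Two facts are combined: the super lambda-length of an edge is the same in every decorated
  triangulation reached by flips, and one particular sequence of flips computes the sum over
  double paths one tile at a time.

  Invariance is proved by a super analogue of light-cone vectors. To every vertex v of the polygon
  a vector V v with two even coordinates and one odd coordinate is attached. On such
  vectors there are the OSp(1|2)-invariant bracket and a cubic odd invariant of three vectors. A
  decorated triangulation is realized by V if its lambda-lengths are the brackets of the vectors at
  the ends of the edges and its mu-invariants are, up to a sign for each triangle, the normalized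
  odd invariants. The ratio of the signs of two adjacent triangles is prescribed by the orientation
  of their common diagonal. A flip preserves realization by the same vectors
  (\<open>flip_realized\<close>): the flip formulas are polynomial identities between brackets and odd
  invariants (\<open>super_identities\<close>), and the change of orientation in a flip is the change of the
  signs (\<open>spin_signs_flip\<close>). Hence the lambda-length of an edge is a bracket and
  depends only on V (\<open>super_lambda_eqI\<close>). The given triangulation is realized by some V, since its
  triangles form a strip, and the vector at each new vertex is found by solving linear equations
  (\<open>realization_exists\<close>).

  For the computation, the crossed diagonals \<open>x\<^sub>n\<^sub>-\<^sub>1, \<dots>, x\<^sub>1\<close> are flipped in this order. After the
  flips of all diagonals beyond \<open>x\<^sub>m = (p, q)\<close> the triangle p, q, j is present; its data are
  \<open>A = \<lambda>(p, j)\<close>, \<open>B = \<lambda>(q, j)\<close> and its mu-invariant Z. The flip of \<open>x\<^sub>m\<close> turns the triple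
  \<open>(A, \<surd>A \<surd>B Z, B)\<close> into the corresponding triple for \<open>x\<^sub>m\<^sub>-\<^sub>1\<close> by a linear map with three
  states (\<open>flip_towards_start\<close>, \<open>transfer_algebra\<close>).

  On the other side, a lattice path is determined by the tiles above which it runs, so a double
  path is a function f from the tiles to {0, 1, 2}, where f counts the paths
  passing above the tile, subject to a monotonicity condition between neighbouring tiles
  (\<open>double_paths_eq\<close>). The cycles are the runs of the value 1. The sum of the weights is therefore a
  product of transfer matrices with the same three states (\<open>partial_sum_step\<close>). When the tiles are
  added from the last to the first, a new odd variable has the smallest index so far, so in the
  positive order it comes first or last. Moving it to the front costs a sign precisely when it comes
  last and the product of the others is odd. This is the sign with which the mu-invariant of the
  triangle in front of \<open>x\<^sub>m\<close> enters the flip of \<open>x\<^sub>m\<close>; the default orientation ensures that the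
  triangle retained for the next flip is the one to the left of the new diagonal, whose mu-invariant is
  given by a formula without signs.
\<close>

section \<open>Even and odd elements of the Grassmann algebra\<close>

lemma coeff_mult:
  "coeff (x * y) S = (\<Sum>A\<in>Pow S. (- 1) ^ inversions A (S - A) * coeff x A * coeff y (S - A))"
  by (simp add: times_grassmann.rep_eq)

lemma coeff_infinite: "infinite A \<Longrightarrow> coeff x A = 0"
  using coeff[of x] by auto

lemma grassmann_eqI:
  assumes "\<And>A. finite A \<Longrightarrow> coeff x A = coeff y A"
  shows "x = y"
proof -
  have "coeff x = coeff y" using assms coeff_infinite by (metis ext)
  then show ?thesis by (simp add: coeff_inject)
qed

lemma coeff_mult_nonzero:
  assumes "coeff (x * y) S \<noteq> 0"
  obtains A where "A \<subseteq> S" "finite S" "coeff x A \<noteq> 0" "coeff y (S - A) \<noteq> 0"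
proof -
  have "\<exists>A\<in>Pow S. (- 1) ^ inversions A (S - A) * coeff x A * coeff y (S - A) \<noteq> 0"
    using assms unfolding coeff_mult by (meson sum.not_neutral_contains_not_neutral)
  then show ?thesis using that assms coeff_infinite by (metis PowD mult_zero_left mult_zero_right)
qed

text \<open>
  Each pair in \<open>A \<times> B\<close> is an inversion for exactly one of the two orders of the factors.
\<close>

lemma inversions_swap:
  assumes "finite A" "finite B" "A \<inter> B = {}"
  shows "inversions A B + inversions B A = card A * card B"
proof -
  let ?X = "{(a, b). a \<in> A \<and> b \<in> B \<and> b < a}" and ?Y = "{(a, b). a \<in> A \<and> b \<in> B \<and> a < b}"
  have "A \<times> B = ?X \<union> ?Y" using assms(3) by (auto simp: disjoint_iff) (metis linorder_less_linear)
  moreover have "finite ?X" "finite ?Y"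
    by (rule finite_subset[of _ "A \<times> B"], use assms in auto)+
  then have "card (?X \<union> ?Y) = card ?X + card ?Y" by (rule card_Un_disjoint) auto
  moreover have "card ?Y = inversions B A"
    unfolding inversions_def by (rule bij_betw_same_card[of prod.swap]) (auto simp: bij_betw_def inj_on_def)
  ultimately show ?thesis
    unfolding inversions_def by (simp flip: card_cartesian_product)
qed

lemma coeff_mult_swap:
  "coeff (y * x) S = (\<Sum>A\<in>Pow S. (- 1) ^ inversions (S - A) A * coeff y (S - A) * coeff x A)"
  unfolding coeff_mult
  by (rule sum.reindex_bij_witness[of _ "\<lambda>A. S - A" "\<lambda>A. S - A"]) (auto simp: double_diff)

definition odd_elem :: "'k::zero grassmann \<Rightarrow> bool" where
  "odd_elem x \<longleftrightarrow> (\<forall>A. coeff x A \<noteq> 0 \<longrightarrow> odd (card A))"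

lemma minus_one_power_inversions:
  assumes "finite S" "A \<subseteq> S" "even (card A) \<or> even (card (S - A))"
  shows "(- 1 :: 'k::comm_ring_1) ^ inversions A (S - A) = (- 1) ^ inversions (S - A) A"
proof -
  have "inversions A (S - A) + inversions (S - A) A = card A * card (S - A)"
    using assms by (intro inversions_swap) (auto intro: finite_subset)
  then have "even (inversions A (S - A)) = even (inversions (S - A) A)"
    using assms(3) by (metis even_add even_mult_iff)
  then show ?thesis by (simp add: minus_one_power_iff)
qed

lemma minus_one_power_inversions_odd:
  assumes "finite S" "A \<subseteq> S" "odd (card A)" "odd (card (S - A))"
  shows "(- 1 :: 'k::comm_ring_1) ^ inversions A (S - A) = - ((- 1) ^ inversions (S - A) A)"
proof -
  have "inversions A (S - A) + inversions (S - A) A = card A * card (S - A)"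
    using assms by (intro inversions_swap) (auto intro: finite_subset)
  then have "even (inversions A (S - A)) \<noteq> even (inversions (S - A) A)"
    using assms(3,4) by (metis even_add even_mult_iff)
  then show ?thesis by (simp add: minus_one_power_iff)
qed

lemma even_commute:
  assumes "even_elem (x :: 'k::comm_ring_1 grassmann)"
  shows "x * y = y * x"
proof (rule grassmann_eqI)
  fix S :: "nat set" assume "finite S"
  then show "coeff (x * y) S = coeff (y * x) S"
    unfolding coeff_mult_swap[of y x] unfolding coeff_mult
  proof (intro sum.cong refl, goal_cases)
    case (1 A)
    show ?case
    proof (cases "coeff x A = 0")
      case False
      then have "even (card A)" using assms by (auto simp: even_elem_def)
      then show ?thesis using 1 minus_one_power_inversions[of S A, where 'k='k] by (simp add: algebra_simps)
    qed simp
  qed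
qed

lemma odd_anticommute:
  assumes "odd_elem (x :: 'k::comm_ring_1 grassmann)" "odd_elem y"
  shows "x * y = - (y * x)"
proof (rule grassmann_eqI)
  fix S :: "nat set" assume "finite S"
  have "coeff (x * y) S =
      (\<Sum>A\<in>Pow S. - ((- 1) ^ inversions (S - A) A * coeff y (S - A) * coeff x A))"
    unfolding coeff_mult
  proof (intro sum.cong refl, goal_cases)
    case (1 A)
    show ?case
    proof (cases "coeff x A = 0 \<or> coeff y (S - A) = 0")
      case False
      then have "odd (card A)" "odd (card (S - A))" using assms by (auto simp: odd_elem_def)
      then have sgn: "(- 1 :: 'k) ^ inversions A (S - A) = - ((- 1) ^ inversions (S - A) A)"
        using 1 \<open>finite S\<close> by (intro minus_one_power_inversions_odd) auto
      show ?thesis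
        unfolding sgn by (simp only: mult_minus_left mult.assoc mult.commute[of "coeff x A"])
    qed auto
  qed
  then show "coeff (x * y) S = coeff (- (y * x)) S"
    by (simp add: uminus_grassmann.rep_eq coeff_mult_swap[of y x] sum_negf)
qed

text \<open>
  Anticommuting with itself forces the square to be its own negative, and the coefficients have
  characteristic zero.
\<close>

lemma odd_square:
  assumes "odd_elem (x :: 'k::linordered_idom grassmann)"
  shows "x * x = 0"
proof (rule grassmann_eqI)
  fix A
  have "coeff (x * x) A = - coeff (x * x) A"
    using arg_cong[OF odd_anticommute[OF assms assms], of "\<lambda>y. coeff y A"]
    by (simp add: uminus_grassmann.rep_eq)
  then show "coeff (x * x) A = coeff 0 A" by (simp add: zero_grassmann.rep_eq)
qed

lemma card_Diff_parity:
  assumes "finite S" "A \<subseteq> S"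
  shows "even (card S) \<longleftrightarrow> (even (card A) \<longleftrightarrow> even (card (S - A)))"
  using assms by (metis card_Diff_subset card_mono even_add finite_subset le_add_diff_inverse)

lemma parity_mult:
  fixes x y :: "'k::comm_ring_1 grassmann"
  shows even_even: "even_elem x \<Longrightarrow> even_elem y \<Longrightarrow> even_elem (x * y)"
    and odd_odd: "odd_elem x \<Longrightarrow> odd_elem y \<Longrightarrow> even_elem (x * y)"
    and even_odd: "even_elem x \<Longrightarrow> odd_elem y \<Longrightarrow> odd_elem (x * y)"
    and odd_even: "odd_elem x \<Longrightarrow> even_elem y \<Longrightarrow> odd_elem (x * y)"
  unfolding even_elem_def odd_elem_def
  by (metis coeff_mult_nonzero card_Diff_parity)+

lemma parity_add:
  fixes x y :: "'k::comm_ring_1 grassmann"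
  shows even_add_elem: "even_elem x \<Longrightarrow> even_elem y \<Longrightarrow> even_elem (x + y)"
    and odd_add_elem: "odd_elem x \<Longrightarrow> odd_elem y \<Longrightarrow> odd_elem (x + y)"
    and even_uminus: "even_elem x \<Longrightarrow> even_elem (- x)"
    and odd_uminus: "odd_elem x \<Longrightarrow> odd_elem (- x)"
    and even_diff: "even_elem x \<Longrightarrow> even_elem y \<Longrightarrow> even_elem (x - y)"
    and odd_diff: "odd_elem x \<Longrightarrow> odd_elem y \<Longrightarrow> odd_elem (x - y)"
  unfolding even_elem_def odd_elem_def
    plus_grassmann.rep_eq uminus_grassmann.rep_eq minus_grassmann.rep_eq
  by (metis add_0 neg_equal_0_iff_equal diff_0 diff_zero)+

lemma parity_const:
  "even_elem (0 :: 'k::comm_ring_1 grassmann)" "even_elem (1 :: 'k grassmann)"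
  "even_elem (scal c)" "odd_elem (gen m :: 'k grassmann)"
  by (auto simp: even_elem_def odd_elem_def zero_grassmann.rep_eq one_grassmann.rep_eq
      scal.rep_eq gen.rep_eq)

lemmas parity = parity_mult parity_add parity_const

lemma body_simps:
  fixes x y :: "'k::comm_ring_1 grassmann"
  shows "body (x + y) = body x + body y" "body (x - y) = body x - body y"
    "body (x * y) = body x * body y" "body (1 :: 'k grassmann) = 1" "body (scal c) = c"
    "body (- x) = - body x" "odd_elem x \<Longrightarrow> body x = 0"
  by (auto simp: body_def plus_grassmann.rep_eq minus_grassmann.rep_eq coeff_mult
      one_grassmann.rep_eq scal.rep_eq uminus_grassmann.rep_eq odd_elem_def)

lemma coeff_scal_mult: "coeff (scal c * x) A = c * coeff (x :: 'k::comm_ring_1 grassmann) A"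
proof (cases "finite A")
  case True
  have "coeff (scal c * x) A = (\<Sum>B\<in>Pow A. if B = {} then c * coeff x A else 0)"
    unfolding coeff_mult by (rule sum.cong) (auto simp: scal.rep_eq)
  then show ?thesis using True by (simp add: sum.delta')
qed (simp add: coeff_infinite)

lemma scal_mult: "scal (a * b) = scal a * (scal b :: 'k::comm_ring_1 grassmann)"
  by (rule grassmann_eqI) (simp add: coeff_scal_mult scal.rep_eq)

lemma scal_1 [simp]: "scal 1 = (1 :: 'k::comm_ring_1 grassmann)"
  by (rule grassmann_eqI) (simp add: scal.rep_eq one_grassmann.rep_eq)

section \<open>Inverses and square roots\<close>

text \<open>
  The filtration by the number of generators in a monomial: products add the degrees d, and nothing
  nonzero on the finite set U of generators has degree beyond the size of U. Improving an approximate solution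
  degree by degree replaces the geometric and the binomial series.
\<close>

definition filtered :: "nat set \<Rightarrow> nat \<Rightarrow> 'k::zero grassmann \<Rightarrow> bool" where
  "filtered U d x \<longleftrightarrow> (\<forall>A. coeff x A \<noteq> 0 \<longrightarrow> A \<subseteq> U \<and> d \<le> card A)"

lemma filtered_mult:
  fixes x y :: "'k::comm_ring_1 grassmann"
  assumes "filtered U d x" "filtered U e y"
  shows "filtered U (d + e) (x * y)"
  unfolding filtered_def
proof (intro allI impI)
  fix S assume "coeff (x * y) S \<noteq> 0"
  then obtain A where A: "A \<subseteq> S" "finite S" "coeff x A \<noteq> 0" "coeff y (S - A) \<noteq> 0"
    by (rule coeff_mult_nonzero)
  then have "A \<subseteq> U" "d \<le> card A" "S - A \<subseteq> U" "e \<le> card (S - A)"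
    using assms by (auto simp: filtered_def)
  moreover have "card S = card A + card (S - A)"
    using A by (metis card_Diff_subset card_mono finite_subset le_add_diff_inverse)
  ultimately show "S \<subseteq> U \<and> d + e \<le> card S" by auto
qed

lemma filtered_add_diff:
  fixes x y :: "'k::comm_ring_1 grassmann"
  assumes "filtered U d x" "filtered U d y"
  shows "filtered U d (x + y)" "filtered U d (x - y)"
  using assms unfolding filtered_def plus_grassmann.rep_eq minus_grassmann.rep_eq
  by (metis add_0 diff_zero diff_0 neg_equal_0_iff_equal)+

lemma filtered_scal: "filtered U 0 (scal c)"
  by (auto simp: filtered_def scal.rep_eq)

lemma filtered_mono: "filtered U d x \<Longrightarrow> e \<le> d \<Longrightarrow> filtered U e x"
  by (auto simp: filtered_def)

lemma filtered_zero: "finite U \<Longrightarrow> filtered U (Suc (card U)) x \<Longrightarrow> x = 0"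
  by (rule grassmann_eqI) (metis filtered_def zero_grassmann.rep_eq card_mono not_less_eq_eq)

lemma filtered_support:
  obtains U where "finite U" "filtered U 0 (x :: 'k::zero grassmann)"
proof
  show "finite (\<Union>{A. coeff x A \<noteq> 0})" using coeff[of x] by auto
qed (auto simp: filtered_def)

lemma filtered_Suc:
  fixes x :: "'k::comm_ring_1 grassmann"
  assumes "finite U" "filtered U 0 x"  "body x = 0"
  shows "filtered U 1 x"
  using assms unfolding filtered_def body_def
  by (metis card_0_eq finite_subset not_less_eq_eq One_nat_def le_zero_eq)

text \<open>
  Newton-like iteration \<open>y + b (1 - x y)\<close>, where b is the inverse of the body: each step multiplies
  the error \<open>1 - x y\<close> by \<open>1 - x b\<close>, which has no constant term.
\<close>

lemma even_inverse_exists: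
  fixes x :: "'k::field grassmann"
  assumes "even_elem x" "body x \<noteq> 0"
  shows "\<exists>y. even_elem y \<and> x * y = 1"
proof -
  obtain U where U: "finite U" "filtered U 0 x" by (rule filtered_support)
  let ?b = "scal (1 / body x)"
  have "filtered U 1 (1 - x * ?b)"
  proof (rule filtered_Suc[OF U(1)])
    show "filtered U 0 (1 - x * ?b)"
      using filtered_add_diff(2)[OF filtered_scal[of U 1] filtered_mult[OF U(2) filtered_scal, simplified]] by simp
  qed (use assms in \<open>simp add: body_simps\<close>)
  note small = this
  have "\<exists>y. even_elem y \<and> filtered U 0 y \<and> filtered U d (1 - x * y)" for d
  proof (induction d)
    case 0
    have "filtered U 0 (1 :: 'k grassmann)" using filtered_scal[of U "1 :: 'k"] by simp
    moreover have "filtered U 0 (0 :: 'k grassmann)" by (simp add: filtered_def zero_grassmann.rep_eq)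
    ultimately show ?case by (intro exI[of _ 0]) (simp add: parity)
  next
    case (Suc d)
    then obtain y where y: "even_elem y" "filtered U 0 y" "filtered U d (1 - x * y)" by blast
    let ?y = "y + ?b * (1 - x * y)"
    have "1 - x * ?y = (1 - x * ?b) * (1 - x * y)" by (simp add: algebra_simps)
    then have "filtered U (Suc d) (1 - x * ?y)" using filtered_mult[OF small y(3)] by simp
    moreover have "filtered U 0 ?y"
      using filtered_add_diff(1)[OF y(2) filtered_mult[OF filtered_scal filtered_mono[OF y(3)], of 0, simplified]] .
    ultimately show ?case using y(1) assms(1) by (intro exI[of _ ?y]) (simp add: parity)
  qed
  then obtain y where "even_elem y" "filtered U (Suc (card U)) (1 - x * y)" by blast
  then show ?thesis using filtered_zero[OF U(1)] by (metis eq_iff_diff_eq_0)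
qed

definition positive_even :: "'k::sqrt_field grassmann \<Rightarrow> bool" where
  "positive_even x \<longleftrightarrow> even_elem x \<and> 0 < body x"

lemma positive_evenD: "positive_even x \<Longrightarrow> even_elem x"
  by (simp add: positive_even_def)

lemma even_inverse:
  fixes x :: "'k::field grassmann"
  assumes "even_elem x" "body x \<noteq> 0"
  shows "even_elem (inverse x)" "x * inverse x = 1" "inverse x * x = 1"
proof -
  obtain y where y: "even_elem y" "x * y = 1" using even_inverse_exists[OF assms] by blast
  then have y': "y * x = 1" using even_commute by metis
  have "inverse x = y"
    unfolding inverse_grassmann_def
  proof (subst if_P)
    show "(THE y. x * y = 1 \<and> y * x = 1) = y"
    proof (rule the_equality)
      fix z assume "x * z = 1 \<and> z * x = 1"
      then show "z = y" using y y' by (metis mult.assoc mult_1_left mult_1_right)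
    qed (use y y' in auto)
  qed (use y y' in blast)
  then show "even_elem (inverse x)" "x * inverse x = 1" "inverse x * x = 1" using y y' by auto
qed

lemma positive_even_inverse:
  assumes "positive_even x"
  shows "positive_even (inverse x)" "x * inverse x = 1" "inverse x * x = 1"
proof -
  have e: "even_elem x" "body x \<noteq> 0" using assms by (auto simp: positive_even_def)
  note even_inverse[OF e]
  moreover from this have "body x * body (inverse x) = 1" using body_simps by metis
  ultimately show "positive_even (inverse x)" "x * inverse x = 1" "inverse x * x = 1"
    using assms by (auto simp: positive_even_def) (metis zero_less_mult_pos zero_less_one)
qed

lemma positive_even_cancel:
  assumes "positive_even z" "x * z = y * z"
  shows "x = y"
proof -
  have "x * (z * inverse z) = y * (z * inverse z)" using assms(2) by (simp flip: mult.assoc)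
  then show ?thesis by (simp add: positive_even_inverse[OF assms(1)])
qed

lemma positive_even_divide:
  assumes "positive_even z"
  shows "x div z * z = x" "(x div z = y) \<longleftrightarrow> (x = y * z)"
proof -
  show "x div z * z = x" unfolding divide_grassmann_def
    by (simp add: mult.assoc positive_even_inverse[OF assms])
  then show "(x div z = y) \<longleftrightarrow> (x = y * z)" using positive_even_cancel[OF assms] by metis
qed

lemma positive_even_closed:
  fixes x y :: "'k::sqrt_field grassmann"
  shows "positive_even x \<Longrightarrow> positive_even y \<Longrightarrow> positive_even (x * y)"
    "positive_even x \<Longrightarrow> positive_even y \<Longrightarrow> positive_even (x + y)"
    "positive_even (scal c :: 'k grassmann) \<longleftrightarrow> 0 < c"
  by (auto simp: positive_even_def parity body_simps)

lemma psqrt: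
  fixes a :: "'k::sqrt_field" assumes "0 < a"
  shows "0 < psqrt a" "psqrt a * psqrt a = a"
proof -
  have "\<exists>!b. 0 < b \<and> b * b = a"
  proof (rule ex_ex1I)
    obtain b where b: "b * b = a" using ex_sqrt[OF assms] by blast
    then have "b \<noteq> 0" using assms by auto
    then show "\<exists>b. 0 < b \<and> b * b = a" using b
      by (intro exI[of _ "\<bar>b\<bar>"]) (simp add: abs_mult_self_eq)
    show "b = c" if "0 < b \<and> b * b = a" "0 < c \<and> c * c = a" for b c
      using that mult_strict_mono[of b c b c] mult_strict_mono[of c b c b] by (cases b c rule: linorder_cases) auto
  qed
  then show "0 < psqrt a" "psqrt a * psqrt a = a"
    using theI'[of "\<lambda>b. 0 < b \<and> b * b = a"] unfolding psqrt_def by auto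
qed

text \<open>
  From \<open>(y - z) (y + z) = 0\<close>, since the sum of positive even elements is invertible.
\<close>

lemma gsqrt_unique:
  fixes y z :: "'k::sqrt_field grassmann"
  assumes "positive_even y" "positive_even z" "y * y = z * z"
  shows "y = z"
proof -
  have "y * z = z * y" using assms by (simp add: even_commute positive_evenD)
  then have "(y - z) * (y + z) = 0 * (y + z)" using assms(3) by (simp add: algebra_simps)
  then show ?thesis using positive_even_cancel[OF positive_even_closed(2)[OF assms(1,2)]] by fastforce
qed

text \<open>
  Newton iteration with the derivative frozen at its constant term 2 s, s being the root of the body:
  the error is multiplied by an element without constant term in each step.
\<close>

lemma gsqrt_exists:
  fixes x :: "'k::sqrt_field grassmann"
  assumes "positive_even x"
  shows "\<exists>y. positive_even y \<and> y * y = x"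
proof -
  obtain U where U: "finite U" "filtered U 0 x" by (rule filtered_support)
  define s where "s = psqrt (body x)"
  have s: "0 < s" "s * s = body x" using psqrt assms by (auto simp: s_def positive_even_def)
  have "\<exists>y. even_elem y \<and> body y = s \<and> filtered U 0 y \<and> filtered U d (x - y * y)" for d
  proof (induction d)
    case 0
    have "filtered U 0 (x - scal s * scal s)"
      using filtered_add_diff(2)[OF U(2) filtered_mult[OF filtered_scal filtered_scal, simplified]] .
    then show ?case
      by (intro exI[of _ "scal s"]) (simp add: parity body_simps filtered_scal)
  next
    case (Suc d)
    then obtain y where y: "even_elem y" "body y = s" "filtered U 0 y" "filtered U d (x - y * y)"
      by blast
    define \<delta> where "\<delta> = x - y * y"
    define r where "r = (scal (1 / (2 * s)) :: 'k grassmann)"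
    have \<delta>: "even_elem \<delta>" "body \<delta> = 0" "filtered U d \<delta>" "filtered U 0 \<delta>"
      using y assms s filtered_mono[OF y(4)]
      by (auto simp: \<delta>_def positive_even_def parity body_simps)
    have r: "even_elem r" "filtered U 0 r" by (auto simp: r_def parity filtered_scal)
    let ?y = "y + r * \<delta>"
    have comm: "\<And>z. z * r = r * z" "\<And>z. z * \<delta> = \<delta> * z"
      using even_commute \<delta>(1) r(1) by metis+
    have "filtered U 1 ((1 - y * r - y * r) - r * (r * \<delta>))"
    proof (rule filtered_Suc[OF U(1)])
      have "filtered U 0 (1 - y * r - y * r)"
        using filtered_add_diff(2)[OF filtered_add_diff(2)[OF filtered_scal[of U 1]
              filtered_mult[OF y(3) r(2), simplified]] filtered_mult[OF y(3) r(2), simplified]]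
        by simp
      then show "filtered U 0 ((1 - y * r - y * r) - r * (r * \<delta>))"
        using filtered_add_diff(2) filtered_mult[OF r(2) filtered_mult[OF r(2) \<delta>(4)]] by (simp only: add_0)
    qed (use y(2) \<delta>(2) s(1) in \<open>simp add: body_simps r_def field_simps\<close>)
    note small = this
    have "x - ?y * ?y = \<delta> * ((1 - y * r - y * r) - r * (r * \<delta>))"
    proof -
      have "y * (r * \<delta>) = \<delta> * (y * r)" using comm(2)[of "y * r"] by (simp only: mult.assoc)
      moreover have "r * \<delta> * y = \<delta> * (y * r)" 
        by (simp only: comm(2)[of r] comm(1)[of y] mult.assoc)
      moreover have "r * \<delta> * (r * \<delta>) = \<delta> * (r * (r * \<delta>))"
        by (simp only: comm(2)[of r] mult.assoc)
      moreover have "x = \<delta> + y * y" by (simp add: \<delta>_def)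
      ultimately show ?thesis by (simp add: distrib_left distrib_right right_diff_distrib)
    qed
    then have "filtered U (Suc d) (x - ?y * ?y)" using filtered_mult[OF \<delta>(3) small] by simp
    moreover have "filtered U 0 ?y"
      using filtered_add_diff(1)[OF y(3) filtered_mult[OF r(2) \<delta>(4), simplified]] .
    moreover have "body ?y = s" using y(2) \<delta>(2) by (simp add: body_simps)
    ultimately show ?case using y(1) \<delta>(1) r(1) by (intro exI[of _ ?y]) (simp add: parity)
  qed
  then obtain y where "even_elem y" "body y = s" "filtered U (Suc (card U)) (x - y * y)" by blast
  then show ?thesis using filtered_zero[OF U(1)] s by (metis eq_iff_diff_eq_0 positive_even_def)
qed

lemma gsqrt:
  assumes "positive_even x"
  shows "positive_even (gsqrt x)" "gsqrt x * gsqrt x = x"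
proof -
  have "\<exists>!y. even_elem y \<and> 0 < body y \<and> y * y = x"
    using gsqrt_exists[OF assms] gsqrt_unique unfolding positive_even_def by blast
  then have "even_elem (gsqrt x) \<and> 0 < body (gsqrt x) \<and> gsqrt x * gsqrt x = x"
    unfolding gsqrt_def by (rule theI')
  then show "positive_even (gsqrt x)" "gsqrt x * gsqrt x = x"
    by (auto simp: positive_even_def)
qed

lemma gsqrt_eqI:
  assumes "positive_even y" "y * y = x"
  shows "gsqrt x = y"
proof -
  have "positive_even x" using positive_even_closed(1)[OF assms(1,1)] assms(2) by simp
  from gsqrt[OF this] show ?thesis using gsqrt_unique[OF _ assms(1)] assms(2) by simp
qed

lemma gsqrt_mult:
  assumes "positive_even x" "positive_even y"
  shows "gsqrt (x * y) = gsqrt x * gsqrt y"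
proof (rule gsqrt_eqI)
  show "gsqrt x * gsqrt y * (gsqrt x * gsqrt y) = x * y"
  proof -
    have "gsqrt y * (gsqrt x * gsqrt y) = gsqrt x * (gsqrt y * gsqrt y)"
      using even_commute[OF positive_evenD[OF gsqrt(1)[OF assms(1)]], of "gsqrt y"]
      by (metis mult.assoc)
    then have "gsqrt x * gsqrt y * (gsqrt x * gsqrt y) = gsqrt x * gsqrt x * (gsqrt y * gsqrt y)"
      by (simp add: mult.assoc)
    then show ?thesis by (simp add: gsqrt assms)
  qed
qed (use assms in \<open>simp add: gsqrt positive_even_closed\<close>)

lemma gsqrt_scal: "0 < c \<Longrightarrow> gsqrt (scal c) = scal (psqrt c)"
  by (rule gsqrt_eqI) (simp_all add: positive_even_closed psqrt flip: scal_mult)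

lemma odd_cancel:
  assumes "positive_even z" "odd_elem (x * z)"
  shows "odd_elem x"
proof -
  have "x = x * z * inverse z" using positive_even_inverse[OF assms(1)] by (simp add: mult.assoc)
  then show ?thesis
    using parity_mult(4)[OF assms(2) positive_evenD[OF positive_even_inverse(1)[OF assms(1)]]] by simp
qed

section \<open>Super vectors\<close>

type_synonym 'k svec = "'k grassmann \<times> 'k grassmann \<times> 'k grassmann"

text \<open>
  The points of the super plane: two even coordinates and one odd coordinate. The bracket is the
  form preserved by OSp(1|2), and the cubic expression below is an odd invariant of a triple.
\<close>

fun svec :: "'k::comm_ring_1 svec \<Rightarrow> bool" where
  "svec (a, b, x) \<longleftrightarrow> even_elem a \<and> even_elem b \<and> odd_elem x"

fun bracket :: "'k::comm_ring_1 svec \<Rightarrow> 'k svec \<Rightarrow> 'k grassmann" where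
  "bracket (a, b, x) (a', b', x') = a * b' - b * a' - x * x'"

fun odd_part :: "'k svec \<Rightarrow> 'k grassmann" where
  "odd_part (a, b, x) = x"

definition odd_invariant :: "'k::comm_ring_1 svec \<Rightarrow> 'k svec \<Rightarrow> 'k svec \<Rightarrow> 'k grassmann" where
  "odd_invariant u v w = odd_part u * bracket v w + odd_part v * bracket w u + odd_part w * bracket u v
     + odd_part u * odd_part v * odd_part w"

lemma commute_if_even:
  fixes x y z :: "'k::comm_ring_1 grassmann"
  assumes "even_elem x \<or> even_elem y"
  shows "x * y = y * x" "x * (y * z) = y * (x * z)"
  using assms even_commute by (metis mult.assoc)+

lemma odd_left:
  fixes x y z :: "'k::linordered_idom grassmann"
  assumes "odd_elem x" 
  shows "odd_elem y \<Longrightarrow> x * (y * z) = - (y * (x * z))" "x * (x * z) = 0"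
  using odd_anticommute[OF assms, of y] odd_square[OF assms] by (simp_all flip: mult.assoc)

text \<open>
  The first two identities express the odd invariants of the triangles on the diagonal s t by those on
  l r, and the third one is the super Ptolemy relation. As polynomial identities they follow by expanding in
  coordinates and sorting the odd factors.
\<close>

lemma super_identities:
  fixes l r s t :: "'k::linordered_idom svec"
  assumes "svec l" "svec r" "svec s" "svec t"
  shows "bracket l r * odd_invariant l s t = 
       odd_invariant l r t * bracket l s + odd_invariant l s r * bracket l t" (is ?A)
    and "bracket l r * odd_invariant s r t =
       odd_invariant l r t * bracket s r - odd_invariant l s r * bracket r t" (is ?B)
    and "bracket l r * (bracket l r * bracket s t) =
       bracket l r * (bracket l t * bracket s r + bracket r t * bracket l s)
       + odd_invariant l s r * odd_invariant l r t" (is ?C)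
proof -
  obtain a1 b1 x1 where l: "l = (a1, b1, x1)" by (cases l)
  obtain a2 b2 x2 where r: "r = (a2, b2, x2)" by (cases r)
  obtain a3 b3 x3 where s: "s = (a3, b3, x3)" by (cases s)
  obtain a4 b4 x4 where t: "t = (a4, b4, x4)" by (cases t)
  have e: "even_elem a1" "even_elem a2" "even_elem a3" "even_elem a4"
      "even_elem b1" "even_elem b2" "even_elem b3" "even_elem b4"
    and o: "odd_elem x1" "odd_elem x2" "odd_elem x3" "odd_elem x4"
    using assms by (auto simp: l r s t)
  note anti = odd_anticommute[OF o(2,1)] odd_anticommute[OF o(3,1)] odd_anticommute[OF o(4,1)]
    odd_anticommute[OF o(3,2)] odd_anticommute[OF o(4,2)] odd_anticommute[OF o(4,3)]
    odd_left(1)[OF o(2,1)] odd_left(1)[OF o(3,1)] odd_left(1)[OF o(4,1)]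
    odd_left(1)[OF o(3,2)] odd_left(1)[OF o(4,2)] odd_left(1)[OF o(4,3)]
    o[THEN odd_square] o[THEN odd_left(2)]
  note normal = l r s t odd_invariant_def bracket.simps odd_part.simps algebra_simps
      mult_minus_left mult_minus_right minus_minus mult_zero_left mult_zero_right HOL.simp_thms commute_if_even e anti
  show ?A by (simp only: normal) simp
  show ?B by (simp only: normal) simp
  show ?C by (simp only: normal) simp
qed

definition sg :: "bool \<Rightarrow> 'k::comm_ring_1 grassmann" where
  "sg b = (if b then 1 else - 1)"

text \<open>
  Changing the sign of a vector changes brackets and odd invariants by that sign. This freedom is
  needed since the cyclic order of the vertices has to be cut somewhere to
  make the antisymmetric bracket positive.
\<close>

definition signed :: "bool \<Rightarrow> 'k::comm_ring_1 svec \<Rightarrow> 'k svec" where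
  "signed b v = (if b then v else (- fst v, - fst (snd v), - snd (snd v)))"

lemma sg_simps [simp]: "sg True = 1" "sg False = - 1" "sg b * sg b = 1" "sg b * (sg b * x) = x"
  by (auto simp: sg_def)

lemma even_sg: "even_elem (sg b)"
  by (auto simp: sg_def parity)

lemma sg_flip: "sg (\<not> b) = - sg b" "sg b * sg c = sg (b = c)" "sg b * (sg c * x) = sg (b = c) * x"
  by (auto simp: sg_def)

lemma svec_signed: "svec v \<Longrightarrow> svec (signed b v)"
  by (cases v) (auto simp: signed_def parity)

lemma bracket_signed: "bracket (signed b u) (signed c v) = sg b * sg c * bracket u v"
  by (cases u; cases v) (auto simp: signed_def sg_def)

lemma bracket_antisym: "svec u \<Longrightarrow> svec v \<Longrightarrow> bracket v u = - bracket u v"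
proof (cases u; cases v)
  fix a b x a' b' x' assume uv: "u = (a, b, x)" "v = (a', b', x')" and "svec u" "svec v"
  then have "a' * b = b * a'" "b' * a = a * b'" "x' * x = - (x * x')"
    using even_commute[of b a'] even_commute[of a b'] odd_anticommute[of x' x] by auto
  then show ?thesis by (simp add: uv)
qed

lemma odd_invariant_signed:
  "odd_invariant (signed a u) (signed b v) (signed c w) = sg a * sg b * sg c * odd_invariant u v w"
  unfolding odd_invariant_def bracket_signed
  by (cases u; cases v; cases w) (auto simp: signed_def sg_def algebra_simps)

lemma svec_parity: "svec v \<Longrightarrow> odd_elem (odd_part v)" "svec u \<Longrightarrow> svec v \<Longrightarrow> even_elem (bracket u v)"
  by (cases v; auto) (cases u; cases v; auto simp: parity)

lemma odd_invariant_cyclic: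
  fixes u v w :: "'k::linordered_idom svec"
  assumes "svec u" "svec v" "svec w"
  shows "odd_invariant v w u = odd_invariant u v w"
proof -
  have o: "odd_elem (odd_part u)" "odd_elem (odd_part v)" "odd_elem (odd_part w)"
    using assms svec_parity by blast+
  have "odd_part v * odd_part w * odd_part u = odd_part u * odd_part v * odd_part w"
    using commute_if_even(1)[of "odd_part v * odd_part w" "odd_part u"] parity_mult(2)[OF o(2,3)]
    by (simp add: mult.assoc)
  then show ?thesis by (simp add: odd_invariant_def add_ac)
qed

lemma odd_invariant_parity:
  assumes "svec u" "svec v" "svec w"
  shows "odd_elem (odd_invariant u v w)"
  using assms unfolding odd_invariant_def
  by (intro parity_add(2)) (simp_all add: parity_mult svec_parity)

text \<open>
  A flip in terms of super vectors at the corners of a quadrilateral whose brackets, taken in the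
  cyclic order l, s, r, t, are the lambda-lengths. Clearing denominators turns the three formulas
  into the polynomial identities above. The common sign \<open>\<rho>\<close> of the two old triangles is kept by the
  new left triangle and reversed by the new right one; the reversal is the reason why a flip
  changes the orientation of one side.
\<close>

lemma flip_super_vectors:
  fixes l r s t :: "'k::sqrt_field svec"
  assumes v: "svec l" "svec r" "svec s" "svec t"
    and a: "a = bracket l t" and b: "b = bracket r t" and c: "c = bracket s r"
    and d: "d = bracket l s" and e: "e = bracket l r"
    and pos: "positive_even a" "positive_even b" "positive_even c" "positive_even d" "positive_even e"
    and \<theta>: "\<theta> * (gsqrt a * gsqrt b * gsqrt e) = sg \<rho> * odd_invariant l r t"
    and \<sigma>: "\<sigma> * (gsqrt c * gsqrt d * gsqrt e) = sg \<rho> * odd_invariant l s r"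
    and f: "f = (a * c + b * d + gsqrt (a * b * c * d) * \<sigma> * \<theta>) / e"
  shows "f = bracket s t" "positive_even f"
    "(\<theta> * gsqrt (b * d) + \<sigma> * gsqrt (a * c)) / gsqrt (e * f) * (gsqrt a * gsqrt d * gsqrt f) =
       sg \<rho> * odd_invariant l s t"
    "(\<sigma> * gsqrt (b * d) - \<theta> * gsqrt (a * c)) / gsqrt (e * f) * (gsqrt b * gsqrt c * gsqrt f) =
       - sg \<rho> * odd_invariant s r t"
proof -
  define ra rb rc rd re where r_def: "ra = gsqrt a" "rb = gsqrt b" "rc = gsqrt c" "rd = gsqrt d" "re = gsqrt e"
  have pr: "positive_even ra" "positive_even rb" "positive_even rc" "positive_even rd" "positive_even re"
    and sq: "ra * ra = a" "rb * rb = b" "rc * rc = c" "rd * rd = d" "re * re = e"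
    using gsqrt pos by (auto simp: r_def)
  have ev: "even_elem ra" "even_elem rb" "even_elem rc" "even_elem rd" "even_elem re" "even_elem (sg \<rho> :: 'k grassmann)"
    using pr positive_evenD even_sg by auto
  note comm = commute_if_even(1) commute_if_even(2) ev
  have \<theta>': "\<theta> * (ra * (rb * re)) = sg \<rho> * odd_invariant l r t"
    and \<sigma>': "\<sigma> * (rc * (rd * re)) = sg \<rho> * odd_invariant l s r"
    using \<theta> \<sigma> by (simp_all add: r_def mult.assoc)
  have Jodd: "odd_elem (odd_invariant l r t)" "odd_elem (odd_invariant l s r)"
    using odd_invariant_parity v by blast+
  have odd: "odd_elem \<theta>" "odd_elem \<sigma>"
    by (rule odd_cancel[of "ra * (rb * re)"], simp add: pr positive_even_closed,
        simp add: \<theta>' parity_mult even_sg Jodd)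
       (rule odd_cancel[of "rc * (rd * re)"], simp add: pr positive_even_closed,
        simp add: \<sigma>' parity_mult even_sg Jodd)
  have g: "gsqrt (a * b * c * d) = ra * (rb * (rc * rd))" "gsqrt (b * d) = rb * rd" "gsqrt (a * c) = ra * rc"
    using pos by (simp_all add: gsqrt_mult positive_even_closed r_def mult.assoc)
  have fe: "f * e = a * c + b * d + ra * (rb * (rc * (rd * (\<sigma> * \<theta>))))"
    unfolding f positive_even_divide(1)[OF pos(5)] g by (simp add: mult.assoc)
  \<comment> \<open>Multiplying by e once more completes the odd term to the two normalized mu-invariants.\<close>
  have "e * (f * e) = e * (a * c + b * d) + \<sigma> * (rc * (rd * re)) * (\<theta> * (ra * (rb * re)))"
    unfolding fe unfolding sq(5)[symmetric] by (simp add: distrib_left mult.assoc comm add_ac)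
  also have "\<dots> = e * (a * c + b * d) + odd_invariant l s r * odd_invariant l r t"
    unfolding \<theta>' \<sigma>' by (cases \<rho>) simp_all
  also have "\<dots> = e * (e * bracket s t)"
    using super_identities(3)[OF v] by (simp add: a b c d e)
  finally have "e * (f * e) = e * (e * bracket s t)" .
  then have "f * e * e = bracket s t * e * e"
    using even_commute[OF positive_evenD[OF pos(5)]] by (metis mult.assoc)
  then show f_eq: "f = bracket s t" using positive_even_cancel[OF pos(5)] by blast
  have "body f * body e = body a * body c + body b * body d"
    using arg_cong[OF fe, of body] odd parity_mult(2)[of \<sigma> \<theta>] by (simp add: body_simps)
  moreover have "0 < body a * body c + body b * body d" "0 < body e"
    using pos by (auto simp: positive_even_def intro!: add_pos_pos)
  ultimately have "0 < body f" by (metis zero_less_mult_pos2)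
  then show pf: "positive_even f"
    using svec_parity(2)[OF v(3,4)] by (simp add: positive_even_def f_eq)
  define rf where "rf = gsqrt f"
  have rf_pos: "positive_even rf" and evf: "even_elem rf"
    using gsqrt[OF pf] positive_evenD by (auto simp: rf_def)
  note comm = commute_if_even(1) commute_if_even(2) ev evf
  have gf: "gsqrt (e * f) = re * rf" using pos pf by (simp add: gsqrt_mult r_def rf_def)
  have pef: "positive_even (re * rf)" using pr rf_pos positive_even_closed by blast
  have clear: "x / (re * rf) * (y * z * rf) = w" 
    if "x * (y * (z * re)) = e * w" "even_elem y" "even_elem z" for x y z w
  proof -
    define q where "q = x / (re * rf)"
    have x: "x = q * (re * rf)" using positive_even_divide(1)[OF pef] q_def by metis
    have "e * w = q * (re * rf) * (y * (z * re))" using that(1) x by simp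
    also have "\<dots> = re * re * (q * (y * z * rf))" using that(2,3) by (simp add: mult.assoc comm)
    finally have "w * e = (q * (y * z * rf)) * e"
      using sq(5) even_commute[OF positive_evenD[OF pos(5)]] by metis
    then show ?thesis unfolding q_def using positive_even_cancel[OF pos(5)] by metis
  qed
  have "(\<theta> * (rb * rd) + \<sigma> * (ra * rc)) * (ra * (rd * re))
      = \<theta> * (ra * (rb * re)) * (rd * rd) + \<sigma> * (rc * (rd * re)) * (ra * ra)"
    by (simp add: distrib_right mult.assoc comm)
  also have "\<dots> = e * (sg \<rho> * odd_invariant l s t)"
    unfolding \<theta>' \<sigma>' sq using super_identities(1)[OF v]
    by (cases \<rho>) (simp_all add: a b c d e)
  finally show "(\<theta> * gsqrt (b * d) + \<sigma> * gsqrt (a * c)) / gsqrt (e * f) * (gsqrt a * gsqrt d * gsqrt f) =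
       sg \<rho> * odd_invariant l s t"
    unfolding g gf r_def[symmetric] rf_def[symmetric] by (intro clear ev)
  have "(\<sigma> * (rb * rd) - \<theta> * (ra * rc)) * (rb * (rc * re))
      = \<sigma> * (rc * (rd * re)) * (rb * rb) - \<theta> * (ra * (rb * re)) * (rc * rc)"
    by (simp add: left_diff_distrib mult.assoc comm)
  also have "\<dots> = e * (- sg \<rho> * odd_invariant s r t)"
    unfolding \<theta>' \<sigma>' sq using super_identities(2)[OF v]
    by (cases \<rho>) (simp_all add: a b c d e)
  finally show "(\<sigma> * gsqrt (b * d) - \<theta> * gsqrt (a * c)) / gsqrt (e * f) * (gsqrt b * gsqrt c * gsqrt f) =
       - sg \<rho> * odd_invariant s r t"
    unfolding g gf r_def[symmetric] rf_def[symmetric] by (intro clear ev)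
qed

section \<open>Planarity\<close>

lemma crosses_iff:
  "crosses {a, b} {c, d} \<longleftrightarrow> ccw a c b \<and> ccw b d a \<or> ccw a d b \<and> ccw b c a"
  unfolding crosses_def by (auto simp: doubleton_eq_iff)

lemma ccw_cyclic: "ccw a b c \<Longrightarrow> ccw b c a"
  by (auto simp: ccw_def)

lemma ccw_distinct: "ccw a b c \<Longrightarrow> a \<noteq> b \<and> b \<noteq> c \<and> a \<noteq> c"
  by (auto simp: ccw_def)

lemma ccw_total: "a \<noteq> b \<Longrightarrow> b \<noteq> c \<Longrightarrow> a \<noteq> c \<Longrightarrow> ccw a b c \<or> ccw a c b"
  by (auto simp: ccw_def)

lemma ccw_asym: "ccw a b c \<Longrightarrow> \<not> ccw a c b"
  by (auto simp: ccw_def)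

text \<open>
  A form for the solver of linear real arithmetic, which settles the cyclic order facts below.
\<close>

lemma ccw_real:
  "ccw a b c \<longleftrightarrow> real a < real b \<and> real b < real c \<or> real b < real c \<and> real c < real a \<or>
     real c < real a \<and> real a < real b"
  by (simp add: ccw_def)

lemma crosses_sym: "crosses e f \<Longrightarrow> crosses f e"
proof -
  assume "crosses e f"
  then obtain a b c d where "e = {a, b}" "f = {c, d}" "ccw a c b" "ccw b d a"
    unfolding crosses_def by blast
  moreover from this have "ccw c b d" "ccw d a c" unfolding ccw_real by argo+
  ultimately show "crosses f e" by (simp add: crosses_iff)
qed

lemma ccw_between:
  assumes "ccw s r t"
  shows "ccw s x t \<Longrightarrow> x \<noteq> r \<Longrightarrow> ccw s x r \<or> ccw r x t"
    and "ccw t y s \<Longrightarrow> ccw r y s" and "ccw t y s \<Longrightarrow> ccw t y r"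
  using assms unfolding ccw_real of_nat_eq_iff[symmetric, where 'a = real] by argo+

lemma ccw_quadrilateral:
  assumes "ccw l s r" "ccw r t l"
  shows "ccw s r t" "ccw t l s"
    and "l < s \<and> s < r \<and> r < t \<or> s < r \<and> r < t \<and> t < l \<or> r < t \<and> t < l \<and> l < s \<or> t < l \<and> l < s \<and> s < r"
  using assms unfolding ccw_real of_nat_less_iff[symmetric, where 'a = real] by argo+

text \<open>
  These two facts compare the position of x and y relative to the cut of the cyclic order between
  the last vertex and vertex 0, seen from the two ends of an edge.
\<close>

lemma ccw_same_side: "ccw a b x \<Longrightarrow> ccw a b y \<Longrightarrow> ((a < x) = (a < y)) = ((b < x) = (b < y))"
  unfolding ccw_real of_nat_less_iff[symmetric, where 'a = real] by argo

lemma ccw_opposite_side: "ccw a b x \<Longrightarrow> ccw b a y \<Longrightarrow> ((a < x) = (a < y)) \<noteq> ((b < x) = (b < y))"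
  unfolding ccw_real of_nat_less_iff[symmetric, where 'a = real] by argo

definition planar :: "nat set set \<Rightarrow> bool" where
  "planar E \<longleftrightarrow> (\<forall>e\<in>E. \<exists>u v. u \<noteq> v \<and> e = {u, v}) \<and> (\<forall>e\<in>E. \<forall>f\<in>E. \<not> crosses e f)"

lemma planarD:
  assumes "planar E" "e \<in> E"
  shows "\<exists>u v. u \<noteq> v \<and> e = {u, v}" "f \<in> E \<Longrightarrow> \<not> crosses e f"
  using assms by (auto simp: planar_def)

text \<open>
  Two different apexes on the same side of an edge would have crossing sides.
\<close>

lemma planar_apex_unique:
  assumes "planar E" "{u, v} \<in> E" "{v, w} \<in> E" "{w, u} \<in> E" "{v, x} \<in> E" "{x, u} \<in> E"
    and "ccw u v w" "ccw u v x"
  shows "w = x"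
proof (rule ccontr)
  assume "w \<noteq> x"
  have "\<not> crosses {v, x} {w, u}" "\<not> crosses {v, w} {x, u}"
    using planarD(2)[OF assms(1)] assms(3-6) by auto
  moreover have "ccw v w x \<or> ccw v x w"
    using ccw_total ccw_distinct assms(7,8) \<open>w \<noteq> x\<close> by metis
  ultimately show False using assms(7,8) ccw_cyclic unfolding crosses_iff by metis
qed

text \<open>
  Whatever crosses the new diagonal leaves the quadrilateral through one of its sides or joins l
  and r.
\<close>

lemma planar_flip:
  assumes "planar E" "{l, r} \<in> E" "ccw l s r" "ccw r t l"
    "{{l, t}, {t, r}, {r, s}, {s, l}} \<subseteq> E"
  shows "planar (insert {s, t} (E - {{l, r}}))"
proof -
  note q = ccw_quadrilateral[OF assms(3,4)]
  have st: "\<not> crosses {s, t} e" if e: "e \<in> E - {{l, r}}" for e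
  proof -
    obtain x y where xy: "x \<noteq> y" "e = {x, y}" using planarD(1)[OF assms(1), of e] e by blast
    have "\<not> crosses {l, t} {x, y}" "\<not> crosses {t, r} {x, y}" "\<not> crosses {r, s} {x, y}" "\<not> crosses {s, l} {x, y}"
      using planarD(2)[OF assms(1) _, of _ "{x, y}"] assms(5) e xy(2) by auto
    moreover have "\<not> (x = l \<and> y = r)" "\<not> (x = r \<and> y = l)" using e xy by auto
    moreover have "crosses {r, s} {x, y} \<or> crosses {t, r} {x, y} \<or> crosses {l, t} {x, y} \<or>
        crosses {s, l} {x, y} \<or> x = r \<and> y = l" if xy: "ccw s x t" "ccw t y s" for x y
    proof (cases "x = r")
      case False
      then show ?thesis
        using ccw_between(1)[OF q(1) xy(1)] ccw_between(2,3)[OF q(1) xy(2)] unfolding crosses_iff by blast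
    next
      case True
      have "ccw l r t" "ccw s r l" using assms(3,4) ccw_cyclic by blast+
      then show ?thesis
        using ccw_between(1)[OF q(2) xy(2)] True unfolding crosses_iff by blast
    qed
    from this[of x y] this[of y x] have "crosses {s, t} {x, y} \<Longrightarrow> crosses {r, s} {x, y} \<or>
        crosses {t, r} {x, y} \<or> crosses {l, t} {x, y} \<or> crosses {s, l} {x, y} \<or> x = r \<and> y = l \<or> x = l \<and> y = r"
      unfolding crosses_iff[of s t] by (auto simp: insert_commute)
    ultimately show ?thesis unfolding xy(2) by blast
  qed
  moreover have "\<not> crosses {s, t} {s, t}" using ccw_distinct by (simp add: crosses_iff) blast
  moreover have "s \<noteq> t" using assms(3,4) by (auto simp: ccw_def)
  ultimately show ?thesis
    unfolding planar_def
  proof (intro conjI ballI)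
    fix e f assume ef: "e \<in> insert {s, t} (E - {{l, r}})"
    show "\<exists>u v. u \<noteq> v \<and> e = {u, v}" using ef planarD(1)[OF assms(1)] \<open>s \<noteq> t\<close> by blast
    assume "f \<in> insert {s, t} (E - {{l, r}})"
    then show "\<not> crosses e f"
      using ef st crosses_sym[of e f] \<open>\<not> crosses {s, t} {s, t}\<close> planarD(2)[OF assms(1), of e f] by blast
  qed
qed

section \<open>Flip invariance\<close>

definition edges :: "nat \<Rightarrow> 'k decorated \<Rightarrow> nat set set" where
  "edges N D = diags D \<union> sides N"

text \<open>
  Vectors determine the mu-invariant of a triangle only up to a sign \<open>\<tau>\<close>. Here the orientation of a
  diagonal fixes the ratio of the signs of the two triangles at it. The vertex numbers enter because
  brackets are positive for increasing vertices, so that moving the cut of the cyclic order changes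
  signs. By \<open>ccw_opposite_side\<close>, reversing the diagonal negates the right-hand side: the orientation
  carries exactly the information about the relative sign. In other words, it is a spin structure.
\<close>

definition spin_signs :: "nat \<Rightarrow> 'k decorated \<Rightarrow> (nat set \<Rightarrow> bool) \<Rightarrow> bool" where
  "spin_signs N D \<tau> \<longleftrightarrow> (\<forall>l r s t. {l, r} \<in> diags D \<longrightarrow> head D {l, r} = r \<longrightarrow> ccw l s r \<longrightarrow> ccw r t l \<longrightarrow>
     {{l, t}, {t, r}, {r, s}, {s, l}} \<subseteq> edges N D \<longrightarrow>
     (\<tau> {l, r, t} = \<tau> {l, r, s}) = ((l < s) = (l < t)))"

text \<open>
  Only the new diagonal and the four sides of the quadrilateral border a triangle whose sign has
  changed. The new triangle on the left takes its sign from the old ones; the one on the right gets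
  the opposite of what it would inherit. For three sides this agrees with keeping the orientation,
  and for the side from t to r the extra sign is cancelled by the reversal in the flip. The condition at any other
  diagonal concerns unchanged triangles.
\<close>

lemma spin_signs_flip:
  assumes sp: "spin_signs N D \<tau>" and hd: "\<forall>e\<in>diags D. head D e \<in> e" and pl: "planar (edges N D)" and disj: "diags D \<inter> sides N = {}"
    and lr: "{l, r} \<in> diags D" "head D {l, r} = r" and ccw: "ccw l s r" "ccw r t l"
    and E: "{{l, t}, {t, r}, {r, s}, {s, l}} \<subseteq> edges N D"
    and D': "diags D' = insert {s, t} (diags D - {{l, r}})"
      "head D' = (head D)({s, t} := t, {t, r} := (if head D {t, r} = t then r else t))"
    and \<tau>': "\<tau>' = \<tau>({l, s, t} := (\<tau> {l, r, t} = ((l < s) = (l < r))),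
       {r, s, t} := (\<tau> {l, r, t} \<noteq> ((s < r) = (l < r))))"
  shows "spin_signs N D' \<tau>'"
proof -
  have dist: "l \<noteq> r" "l \<noteq> s" "l \<noteq> t" "r \<noteq> s" "r \<noteq> t" "s \<noteq> t"
    using ccw by (auto simp: ccw_def)
  have edges': "edges N D' = insert {s, t} (edges N D - {{l, r}})"
    using D'(1) lr(1) disj by (auto simp: edges_def)
  have pl': "planar (edges N D')"
    unfolding edges' by (rule planar_flip[OF pl _ ccw E]) (use lr in \<open>simp add: edges_def\<close>)
  have "{l, t} \<in> edges N D'" "{t, r} \<in> edges N D'" "{r, s} \<in> edges N D'" "{s, l} \<in> edges N D'" "{s, t} \<in> edges N D'"
    using E dist unfolding edges' by (auto simp: doubleton_eq_iff)
  then have E': "{l, t} \<in> edges N D'" "{t, r} \<in> edges N D'" "{r, s} \<in> edges N D'" "{s, l} \<in> edges N D'" "{s, t} \<in> edges N D'"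
    "{t, l} \<in> edges N D'" "{r, t} \<in> edges N D'" "{s, r} \<in> edges N D'" "{l, s} \<in> edges N D'" "{t, s} \<in> edges N D'"
    by (simp_all add: insert_commute)
  have old: "(\<tau> {l, r, t} = \<tau> {l, r, s}) = ((l < s) = (l < t))"
    using sp lr ccw E unfolding spin_signs_def by blast
  have \<tau>'_L: "\<tau>' {l, s, t} = (\<tau> {l, r, t} = ((l < s) = (l < r)))"
    and \<tau>'_R: "\<tau>' {r, s, t} = (\<tau> {l, r, t} \<noteq> ((s < r) = (l < r)))"
    using dist by (auto simp: \<tau>')
  have \<tau>'_old: "\<tau>' X = \<tau> X" if "\<not> {s, t} \<subseteq> X" for X
    using that by (auto simp: \<tau>')
  note quad = ccw_quadrilateral[OF ccw]
  have C: "ccw l s r" "ccw s r l" "ccw r l s" "ccw r t l" "ccw t l r" "ccw l r t"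
    "ccw s r t" "ccw r t s" "ccw t s r" "ccw t l s" "ccw l s t" "ccw s t l"
    using ccw quad(1,2) ccw_cyclic by blast+
  have lrE: "{l, r} \<in> edges N D" using lr(1) by (simp add: edges_def)
  have E2: "{l, t} \<in> edges N D" "{t, r} \<in> edges N D" "{r, s} \<in> edges N D" "{s, l} \<in> edges N D" "{l, r} \<in> edges N D"
    "{t, l} \<in> edges N D" "{r, t} \<in> edges N D" "{s, r} \<in> edges N D" "{l, s} \<in> edges N D" "{r, l} \<in> edges N D"
    using E lrE by (simp_all add: insert_commute)
  have NE: "{l, t} \<noteq> {s, t}" "{t, r} \<noteq> {s, t}" "{r, s} \<noteq> {s, t}" "{s, l} \<noteq> {s, t}"
    "{l, t} \<noteq> {t, r}" "{r, s} \<noteq> {t, r}" "{s, l} \<noteq> {t, r}"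
    using dist by (simp_all add: doubleton_eq_iff)
  have perm: "{t, l, s} = {l, s, t}" "{t, l, r} = {l, r, t}" "{s, l, t} = {l, s, t}" "{s, l, r} = {l, r, s}"
    "{s, r, t} = {r, s, t}" "{s, r, l} = {l, r, s}" "{r, t, s} = {r, s, t}" "{r, t, l} = {l, r, t}"
    "{l, s, r} = {l, r, s}" "{s, t, l} = {l, s, t}" "{s, t, r} = {r, s, t}"
    by blast+
  have parity_L: "((l < s) = (l < t)) = (((l < s) = (l < r)) = ((s < t) = (s < r)))"
    and parity_R: "((s < r) = (l < r)) \<noteq> (((l < s) = (l < t)) = ((s < t) = (s < l)))"
    and not_less: "(s < l) = (\<not> l < s)" "(s < r) = (\<not> r < s)" "(l < r) = (\<not> r < l)"
    using quad(3) by (elim disjE; simp)+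
  have old_edge: "{a, b} \<in> edges N D" if "{a, b} \<in> edges N D'" "{a, b} \<noteq> {s, t}" for a b
    using that by (auto simp: edges')
  show ?thesis
    unfolding spin_signs_def
  proof (intro allI impI)
    fix u v x y
    assume uv: "{u, v} \<in> diags D'" "head D' {u, v} = v" and c: "ccw u x v" "ccw v y u"
      and Q: "{{u, y}, {y, v}, {v, x}, {x, u}} \<subseteq> edges N D'"
    have uvE: "{u, v} \<in> edges N D'" using uv(1) by (auto simp: edges_def)
    have c': "ccw u x v" "ccw x v u" "ccw v u x" "ccw v y u" "ccw y u v" "ccw u v y"
      using c ccw_cyclic by blast+
    have Q': "{u, y} \<in> edges N D'" "{y, u} \<in> edges N D'" "{y, v} \<in> edges N D'" "{v, y} \<in> edges N D'"
      "{v, x} \<in> edges N D'" "{x, v} \<in> edges N D'" "{x, u} \<in> edges N D'" "{u, x} \<in> edges N D'"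
      using Q by (simp_all add: insert_commute)
    have apex_left: "y = z" if "{v, z} \<in> edges N D'" "{z, u} \<in> edges N D'" "ccw u v z" for z
      by (rule planar_apex_unique[OF pl' uvE Q'(4,2) that(1,2) c'(6) that(3)])
    have apex_right: "x = z" if "{u, z} \<in> edges N D'" "{z, v} \<in> edges N D'" "ccw v u z" for z
      by (rule planar_apex_unique[OF pl' _ Q'(8,6) that(1,2) c'(3) that(3)])
        (use uvE in \<open>simp add: insert_commute\<close>)
    have old_uv: "(\<tau> {u, v, y} = \<tau> {u, v, x}) = ((u < x) = (u < y))"
      if "{u, v} \<in> diags D" "head D {u, v} = v" "ccw u x v" "ccw v y u"
        "{u, y} \<in> edges N D" "{y, v} \<in> edges N D" "{v, x} \<in> edges N D" "{x, u} \<in> edges N D" for u v x y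
      using sp that unfolding spin_signs_def by simp
    consider "{u, v} = {s, t}" | "{u, v} = {l, t}" | "{u, v} = {t, r}" | "{u, v} = {r, s}" | "{u, v} = {s, l}"
      | "{u, v} \<noteq> {s, t}" "{u, v} \<noteq> {l, t}" "{u, v} \<noteq> {t, r}" "{u, v} \<noteq> {r, s}" "{u, v} \<noteq> {s, l}"
      by argo
    then show "(\<tau>' {u, v, y} = \<tau>' {u, v, x}) = ((u < x) = (u < y))"
    proof cases
      case 1
      then have [simp]: "u = s" "v = t" using uv(2) D'(2) dist by (auto simp: doubleton_eq_iff)
      have "y = l" by (rule apex_left) (simp_all add: E' C)
      moreover have "x = r" by (rule apex_right) (simp_all add: E' C)
      ultimately show ?thesis using \<tau>'_L \<tau>'_R not_less unfolding \<open>u = s\<close> \<open>v = t\<close> by (simp only: perm) argo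
    next
      case 2
      have uvD: "{u, v} \<in> diags D" using uv(1) NE unfolding D'(1) 2 by simp
      have uvh: "head D {u, v} = v" using uv(2) NE unfolding D'(2) 2 by simp
      have \<tau>s: "\<tau>' {t, l, s} = (\<tau> {t, l, r} = ((l < s) = (l < r)))"
        unfolding perm using \<tau>'_L old parity_L by argo
      from 2 consider "u = t" "v = l" | "u = l" "v = t" by (auto simp: doubleton_eq_iff)
      then show ?thesis
      proof cases
        case 1
        then have "y = s" by (intro apex_left) (simp_all add: E' C)
        have "x \<noteq> s" using c' C ccw_asym unfolding 1 by blast
        have outside: "{t, x} \<in> edges N D" "{x, t} \<in> edges N D"
            "{l, x} \<in> edges N D" "{x, l} \<in> edges N D"
          by (rule old_edge, use Q' 1 in simp, use \<open>x \<noteq> s\<close> dist in \<open>simp add: doubleton_eq_iff\<close>)+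
        have "(\<tau> {t, l, r} = \<tau> {t, l, x}) = ((t < x) = (t < r))"
          by (rule old_uv) (use uvD uvh C c' outside E2 in \<open>simp_all add: 1 insert_commute[of r t]\<close>)
        moreover have "\<tau>' {t, l, x} = \<tau> {t, l, x}" using \<open>x \<noteq> s\<close> dist by (intro \<tau>'_old) auto
        moreover have "((t < s) = (t < r)) = ((l < s) = (l < r))"
          by (rule ccw_same_side) (rule C)+
        ultimately show ?thesis using \<tau>s unfolding 1 \<open>y = s\<close> insert_commute[of l t] by argo
      next
        case 2
        then have "x = s" by (intro apex_right) (simp_all add: E' C)
        have "y \<noteq> s" using c' C ccw_asym unfolding 2 by blast
        have outside: "{l, y} \<in> edges N D" "{y, l} \<in> edges N D"
            "{t, y} \<in> edges N D" "{y, t} \<in> edges N D"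
          by (rule old_edge, use Q' 2 in simp, use \<open>y \<noteq> s\<close> dist in \<open>simp add: doubleton_eq_iff\<close>)+
        have "(\<tau> {l, t, y} = \<tau> {l, t, r}) = ((l < r) = (l < y))"
          by (rule old_uv) (use uvD uvh C c' outside E2 in \<open>simp_all add: 2 insert_commute[of r t]\<close>)
        moreover have "\<tau>' {t, l, y} = \<tau> {t, l, y}" using \<open>y \<noteq> s\<close> dist by (intro \<tau>'_old) auto
        moreover have "((t < s) = (t < r)) = ((l < s) = (l < r))"
          by (rule ccw_same_side) (rule C)+
        ultimately show ?thesis using \<tau>s unfolding 2 \<open>x = s\<close> insert_commute[of l t] by argo
      qed
    next
      case 5
      have uvD: "{u, v} \<in> diags D" using uv(1) NE unfolding D'(1) 5 by simp
      have uvh: "head D {u, v} = v" using uv(2) NE unfolding D'(2) 5 by simp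
      have \<tau>s: "\<tau>' {l, s, t} = (\<tau> {l, s, r} = ((s < t) = (s < r)))"
        unfolding perm using \<tau>'_L old parity_L by argo
      from 5 consider "u = l" "v = s" | "u = s" "v = l" by (auto simp: doubleton_eq_iff)
      then show ?thesis
      proof cases
        case 1
        then have "y = t" by (intro apex_left) (simp_all add: E' C)
        have "x \<noteq> t" using c' C ccw_asym unfolding 1 by blast
        have outside: "{l, x} \<in> edges N D" "{x, l} \<in> edges N D"
            "{s, x} \<in> edges N D" "{x, s} \<in> edges N D"
          by (rule old_edge, use Q' 1 in simp, use \<open>x \<noteq> t\<close> dist in \<open>simp add: doubleton_eq_iff\<close>)+
        have "(\<tau> {l, s, r} = \<tau> {l, s, x}) = ((l < x) = (l < r))"
          by (rule old_uv) (use uvD uvh C c' outside E2 in \<open>simp_all add: 1 insert_commute[of r t]\<close>)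
        moreover have "\<tau>' {l, s, x} = \<tau> {l, s, x}" using \<open>x \<noteq> t\<close> dist by (intro \<tau>'_old) auto
        moreover have "((l < t) = (l < r)) = ((s < t) = (s < r))"
          by (rule ccw_same_side) (rule C)+
        ultimately show ?thesis using \<tau>s unfolding 1 \<open>y = t\<close> insert_commute[of s l] by argo
      next
        case 2
        then have "x = t" by (intro apex_right) (simp_all add: E' C)
        have "y \<noteq> t" using c' C ccw_asym unfolding 2 by blast
        have outside: "{s, y} \<in> edges N D" "{y, s} \<in> edges N D"
            "{l, y} \<in> edges N D" "{y, l} \<in> edges N D"
          by (rule old_edge, use Q' 2 in simp, use \<open>y \<noteq> t\<close> dist in \<open>simp add: doubleton_eq_iff\<close>)+
        have "(\<tau> {s, l, y} = \<tau> {s, l, r}) = ((s < r) = (s < y))"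
          by (rule old_uv) (use uvD uvh C c' outside E2 in \<open>simp_all add: 2 insert_commute[of r t]\<close>)
        moreover have "\<tau>' {l, s, y} = \<tau> {l, s, y}" using \<open>y \<noteq> t\<close> dist by (intro \<tau>'_old) auto
        moreover have "((l < t) = (l < r)) = ((s < t) = (s < r))"
          by (rule ccw_same_side) (rule C)+
        ultimately show ?thesis using \<tau>s unfolding 2 \<open>x = t\<close> insert_commute[of s l] by argo
      qed
    next
      case 4
      have uvD: "{u, v} \<in> diags D" using uv(1) NE unfolding D'(1) 4 by simp
      have uvh: "head D {u, v} = v" using uv(2) NE unfolding D'(2) 4 by simp
      have \<tau>s: "\<tau>' {s, r, t} = (\<tau> {s, r, l} = ((s < t) = (s < l)))"
        unfolding perm using \<tau>'_R old parity_R by argo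
      from 4 consider "u = s" "v = r" | "u = r" "v = s" by (auto simp: doubleton_eq_iff)
      then show ?thesis
      proof cases
        case 1
        then have "y = t" by (intro apex_left) (simp_all add: E' C)
        have "x \<noteq> t" using c' C ccw_asym unfolding 1 by blast
        have outside: "{s, x} \<in> edges N D" "{x, s} \<in> edges N D"
            "{r, x} \<in> edges N D" "{x, r} \<in> edges N D"
          by (rule old_edge, use Q' 1 in simp, use \<open>x \<noteq> t\<close> dist in \<open>simp add: doubleton_eq_iff\<close>)+
        have "(\<tau> {s, r, l} = \<tau> {s, r, x}) = ((s < x) = (s < l))"
          by (rule old_uv) (use uvD uvh C c' outside E2 in \<open>simp_all add: 1 insert_commute[of r t]\<close>)
        moreover have "\<tau>' {s, r, x} = \<tau> {s, r, x}" using \<open>x \<noteq> t\<close> dist by (intro \<tau>'_old) auto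
        moreover have "((s < t) = (s < l)) = ((r < t) = (r < l))"
          by (rule ccw_same_side) (rule C)+
        ultimately show ?thesis using \<tau>s unfolding 1 \<open>y = t\<close> insert_commute[of r s] by argo
      next
        case 2
        then have "x = t" by (intro apex_right) (simp_all add: E' C)
        have "y \<noteq> t" using c' C ccw_asym unfolding 2 by blast
        have outside: "{r, y} \<in> edges N D" "{y, r} \<in> edges N D"
            "{s, y} \<in> edges N D" "{y, s} \<in> edges N D"
          by (rule old_edge, use Q' 2 in simp, use \<open>y \<noteq> t\<close> dist in \<open>simp add: doubleton_eq_iff\<close>)+
        have "(\<tau> {r, s, y} = \<tau> {r, s, l}) = ((r < l) = (r < y))"
          by (rule old_uv) (use uvD uvh C c' outside E2 in \<open>simp_all add: 2 insert_commute[of r t]\<close>)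
        moreover have "\<tau>' {s, r, y} = \<tau> {s, r, y}" using \<open>y \<noteq> t\<close> dist by (intro \<tau>'_old) auto
        moreover have "((s < t) = (s < l)) = ((r < t) = (r < l))"
          by (rule ccw_same_side) (rule C)+
        ultimately show ?thesis using \<tau>s unfolding 2 \<open>x = t\<close> insert_commute[of r s] by argo
      qed
    next
      case 3
      have uvD: "{u, v} \<in> diags D" using uv(1) NE unfolding D'(1) 3 by simp
      then have "head D {u, v} = t \<or> head D {u, v} = r" using hd 3 by fastforce
      moreover have "v = (if head D {u, v} = t then r else t)" using uv(2) NE unfolding D'(2) 3 by simp
      ultimately have uvh: "head D {u, v} = u" using 3 dist by (auto simp: doubleton_eq_iff insert_commute)
      have \<tau>s: "\<tau>' {r, t, s} = (\<tau> {r, t, l} \<noteq> ((r < s) = (r < l)))"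
        unfolding perm using \<tau>'_R not_less by argo
      from 3 consider "u = r" "v = t" | "u = t" "v = r" by (auto simp: doubleton_eq_iff)
      then show ?thesis
      proof cases
        case 1
        then have "y = s" by (intro apex_left) (simp_all add: E' C)
        have "x \<noteq> s" using c' C ccw_asym unfolding 1 by blast
        have outside: "{r, x} \<in> edges N D" "{x, r} \<in> edges N D"
            "{t, x} \<in> edges N D" "{x, t} \<in> edges N D"
          by (rule old_edge, use Q' 1 in simp, use \<open>x \<noteq> s\<close> dist in \<open>simp add: doubleton_eq_iff\<close>)+
        have "(\<tau> {t, r, x} = \<tau> {t, r, l}) = ((t < l) = (t < x))"
          by (rule old_uv) (use uvD uvh C c' outside E2 in \<open>simp_all add: 1 insert_commute[of r t]\<close>)
        moreover have "\<tau>' {r, t, x} = \<tau> {r, t, x}" using \<open>x \<noteq> s\<close> dist by (intro \<tau>'_old) auto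
        moreover have "((r < l) = (r < x)) \<noteq> ((t < l) = (t < x))"
          using ccw_opposite_side[of r t l x] C c' by (simp add: 1)
        moreover have "((r < s) = (r < l)) = ((t < s) = (t < l))"
          by (rule ccw_same_side) (rule C)+
        ultimately show ?thesis using \<tau>s unfolding 1 \<open>y = s\<close> insert_commute[of t r] by argo
      next
        case 2
        then have "x = s" by (intro apex_right) (simp_all add: E' C)
        have "y \<noteq> s" using c' C ccw_asym unfolding 2 by blast
        have outside: "{t, y} \<in> edges N D" "{y, t} \<in> edges N D"
            "{r, y} \<in> edges N D" "{y, r} \<in> edges N D"
          by (rule old_edge, use Q' 2 in simp, use \<open>y \<noteq> s\<close> dist in \<open>simp add: doubleton_eq_iff\<close>)+
        have "(\<tau> {r, t, l} = \<tau> {r, t, y}) = ((r < y) = (r < l))"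
          by (rule old_uv) (use uvD uvh C c' outside E2 in \<open>simp_all add: 2 insert_commute[of r t]\<close>)
        moreover have "\<tau>' {r, t, y} = \<tau> {r, t, y}" using \<open>y \<noteq> s\<close> dist by (intro \<tau>'_old) auto
        moreover have "((r < l) = (r < y)) \<noteq> ((t < l) = (t < y))"
          using ccw_opposite_side[of r t l y] C c' by (simp add: 2)
        moreover have "((r < s) = (r < l)) = ((t < s) = (t < l))"
          by (rule ccw_same_side) (rule C)+
        ultimately show ?thesis using \<tau>s unfolding 2 \<open>x = s\<close> insert_commute[of t r] by argo
      qed
    next
      case 6
      have uvD: "{u, v} \<in> diags D" "head D {u, v} = v" "{u, v} \<noteq> {l, r}" using 6 uv D' by auto
      have corner: "w = l \<or> w = r" if w: "{s, w} \<in> edges N D'" "{w, t} \<in> edges N D'" "w \<noteq> s" "w \<noteq> t" for w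
      proof -
        have "w = l" if "ccw s t w"
          by (rule planar_apex_unique[OF pl', of s t]) (use w E' C that in \<open>simp_all add: insert_commute[of t w] insert_commute[of w s]\<close>)
        moreover have "w = r" if "ccw t s w"
          by (rule planar_apex_unique[OF pl', of t s]) (use w E' C that in \<open>simp_all add: insert_commute\<close>)
        ultimately show ?thesis using ccw_total[of s t w] ccw_cyclic w(3,4) dist(6) by blast
      qed
      have "{v, u} \<in> edges N D'" using uvE by (simp add: insert_commute)
      note uvE' = uvE this
      have no_side: "\<not> (u = a \<and> v = b) \<and> \<not> (u = b \<and> v = a)" if "{u, v} \<noteq> {a, b}" for a b
        using that by auto
      note sides6 = no_side[OF 6(2)] no_side[OF 6(3)] no_side[OF 6(4)] no_side[OF 6(5)]
      have no_st: "\<not> {s, t} \<subseteq> {u, v, z}"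
        if z: "{u, z} \<in> edges N D'" "{z, u} \<in> edges N D'" "{z, v} \<in> edges N D'" "{v, z} \<in> edges N D'"
          "z \<noteq> u" "z \<noteq> v" "u \<noteq> v" for z
      proof
        assume "{s, t} \<subseteq> {u, v, z}"
        then consider "z = s" "u = t" | "z = s" "v = t" | "z = t" "u = s" | "z = t" "v = s"
          using dist(6) no_side[OF 6(1)] by auto
        then show False
        proof cases
          case 1
          have "v = l \<or> v = r" by (rule corner) (use 1 z uvE' in simp_all)
          then show False using 1 sides6 by blast
        next
          case 2
          have "u = l \<or> u = r" by (rule corner) (use 2 z uvE' in simp_all)
          then show False using 2 sides6 by blast
        next
          case 3
          have "v = l \<or> v = r" by (rule corner) (use 3 z uvE' in simp_all)
          then show False using 3 sides6 by blast
        next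
          case 4
          have "u = l \<or> u = r" by (rule corner) (use 4 z uvE' in simp_all)
          then show False using 4 sides6 by blast
        qed
      qed
      have "u \<noteq> v" "x \<noteq> u" "x \<noteq> v" "y \<noteq> u" "y \<noteq> v" using c ccw_distinct by blast+
      then have no: "\<not> {s, t} \<subseteq> {u, v, y}" "\<not> {s, t} \<subseteq> {u, v, x}"
        using no_st Q' by blast+
      have "(\<tau> {u, v, y} = \<tau> {u, v, x}) = ((u < x) = (u < y))"
        by (rule old_uv[OF uvD(1,2) c]; rule old_edge; use Q' no in \<open>auto simp: doubleton_eq_iff\<close>)
      then show ?thesis using no by (simp add: \<tau>'_old)
    qed
  qed
qed

definition side_norm :: "(nat set \<Rightarrow> 'k::sqrt_field grassmann) \<Rightarrow> nat \<Rightarrow> nat \<Rightarrow> nat \<Rightarrow> 'k grassmann" where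
  "side_norm L u v w = gsqrt (L {u, v}) * gsqrt (L {v, w}) * gsqrt (L {w, u})"

text \<open>
  The vectors V realize D. The conditions on planarity and orientation
  make the apexes and the signs of a quadrilateral well determined.
\<close>

definition realized_by :: "nat \<Rightarrow> (nat \<Rightarrow> 'k::sqrt_field svec) \<Rightarrow> 'k decorated \<Rightarrow> bool" where
  "realized_by N V D \<longleftrightarrow> (\<forall>v. svec (V v)) \<and> planar (edges N D) \<and> diags D \<inter> sides N = {} \<and>
     (\<forall>e\<in>diags D. head D e \<in> e) \<and>
     (\<forall>u v. u < v \<longrightarrow> {u, v} \<in> edges N D \<longrightarrow>
        positive_even (lam D {u, v}) \<and> lam D {u, v} = bracket (V u) (V v)) \<and>
     (\<exists>\<tau>. spin_signs N D \<tau> \<and>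
       (\<forall>u v w. ccw u v w \<longrightarrow> {u, v} \<in> edges N D \<longrightarrow> {v, w} \<in> edges N D \<longrightarrow> {w, u} \<in> edges N D \<longrightarrow>
          mu D {u, v, w} * side_norm (lam D) u v w = sg (\<tau> {u, v, w}) * odd_invariant (V u) (V v) (V w)))"

lemma side_norm_cyclic:
  assumes "positive_even (L {u, v})" "positive_even (L {v, w})" "positive_even (L {w, u})"
  shows "side_norm L v w u = side_norm L u v w"
  using assms even_commute[OF positive_evenD[OF gsqrt(1)[OF assms(1)]], of "gsqrt (L {v, w}) * gsqrt (L {w, u})"]
  by (simp add: side_norm_def mult.assoc)

text \<open>
  Up to signs this is \<open>flip_super_vectors\<close>. To apply it, the cut of the cyclic order is moved to the
  vertex l, and \<open>sgn3\<close> below is the sign by which this changes an odd invariant.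
\<close>

lemma flip_realized:
  assumes R: "realized_by N V D" and F: "flip N D D'"
  shows "realized_by N V D'"
proof -
  obtain \<tau> where svec: "\<And>v. svec (V v)" and pl: "planar (edges N D)" and disj: "diags D \<inter> sides N = {}"
    and hd: "\<forall>e\<in>diags D. head D e \<in> e"
    and lam: "\<And>u v. u < v \<Longrightarrow> {u, v} \<in> edges N D \<Longrightarrow>
        positive_even (lam D {u, v}) \<and> lam D {u, v} = bracket (V u) (V v)"
    and sp: "spin_signs N D \<tau>"
    and mu: "\<And>u v w. ccw u v w \<Longrightarrow> {u, v} \<in> edges N D \<Longrightarrow> {v, w} \<in> edges N D \<Longrightarrow> {w, u} \<in> edges N D \<Longrightarrow>
          mu D {u, v, w} * side_norm (lam D) u v w = sg (\<tau> {u, v, w}) * odd_invariant (V u) (V v) (V w)"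
    using R unfolding realized_by_def by blast
  obtain l r s t where lr: "{l, r} \<in> diags D" "head D {l, r} = r" and ccw: "ccw l s r" "ccw r t l"
    and E: "{{l, t}, {t, r}, {r, s}, {s, l}} \<subseteq> edges N D"
    and D'_eq: "let a = lam D {l, t}; b = lam D {t, r}; c = lam D {r, s}; d = lam D {s, l};
          e = lam D {l, r}; \<theta> = mu D {l, r, t}; \<sigma> = mu D {l, r, s};
          f = (a * c + b * d + gsqrt (a * b * c * d) * \<sigma> * \<theta>) / e
      in D' = \<lparr>diags = insert {s, t} (diags D - {{l, r}}),
               head = (head D)({s, t} := t,
                               {t, r} := (if head D {t, r} = t then r else t)),
               lam = (lam D)({s, t} := f),
               mu = (mu D)({l, s, t} := (\<theta> * gsqrt (b * d) + \<sigma> * gsqrt (a * c)) / gsqrt (e * f),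
                           {r, s, t} := (\<sigma> * gsqrt (b * d) - \<theta> * gsqrt (a * c)) / gsqrt (e * f))\<rparr>"
    using F unfolding flip_def edges_def[symmetric] by (elim exE conjE) (rule that)
  define a b c d e \<theta> \<sigma> where defs: "a = lam D {l, t}" "b = lam D {t, r}" "c = lam D {r, s}" "d = lam D {s, l}"
    "e = lam D {l, r}" "\<theta> = mu D {l, r, t}" "\<sigma> = mu D {l, r, s}"
  define f where "f = (a * c + b * d + gsqrt (a * b * c * d) * \<sigma> * \<theta>) / e"
  have D': "diags D' = insert {s, t} (diags D - {{l, r}})"
      "head D' = (head D)({s, t} := t, {t, r} := (if head D {t, r} = t then r else t))"
      "lam D' = (lam D)({s, t} := f)"
      "mu D' = (mu D)({l, s, t} := (\<theta> * gsqrt (b * d) + \<sigma> * gsqrt (a * c)) / gsqrt (e * f),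
          {r, s, t} := (\<sigma> * gsqrt (b * d) - \<theta> * gsqrt (a * c)) / gsqrt (e * f))"
    using D'_eq unfolding Let_def defs[symmetric] f_def[symmetric] by simp_all
  note quad = ccw_quadrilateral[OF ccw]
  have dist: "l \<noteq> r" "l \<noteq> s" "l \<noteq> t" "r \<noteq> s" "r \<noteq> t" "s \<noteq> t"
    using quad(3) by auto
  have lrE: "{l, r} \<in> edges N D" using lr(1) by (simp add: edges_def)
  have E2: "{l, t} \<in> edges N D" "{t, r} \<in> edges N D" "{r, s} \<in> edges N D" "{s, l} \<in> edges N D" "{l, r} \<in> edges N D"
    "{t, l} \<in> edges N D" "{r, t} \<in> edges N D" "{s, r} \<in> edges N D" "{l, s} \<in> edges N D" "{r, l} \<in> edges N D"
    using E lrE by (simp_all add: insert_commute)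
  have edges': "edges N D' = insert {s, t} (edges N D - {{l, r}})"
    using D'(1) lr(1) disj by (auto simp: edges_def)
  have pl': "planar (edges N D')"
    unfolding edges' by (rule planar_flip[OF pl lrE ccw E])
  have "crosses {l, r} {s, t}" using ccw quad ccw_cyclic unfolding crosses_iff by blast
  then have "{s, t} \<notin> edges N D" using planarD(2)[OF pl lrE] by blast
  then have disj': "diags D' \<inter> sides N = {}" using disj by (auto simp: D' edges_def)
  have hd': "\<forall>e\<in>diags D'. head D' e \<in> e" using hd by (auto simp: D')
  \<comment> \<open>Reversing the vectors numbered below l makes all brackets in the cyclic order positive.\<close>
  define W where "W v = signed (l \<le> v) (V v)" for v
  have svecW: "svec (W v)" for v by (simp add: W_def svec svec_signed)
  have brW: "bracket (W u) (W v) = (if u < v then bracket (V u) (V v) else bracket (V v) (V u))"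
    if uv: "u < v \<and> v < l \<or> v < l \<and> l \<le> u \<or> l \<le> u \<and> u < v" for u v
  proof -
    consider "u < v" "(l \<le> u) = (l \<le> v)" | "v < u" "(l \<le> u) = (\<not> l \<le> v)" using uv by fastforce
    then show ?thesis
      by cases (simp_all add: W_def bracket_signed sg_flip bracket_antisym[OF svec svec, of u v])
  qed
  have lamW: "lam D {u, v} = bracket (W u) (W v) \<and> positive_even (lam D {u, v})"
    if "{u, v} \<in> edges N D" "u < v \<and> v < l \<or> v < l \<and> l \<le> u \<or> l \<le> u \<and> u < v" for u v
    using lam[of u v] lam[of v u] that brW[OF that(2)] by (auto simp: insert_commute)
  have vals: "a = bracket (W l) (W t)" "b = bracket (W r) (W t)" "c = bracket (W s) (W r)"
      "d = bracket (W l) (W s)" "e = bracket (W l) (W r)"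
    and pos: "positive_even a" "positive_even b" "positive_even c" "positive_even d" "positive_even e"
    using lamW[of l t] lamW[of r t] lamW[of s r] lamW[of l s] lamW[of l r] quad(3) E2
    by (auto simp: defs insert_commute)
  define sgn3 where "sgn3 u v w = ((l \<le> u) = ((l \<le> v) = (l \<le> w)))" for u v w
  have oddW: "odd_invariant (V u) (V v) (V w) = sg (sgn3 u v w) * odd_invariant (W u) (W v) (W w)" for u v w
    unfolding W_def odd_invariant_signed sgn3_def by (auto simp: sg_def)
  define \<rho> where "\<rho> = (\<tau> {l, r, t} = sgn3 l r t)"
  have old: "(\<tau> {l, r, t} = \<tau> {l, r, s}) = ((l < s) = (l < t))"
    using sp lr ccw E unfolding spin_signs_def by blast
  then have \<rho>2: "\<rho> = (\<tau> {l, r, s} = sgn3 l s r)"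
    unfolding \<rho>_def sgn3_def using quad(3) by auto
  have \<theta>: "\<theta> * (gsqrt a * gsqrt b * gsqrt e) = sg \<rho> * odd_invariant (W l) (W r) (W t)"
  proof -
    have "\<theta> * side_norm (lam D) l r t = sg (\<tau> {l, r, t}) * odd_invariant (V l) (V r) (V t)"
      unfolding defs by (rule mu) (use E2 quad ccw ccw_cyclic in blast)+
    moreover have "side_norm (lam D) l r t = gsqrt a * gsqrt b * gsqrt e"
      using side_norm_cyclic[of "lam D" t l r] side_norm_cyclic[of "lam D" l r t] pos
        even_commute[OF positive_evenD[OF gsqrt(1)[OF pos(2)]]]
      by (simp add: side_norm_def defs insert_commute mult.assoc)
    ultimately show ?thesis by (simp add: oddW \<rho>_def sg_flip)
  qed
  have \<sigma>: "\<sigma> * (gsqrt c * gsqrt d * gsqrt e) = sg \<rho> * odd_invariant (W l) (W s) (W r)"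
  proof -
    have "mu D {l, s, r} * side_norm (lam D) l s r = sg (\<tau> {l, s, r}) * odd_invariant (V l) (V s) (V r)"
      by (rule mu) (use E2 quad ccw ccw_cyclic in blast)+
    moreover have "side_norm (lam D) l s r = gsqrt c * gsqrt d * gsqrt e"
      using even_commute[OF positive_evenD[OF gsqrt(1)[OF pos(3)]]]
      by (simp add: side_norm_def defs insert_commute)
    moreover have "{l, s, r} = {l, r, s}" by blast
    ultimately show ?thesis by (simp add: oddW \<rho>2 sg_flip defs)
  qed
  note FV = flip_super_vectors[OF svecW svecW svecW svecW vals pos \<theta> \<sigma> f_def]
  define \<tau>' where "\<tau>' = \<tau>({l, s, t} := (\<tau> {l, r, t} = ((l < s) = (l < r))),
       {r, s, t} := (\<tau> {l, r, t} \<noteq> ((s < r) = (l < r))))"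
  have sp': "spin_signs N D' \<tau>'"
    by (rule spin_signs_flip[OF sp hd pl disj lr ccw E D'(1,2) \<tau>'_def])
  have \<tau>'_L: "\<tau>' {l, s, t} = (\<rho> = sgn3 l s t)" and \<tau>'_R: "\<tau>' {r, s, t} = (\<rho> \<noteq> sgn3 s r t)"
  proof -
    have "{l, s, t} \<noteq> {r, s, t}" using dist by blast
    then have "\<tau>' {l, s, t} = (\<tau> {l, r, t} = ((l < s) = (l < r)))"
      "\<tau>' {r, s, t} = (\<tau> {l, r, t} \<noteq> ((s < r) = (l < r)))"
      by (simp_all add: \<tau>'_def)
    moreover have "((l < s) = (l < r)) = (sgn3 l r t = sgn3 l s t)" "((s < r) = (l < r)) = (sgn3 l r t = sgn3 s r t)"
      unfolding sgn3_def using quad(3) by (elim disjE; simp)+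
    ultimately show "\<tau>' {l, s, t} = (\<rho> = sgn3 l s t)" "\<tau>' {r, s, t} = (\<rho> \<noteq> sgn3 s r t)"
      unfolding \<rho>_def by argo+
  qed
  have \<tau>'_old: "\<tau>' X = \<tau> X" if "\<not> {s, t} \<subseteq> X" for X
    using that by (auto simp: \<tau>'_def)
  have st_order: "s < t \<and> t < l \<or> t < l \<and> l \<le> s \<or> l \<le> s \<and> s < t" using quad(3) by auto
  have lam': "positive_even (lam D' {u, v}) \<and> lam D' {u, v} = bracket (V u) (V v)"
    if "u < v" "{u, v} \<in> edges N D'" for u v
  proof (cases "{u, v} = {s, t}")
    case True
    then have "lam D' {u, v} = f" by (simp add: D'(3))
    moreover from True consider "u = s" "v = t" | "u = t" "v = s" by (auto simp: doubleton_eq_iff)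
    then have "f = bracket (V u) (V v)"
      using FV(1) brW[OF st_order] that(1) by cases auto
    ultimately show ?thesis using FV(2) by simp
  next
    case False
    then have "{u, v} \<in> edges N D" "lam D' {u, v} = lam D {u, v}" using that(2) by (simp_all add: D'(3) edges')
    then show ?thesis using lam[OF that(1)] by metis
  qed
  have pos': "positive_even (lam D' {u, v})" if "{u, v} \<in> edges N D'" for u v
    using lam'[of u v] lam'[of v u] that planarD(1)[OF pl' that]
    by (cases u v rule: linorder_cases) (auto simp: insert_commute)
  have E': "{l, t} \<in> edges N D'" "{t, r} \<in> edges N D'" "{r, s} \<in> edges N D'" "{s, l} \<in> edges N D'" "{s, t} \<in> edges N D'"
    "{t, l} \<in> edges N D'" "{r, t} \<in> edges N D'" "{s, r} \<in> edges N D'" "{l, s} \<in> edges N D'" "{t, s} \<in> edges N D'"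
    using E2 dist by (simp_all add: edges' doubleton_eq_iff insert_commute)
  have lam'_sides: "lam D' {t, l} = a" "lam D' {l, s} = d" "lam D' {s, t} = f" "lam D' {s, r} = c" "lam D' {r, t} = b"
      "lam D' {t, s} = f"
    using dist by (simp_all add: D'(3) defs doubleton_eq_iff insert_commute)
  define good where "good u v w \<longleftrightarrow>
      mu D' {u, v, w} * side_norm (lam D') u v w = sg (\<tau>' {u, v, w}) * odd_invariant (V u) (V v) (V w)" for u v w
  have good_cyclic: "good v w u"
    if "good u v w" "{u, v} \<in> edges N D'" "{v, w} \<in> edges N D'" "{w, u} \<in> edges N D'" for u v w
  proof -
    have "{v, w, u} = {u, v, w}" by blast
    then show ?thesis
      using that(1) side_norm_cyclic[of "lam D'" u v w] pos' that(2-4)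
        odd_invariant_cyclic[OF svec svec svec, of v w u] 
      by (simp add: good_def odd_invariant_cyclic[OF svec svec svec, of u v w])
  qed
  have good_L: "good l s t"
  proof -
    have "mu D' {l, s, t} = (\<theta> * gsqrt (b * d) + \<sigma> * gsqrt (a * c)) / gsqrt (e * f)"
      using dist by (auto simp: D'(4))
    moreover have "side_norm (lam D') l s t = gsqrt a * gsqrt d * gsqrt f"
      using even_commute[OF positive_evenD[OF gsqrt(1)[OF pos(1)]], of "gsqrt d * gsqrt f"]
      by (simp add: side_norm_def lam'_sides mult.assoc)
    ultimately show ?thesis
      using FV(3) by (cases "sgn3 l s t") (simp_all add: good_def oddW \<tau>'_L sg_flip)
  qed
  have good_R: "good s r t"
  proof -
    have "{s, r, t} = {r, s, t}" by blast
    moreover have "mu D' {r, s, t} = (\<sigma> * gsqrt (b * d) - \<theta> * gsqrt (a * c)) / gsqrt (e * f)"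
      by (simp add: D'(4))
    moreover have "side_norm (lam D') s r t = gsqrt b * gsqrt c * gsqrt f"
      using even_commute[OF positive_evenD[OF gsqrt(1)[OF pos(2)]], of "gsqrt c"]
      by (simp add: side_norm_def lam'_sides)
    ultimately show ?thesis
      using FV(4) by (cases "sgn3 s r t"; cases \<rho>) (simp_all add: good_def oddW \<tau>'_R sg_flip)
  qed
  have good_st: "good s t w" if w: "ccw s t w" "{t, w} \<in> edges N D'" "{w, s} \<in> edges N D'" for w
  proof -
    have "w = l"
      by (rule planar_apex_unique[OF pl' E'(5) w(2,3) E'(6,9) w(1)]) (use quad ccw_cyclic in blast)
    then show ?thesis using good_cyclic[OF good_L] E' by simp
  qed
  have good_ts: "good t s w" if w: "ccw t s w" "{s, w} \<in> edges N D'" "{w, t} \<in> edges N D'" for w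
  proof -
    have "w = r"
      by (rule planar_apex_unique[OF pl' E'(10) w(2,3) E'(8,7) w(1)]) (use quad ccw_cyclic in blast)
    then show ?thesis using good_cyclic[OF good_cyclic[OF good_R]] E' by simp
  qed
  have good_new: "good u v w"
    if "ccw u v w" "{u, v} \<in> edges N D'" "{v, w} \<in> edges N D'" "{w, u} \<in> edges N D'" "{u, v} = {s, t}" for u v w
  proof -
    from that(5) consider "u = s" "v = t" | "u = t" "v = s" by (auto simp: doubleton_eq_iff)
    then show ?thesis using that good_st good_ts by cases auto
  qed
  have mu': "good u v w"
    if uvw: "ccw u v w" "{u, v} \<in> edges N D'" "{v, w} \<in> edges N D'" "{w, u} \<in> edges N D'" for u v w
  proof -
    have c: "ccw v w u" "ccw w u v" using uvw(1) ccw_cyclic by blast+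
    consider "{u, v} = {s, t}" | "{v, w} = {s, t}" | "{w, u} = {s, t}"
      | "{u, v} \<noteq> {s, t}" "{v, w} \<noteq> {s, t}" "{w, u} \<noteq> {s, t}" by argo
    then show ?thesis
    proof cases
      case 1
      then show ?thesis using good_new uvw by blast
    next
      case 2
      then have "good v w u" using good_new[OF c(1) uvw(3,4,2)] by blast
      then show ?thesis using good_cyclic uvw by blast
    next
      case 3
      then have "good w u v" using good_new[OF c(2) uvw(4,2,3)] by blast
      then show ?thesis using good_cyclic uvw by blast
    next
      case 4
      then have old: "{u, v} \<in> edges N D" "{v, w} \<in> edges N D" "{w, u} \<in> edges N D"
        using uvw by (simp_all add: edges')
      have no: "\<not> {s, t} \<subseteq> {u, v, w}" using 4 dist(6) by (auto simp: insert_commute)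
      moreover from no have "{u, v, w} \<noteq> {l, s, t}" "{u, v, w} \<noteq> {r, s, t}" by blast+
      ultimately show ?thesis
        using mu[OF uvw(1) old] 4 by (simp add: good_def \<tau>'_old D'(3,4) side_norm_def)
    qed
  qed
  show ?thesis
    unfolding realized_by_def
  proof (intro conjI exI)
    show "spin_signs N D' \<tau>'" by (rule sp')
    show "\<forall>u v w. ccw u v w \<longrightarrow> {u, v} \<in> edges N D' \<longrightarrow> {v, w} \<in> edges N D' \<longrightarrow> {w, u} \<in> edges N D' \<longrightarrow>
        mu D' {u, v, w} * side_norm (lam D') u v w = sg (\<tau>' {u, v, w}) * odd_invariant (V u) (V v) (V w)"
      using mu' unfolding good_def by blast
  qed (use svec pl' disj' hd' lam' in blast)+
qed

text \<open>
  All decorated triangulations reached by flips are realized by the same vectors, so the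
  lambda-length of an edge is the bracket of the vectors at its ends.
\<close>

lemma super_lambda_eqI:
  assumes "realized_by N V D" "(flip N)\<^sup>*\<^sup>* D D'" "{u, v} \<in> diags D'" "lam D' {u, v} = x"
  shows "super_lambda N D {u, v} = x"
proof -
  have reach: "realized_by N V D''" if "(flip N)\<^sup>*\<^sup>* D D''" for D''
    using that assms(1) by (induction rule: rtranclp_induct) (auto intro: flip_realized)
  have "lam D'' {u, v} = bracket (V (min u v)) (V (max u v))"
    if "(flip N)\<^sup>*\<^sup>* D D''" "{u, v} \<in> diags D''" for D''
  proof -
    have "u \<noteq> v" and *: "\<And>u v. u < v \<Longrightarrow> {u, v} \<in> edges N D'' \<Longrightarrow> lam D'' {u, v} = bracket (V u) (V v)"
      using reach[OF that(1)] that(2) planarD(1)[of "edges N D''" "{u, v}"]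
      unfolding realized_by_def by (auto simp: edges_def)
    then show ?thesis
      using that(2) *[of u v] *[of v u] by (cases "u < v") (auto simp: edges_def insert_commute min_def max_def)
  qed
  then show ?thesis
    unfolding super_lambda_def using assms(2-4) by (intro the_equality) metis+
qed

section \<open>The strip of triangles crossed by the arc\<close>

lemma ccw_less:
  assumes "a < b"
  shows "ccw a c b \<longleftrightarrow> a < c \<and> c < b" "ccw b c a \<longleftrightarrow> c < a \<or> b < c"
  using assms by (auto simp: ccw_def)

lemma crosses_linear:
  assumes "a < b" "c < d"
  shows "crosses {a, b} {c, d} \<longleftrightarrow> a < c \<and> c < b \<and> b < d \<or> c < a \<and> a < d \<and> d < b"
  unfolding crosses_iff ccw_less[OF assms(1)] using assms by auto

lemma ccw_zero: "ccw 0 b c \<longleftrightarrow> 0 < b \<and> b < c" "ccw b c 0 \<longleftrightarrow> 0 < b \<and> b < c"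
  by (auto simp: ccw_def)

text \<open>
  All geometry of the strip is expressed by the number \<open>rel x\<close> of counterclockwise steps from i to x:
  the vertices q lie strictly between 0 and the position J of j, the vertices p strictly beyond J, and
  along the arc the former increase weakly and the latter decrease weakly.
\<close>

locale crossing_strip =
  fixes n i j :: nat and p q :: "nat \<Rightarrow> nat" and T :: "nat set set"
  assumes n: "2 \<le> n" and tri: "triangulation (n + 2) T" and i: "i < n + 2" and j: "j < n + 2"
    and cross: "\<forall>e\<in>T. crosses e {i, j}" and seq: "crossing_sequence n i j p q T"
begin

abbreviation "N \<equiv> n + 2"
abbreviation "d \<equiv> diag p q"

definition rel :: "nat \<Rightarrow> nat" where
  "rel x = (if i \<le> x then x - i else x + N - i)"

lemma rel_simps: "rel i = 0" "x < N \<Longrightarrow> rel x < N" "x < N \<Longrightarrow> y < N \<Longrightarrow> rel x = rel y \<longleftrightarrow> x = y"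
  using i by (auto simp: rel_def)

lemma ccw_rel:
  assumes "a < N" "b < N" "c < N"
  shows "ccw a b c \<longleftrightarrow> ccw (rel a) (rel b) (rel c)"
proof -
  have "ccw (rel a) (rel b) (rel c)" if abc: "ccw a b c" "a < N" "b < N" "c < N" for a b c
  proof -
    consider "a < b" "b < c" | "b < c" "c < a" | "c < a" "a < b"
      using abc(1) unfolding ccw_def by blast
    then show ?thesis
      using abc(2-4) i
      by cases (cases "i \<le> a"; cases "i \<le> b"; cases "i \<le> c"; simp add: rel_def ccw_def; linarith)+
  qed
  then show ?thesis
    using assms ccw_total ccw_asym ccw_distinct rel_simps(3) by metis
qed

lemma crosses_rel:
  assumes "a < N" "b < N" "c < N" "e < N"
  shows "crosses {a, b} {c, e} \<longleftrightarrow> crosses {rel a, rel b} {rel c, rel e}"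
  using assms by (simp add: crosses_iff ccw_rel)

lemma sides_rel:
  assumes "a < N" "b < N"
  shows "{a, b} \<in> sides N \<longleftrightarrow> rel b = Suc (rel a) \<or> rel a = Suc (rel b) \<or> {rel a, rel b} = {0, N - 1}"
proof -
  have "{a, b} \<in> sides N \<longleftrightarrow> b = Suc a \<or> a = Suc b \<or> a = 0 \<and> b = N - 1 \<or> b = 0 \<and> a = N - 1"
    using assms unfolding sides_def by (auto simp: doubleton_eq_iff)
  moreover have "b = Suc a \<or> a = N - 1 \<and> b = 0 \<longleftrightarrow> rel b = Suc (rel a) \<or> rel a = N - 1 \<and> rel b = 0"
    if "a < N" "b < N" for a b
  proof (cases "i \<le> a")
    case True
    then show ?thesis using that i by (cases "i \<le> b") (simp_all add: rel_def, linarith+)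
  next
    case False
    then show ?thesis using that i by (cases "i \<le> b") (simp_all add: rel_def, linarith+)
  qed
  note this[OF assms] this[OF assms(2,1)]
  ultimately show ?thesis unfolding doubleton_eq_iff by argo
qed

abbreviation "Q m \<equiv> rel (q m)"
abbreviation "P m \<equiv> rel (p m)"
abbreviation "J \<equiv> rel j"

lemma T_eq: "T = d ` {1..<n}"
  using seq by (simp add: crossing_sequence_def)

lemma T_D: "e \<in> T \<Longrightarrow> \<exists>m. 1 \<le> m \<and> m < n \<and> e = {q m, p m}"
  by (auto simp: T_eq diag_def insert_commute)

lemma d_bounds:
  assumes "1 \<le> m" "m < n"
  shows "p m < N" "q m < N" 
proof -
  have "d m \<in> diagonals N" using tri T_eq assms unfolding triangulation_def by auto
  then show "p m < N" "q m < N" by (auto simp: diagonals_def diag_def doubleton_eq_iff)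
qed

lemma d_rel:
  assumes "1 \<le> m" "m < n"
  shows "0 < Q m" "Q m < J" "J < P m" "P m < N"
proof -
  have "ccw i (q m) j" "ccw j (p m) i" using seq assms unfolding crossing_sequence_def by auto
  then have "ccw 0 (Q m) J" "ccw J (P m) 0"
    using ccw_rel[of i "q m" j] ccw_rel[of j "p m" i] i j d_bounds[OF assms] rel_simps(1) by simp_all
  then show "0 < Q m" "Q m < J" "J < P m" unfolding ccw_zero by auto
  show "P m < N" using rel_simps(2) d_bounds[OF assms] by blast
qed

lemma d_mono:
  assumes "1 \<le> m" "m \<le> m'" "m' < n"
  shows "Q m \<le> Q m'" "P m' \<le> P m"
proof -
  have "Q m \<le> Q m' \<and> P m' \<le> P m"
  proof (cases "m = m'")
    case False
    have "1 \<le> m'" "m < n" using assms by auto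
    have "q m = q m' \<or> ccw i (q m) (q m')" "p m = p m' \<or> ccw (p m') (p m) i"
      using seq assms False unfolding crossing_sequence_def by auto
    moreover have "ccw i (q m) (q m') \<longleftrightarrow> ccw 0 (Q m) (Q m')" "ccw (p m') (p m) i \<longleftrightarrow> ccw (P m') (P m) 0"
      using ccw_rel i d_bounds[OF \<open>1 \<le> m\<close> \<open>m < n\<close>] d_bounds[OF \<open>1 \<le> m'\<close> \<open>m' < n\<close>] rel_simps(1) by simp_all
    ultimately have "Q m = Q m' \<or> Q m < Q m'" "P m = P m' \<or> P m' < P m"
      unfolding ccw_zero by metis+
    then show ?thesis by linarith
  qed simp
  then show "Q m \<le> Q m'" "P m' \<le> P m" by auto
qed

text \<open>
  By maximality of a triangulation, a chord crossing no diagonal of T belongs to T or is a side; this is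
  the source of all adjacency statements about the strip.
\<close>

lemma chord:
  assumes xy: "x < N" "y < N" "rel x < rel y"
    and nc: "\<And>m. 1 \<le> m \<Longrightarrow> m < n \<Longrightarrow>
      \<not> (rel x < Q m \<and> Q m < rel y \<and> rel y < P m) \<and> \<not> (Q m < rel x \<and> rel x < P m \<and> P m < rel y)"
  shows "rel y = Suc (rel x) \<or> rel x = 0 \<and> rel y = N - 1 \<or> (\<exists>m\<in>{1..<n}. rel x = Q m \<and> rel y = P m)"
proof (cases "{x, y} \<in> sides N")
  case True
  then show ?thesis using xy(3) unfolding sides_rel[OF xy(1,2)] by (auto simp: doubleton_eq_iff)
next
  case False
  then have diag: "{x, y} \<in> diagonals N" using xy unfolding diagonals_def by blast
  have "\<not> crosses {x, y} e" if "e \<in> T" for e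
  proof -
    obtain m where m: "1 \<le> m" "m < n" "e = {q m, p m}"
      using T_D[OF \<open>e \<in> T\<close>] by blast
    have "crosses {x, y} e \<longleftrightarrow> crosses {rel x, rel y} {Q m, P m}"
      using crosses_rel xy d_bounds[OF m(1,2)] m(3) by simp
    also have "\<not> \<dots>" using nc[OF m(1,2)] d_rel[OF m(1,2)] xy(3) crosses_linear[of "rel x" "rel y" "Q m" "P m"] by auto
    finally show ?thesis .
  qed
  then have "{x, y} \<in> T" using tri diag unfolding triangulation_def by blast
  then obtain m where m: "m \<in> {1..<n}" "{x, y} = {q m, p m}" using T_D by fastforce
  have "x = q m \<and> y = p m"
    using m(2) d_rel[of m] m(1) xy(3) by (auto simp: doubleton_eq_iff)
  then show ?thesis using m(1) by blast
qed

lemma first_diagonal: "Q 1 = 1" "P 1 = N - 1"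
proof -
  have b: "p 1 < N" "q 1 < N" "0 < Q 1" "Q 1 < J" "J < P 1" "P 1 < N" using d_bounds[of 1] d_rel[of 1] n by auto
  have "rel j < N" using j rel_simps by blast
  have m: "Q 1 \<le> Q m" "P m \<le> P 1" "0 < Q m" if "1 \<le> m" "m < n" for m using d_mono[of 1 m] d_rel[of m] that by auto
  have "Q 1 = Suc 0 \<or> (\<exists>m\<in>{1..<n}. 0 = Q m)"
    using chord[of i "q 1"] i b m rel_simps(1) by fastforce
  then show "Q 1 = 1" using m by fastforce
  have "P 1 = Suc 0 \<or> P 1 = N - 1 \<or> (\<exists>m\<in>{1..<n}. 0 = Q m)"
    using chord[of i "p 1"] i b m rel_simps(1) by fastforce
  then show "P 1 = N - 1" using m b by fastforce
qed

lemma last_diagonal: "J = Suc (Q (n - 1))" "P (n - 1) = Suc J"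
proof -
  have n1: "1 \<le> n - 1" "n - 1 < n" using n by auto
  note b = d_bounds[OF n1] d_rel[OF n1]
  have m: "Q m \<le> Q (n - 1)" "P (n - 1) \<le> P m" "Q m < J" "J < P m" if "1 \<le> m" "m < n" for m
    using d_mono[of m "n - 1"] d_rel[of m] that by auto
  have "J = Suc (Q (n - 1)) \<or> (\<exists>m\<in>{1..<n}. J = P m)"
    using chord[of "q (n - 1)" j] j b m by fastforce
  then show "J = Suc (Q (n - 1))" using m by fastforce
  have "P (n - 1) = Suc J \<or> (\<exists>m\<in>{1..<n}. J = Q m)"
    using chord[of j "p (n - 1)"] j b m by fastforce
  then show "P (n - 1) = Suc J" using m by fastforce
qed

text \<open>
  If both ends moved, or one end by more than one step, the chord between an old and a new
  end would cross nothing without being one of the diagonals.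
\<close>

lemma next_diagonal:
  assumes "1 \<le> m" "Suc m < n"
  shows "q (Suc m) = q m \<and> P m = Suc (P (Suc m)) \<or> p (Suc m) = p m \<and> Q (Suc m) = Suc (Q m)"
proof -
  have m1: "m < n" "1 \<le> Suc m" using assms by auto
  note b = d_bounds[OF assms(1) m1(1)] d_bounds[OF m1(2) assms(2)] d_rel[OF assms(1) m1(1)] d_rel[OF m1(2) assms(2)]
  have le: "Q m \<le> Q (Suc m)" "P (Suc m) \<le> P m" using d_mono[of m "Suc m"] assms by auto
  have mono: "k \<le> m \<and> Q k \<le> Q m \<and> P m \<le> P k \<or> Suc m \<le> k \<and> Q (Suc m) \<le> Q k \<and> P k \<le> P (Suc m)"
    if "1 \<le> k" "k < n" for k
    using d_mono[of k m] d_mono[of "Suc m" k] that assms by (cases "k \<le> m") auto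
  note kb = d_rel
  consider "Q m < Q (Suc m)" "P (Suc m) < P m" | "Q m = Q (Suc m)" "P (Suc m) < P m"
    | "Q m < Q (Suc m)" "P (Suc m) = P m" | "Q m = Q (Suc m)" "P m = P (Suc m)" using le by linarith
  then show ?thesis
  proof cases
    case 1
    have "P m = Suc (Q (Suc m)) \<or> (\<exists>k\<in>{1..<n}. Q (Suc m) = Q k \<and> P m = P k)"
    proof -
      have "\<not> (Q (Suc m) < Q k \<and> Q k < P m \<and> P m < P k) \<and> \<not> (Q k < Q (Suc m) \<and> Q (Suc m) < P k \<and> P k < P m)"
        if "1 \<le> k" "k < n" for k
        using mono[OF that] 1 by linarith
      then show ?thesis using chord[of "q (Suc m)" "p m"] b by fastforce
    qed
    then obtain k where "k\<in>{1..<n}" "Q (Suc m) = Q k" "P m = P k" using b by fastforce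
    then have False using mono[of k] 1 by auto
    then show ?thesis ..
  next
    case 2
    have "P m = Suc (P (Suc m)) \<or> (\<exists>k\<in>{1..<n}. P (Suc m) = Q k \<and> P m = P k)"
    proof -
      have "\<not> (P (Suc m) < Q k \<and> Q k < P m \<and> P m < P k) \<and> \<not> (Q k < P (Suc m) \<and> P (Suc m) < P k \<and> P k < P m)"
        if "1 \<le> k" "k < n" for k
        using mono[OF that] 2 kb[OF that] b by linarith
      then show ?thesis using chord[of "p (Suc m)" "p m"] b 2 by fastforce
    qed
    moreover have "P (Suc m) \<noteq> Q k" if "k\<in>{1..<n}" for k using kb[of k] that b by auto
    ultimately show ?thesis using 2 b rel_simps(3) by auto
  next
    case 3
    have "Q (Suc m) = Suc (Q m) \<or> (\<exists>k\<in>{1..<n}. Q m = Q k \<and> Q (Suc m) = P k)"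
    proof -
      have "\<not> (Q m < Q k \<and> Q k < Q (Suc m) \<and> Q (Suc m) < P k) \<and> \<not> (Q k < Q m \<and> Q m < P k \<and> P k < Q (Suc m))"
        if "1 \<le> k" "k < n" for k
        using mono[OF that] 3 kb[OF that] b by linarith
      then show ?thesis using chord[of "q m" "q (Suc m)"] b 3 by fastforce
    qed
    moreover have "Q (Suc m) \<noteq> P k" if "k\<in>{1..<n}" for k using kb[of k] that b by auto
    ultimately show ?thesis using 3 b rel_simps(3) by auto
  next
    case 4
    then have "d m = d (Suc m)" using b rel_simps(3) by (simp add: diag_def)
    moreover have "d m \<noteq> d (Suc m)" using seq assms unfolding crossing_sequence_def by auto
    ultimately show ?thesis by simp
  qed
qed

end

text \<open>
  Adjacent fan centers come from adjacent triangles.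
\<close>

lemma remdups_adj_step:
  assumes "Suc s < length (remdups_adj xs)"
  shows "\<exists>k. Suc k < length xs \<and> xs ! k = remdups_adj xs ! s \<and> xs ! Suc k = remdups_adj xs ! Suc s"
  using assms
proof (induction xs arbitrary: s rule: remdups_adj.induct)
  case (3 x y xs)
  show ?case
  proof (cases "x = y")
    case True
    then obtain k where "Suc k < length (x # xs)" "(x # xs) ! k = remdups_adj (x # xs) ! s"
        "(x # xs) ! Suc k = remdups_adj (x # xs) ! Suc s"
      using 3 by fastforce
    then show ?thesis using True by (intro exI[of _ "Suc k"]) simp
  next
    case False
    have hd: "remdups_adj (y # xs) ! 0 = y" "remdups_adj (y # xs) \<noteq> []"
      by (metis hd_conv_nth hd_remdups_adj list.sel(1) list.distinct(1) remdups_adj_Nil_iff)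
        (simp add: remdups_adj_Nil_iff)
    show ?thesis
    proof (cases s)
      case 0
      then show ?thesis using False hd by (intro exI[of _ 0]) simp
    next
      case (Suc s')
      then obtain k where "Suc k < length (y # xs)" "(y # xs) ! k = remdups_adj (y # xs) ! s'"
        "(y # xs) ! Suc k = remdups_adj (y # xs) ! Suc s'"
        using 3 False by fastforce
      then show ?thesis using False Suc by (intro exI[of _ "Suc k"]) simp
    qed
  qed
qed simp_all

lemma doubleton_eqI: "a \<in> {x, y} \<Longrightarrow> b \<in> {x, y} \<Longrightarrow> a \<noteq> b \<Longrightarrow> {x, y} = {a, b}"
  by auto

lemma the_third_side:
  assumes "a \<noteq> b" "b \<noteq> c" "a \<noteq> c"
  shows "(THE e. e \<subseteq> {a, b, c} \<and> card e = 2 \<and> e \<noteq> {a, b} \<and> e \<noteq> {a, c}) = {b, c}"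
proof (rule the_equality)
  show "{b, c} \<subseteq> {a, b, c} \<and> card {b, c} = 2 \<and> {b, c} \<noteq> {a, b} \<and> {b, c} \<noteq> {a, c}"
    using assms by (auto simp: doubleton_eq_iff)
  fix e assume e: "e \<subseteq> {a, b, c} \<and> card e = 2 \<and> e \<noteq> {a, b} \<and> e \<noteq> {a, c}"
  then obtain x y where xy: "e = {x, y}" "x \<noteq> y" by (auto simp: card_2_iff)
  with e have "x \<in> {a, b, c}" "y \<in> {a, b, c}" by auto
  then show "e = {b, c}"
    using e unfolding xy(1) by (elim insertE emptyE) (use xy(2) in \<open>simp_all add: insert_commute\<close>)
qed

context crossing_strip
begin

abbreviation "u \<equiv> apex_before n i j p q"
abbreviation "v \<equiv> apex_after n i j p q"
abbreviation "tr \<equiv> triangle n i j p q"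
abbreviation "E \<equiv> T \<union> sides N"

lemma ij_rel: "J < N" "0 < J" "i \<noteq> j"
  using rel_simps(2)[OF j] d_rel[of 1] n rel_simps(1) by (auto intro: gr0I)

lemma pq_distinct:
  assumes "1 \<le> m" "m < n"
  shows "p m \<noteq> q m" "p m \<noteq> i" "q m \<noteq> i" "p m \<noteq> j" "q m \<noteq> j"
  using d_rel[OF assms] rel_simps(1) by auto

lemma d_inj: "1 \<le> k \<Longrightarrow> k < m \<Longrightarrow> m < n \<Longrightarrow> d k \<noteq> d m"
  using seq unfolding crossing_sequence_def by simp

lemma d_in_E: "1 \<le> m \<Longrightarrow> m < n \<Longrightarrow> {p m, q m} \<in> E" 
  by (auto simp: T_eq diag_def)

lemma side_in_E: "x < N \<Longrightarrow> y < N \<Longrightarrow> rel y = Suc (rel x) \<Longrightarrow> {x, y} \<in> sides N"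
  using sides_rel by blast

lemma apex_before_first: "u 1 = i" "tr 1 = {i, p 1, q 1}"
proof -
  show "tr 1 = {i, p 1, q 1}" using n by (auto simp: triangle_def diag_def)
  then show "u 1 = i" unfolding apex_before_def diag_def
    using pq_distinct[of 1] n by (intro the_equality) auto
qed

lemma apex_after_last: "v (n - 1) = j" "tr n = {j, p (n - 1), q (n - 1)}"
proof -
  show tr: "tr n = {j, p (n - 1), q (n - 1)}" using n by (auto simp: triangle_def diag_def)
  have n1: "Suc (n - 1) = n" "1 \<le> n - 1" "n - 1 < n" using n by simp_all
  show "v (n - 1) = j" unfolding apex_after_def diag_def n1(1) tr
    using pq_distinct[OF n1(2,3)] by (intro the_equality) auto
qed

text \<open>
  Whether the triangle between \<open>x\<^sub>m\<close> and \<open>x\<^sub>m\<^sub>+\<^sub>1\<close> has its fan center on the right of the arc.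
\<close>

definition turns_at_q :: "nat \<Rightarrow> bool" where
  "turns_at_q m \<longleftrightarrow> q (Suc m) = q m"

lemma turn_q:
  assumes "1 \<le> m" "Suc m < n" "turns_at_q m"
  shows "q (Suc m) = q m" "P m = Suc (P (Suc m))" "p (Suc m) \<noteq> p m" "p (Suc m) \<noteq> q m" "p m \<noteq> q m"
    "tr (Suc m) = {q m, p m, p (Suc m)}" "u (Suc m) = p m" "v m = p (Suc m)" "{p (Suc m), p m} \<in> sides N"
    "{q (Suc m), p (Suc m)} \<in> T"
proof -
  have m: "m < n" "1 \<le> Suc m" using assms by auto
  note b = d_rel[OF assms(1) m(1)] d_rel[OF m(2) assms(2)]
  show q: "q (Suc m) = q m" using assms(3) by (simp add: turns_at_q_def)
  then show P: "P m = Suc (P (Suc m))" using next_diagonal[OF assms(1,2)] n_not_Suc_n by metis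
  have "P (Suc m) \<noteq> P m" "P (Suc m) \<noteq> Q m" "P m \<noteq> Q m" using b P by linarith+
  then show d: "p (Suc m) \<noteq> p m" "p (Suc m) \<noteq> q m" "p m \<noteq> q m" by metis+
  show tr: "tr (Suc m) = {q m, p m, p (Suc m)}" using assms q by (auto simp: triangle_def diag_def)
  show "u (Suc m) = p m" unfolding apex_before_def tr diag_def using d q by (intro the_equality) auto
  show "v m = p (Suc m)" unfolding apex_after_def tr diag_def using d q by (intro the_equality) auto
  show "{p (Suc m), p m} \<in> sides N"
    by (rule side_in_E) (use d_bounds assms m P in auto)
  show "{q (Suc m), p (Suc m)} \<in> T" using assms(2) m(2) by (auto simp: T_eq diag_def)
qed

lemma turn_p:
  assumes "1 \<le> m" "Suc m < n" "\<not> turns_at_q m"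
  shows "p (Suc m) = p m" "Q (Suc m) = Suc (Q m)" "q (Suc m) \<noteq> q m" "q (Suc m) \<noteq> p m" "p m \<noteq> q m"
    "tr (Suc m) = {p m, q m, q (Suc m)}" "u (Suc m) = q m" "v m = q (Suc m)" "{q m, q (Suc m)} \<in> sides N"
    "{q (Suc m), p (Suc m)} \<in> T"
proof -
  have m: "m < n" "1 \<le> Suc m" using assms by auto
  note b = d_rel[OF assms(1) m(1)] d_rel[OF m(2) assms(2)]
  show p: "p (Suc m) = p m" and Q: "Q (Suc m) = Suc (Q m)"
    using assms(3) next_diagonal[OF assms(1,2)] unfolding turns_at_q_def by blast+
  have "Q (Suc m) \<noteq> Q m" "Q (Suc m) \<noteq> P m" "P m \<noteq> Q m" using b Q by linarith+
  then show d: "q (Suc m) \<noteq> q m" "q (Suc m) \<noteq> p m" "p m \<noteq> q m" by metis+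
  show tr: "tr (Suc m) = {p m, q m, q (Suc m)}" using assms p by (auto simp: triangle_def diag_def)
  show "u (Suc m) = q m" unfolding apex_before_def tr diag_def using d p by (intro the_equality) auto
  show "v m = q (Suc m)" unfolding apex_after_def tr diag_def using d p by (intro the_equality) auto
  show "{q m, q (Suc m)} \<in> sides N"
    by (rule side_in_E) (use d_bounds assms m Q in auto)
  show "{q (Suc m), p (Suc m)} \<in> T" using assms(2) m(2) by (auto simp: T_eq diag_def)
qed

lemma apex_before:
  assumes "1 \<le> m" "m < n"
  shows "tr m = {u m, p m, q m}" "u m < N" "rel (u m) < Q m \<or> P m < rel (u m)"
    "{u m, p m} \<in> E" "{u m, q m} \<in> E" "rel (u m) \<noteq> J"
proof -
  have "tr m = {u m, p m, q m} \<and> u m < N \<and> (rel (u m) < Q m \<or> P m < rel (u m)) \<and>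
    {u m, p m} \<in> E \<and> {u m, q m} \<in> E \<and> rel (u m) \<noteq> J"
  proof (cases "m = 1")
    case True
    have b: "1 < n" "p 1 < N" "q 1 < N" using n d_bounds[of 1] by auto
    have "{i, q 1} \<in> sides N" by (rule side_in_E) (use i b first_diagonal rel_simps(1) in auto)
    moreover have "{i, p 1} \<in> sides N"
      unfolding sides_rel[OF i b(2)] first_diagonal(2) rel_simps(1) by simp
    ultimately show ?thesis
      using True apex_before_first i first_diagonal rel_simps(1) ij_rel by simp
  next
    case False
    then obtain k where k: "m = Suc k" "1 \<le> k" using assms by (cases m) auto
    have kn: "Suc k < n" "k < n" using k assms by auto
    note b = d_bounds[OF k(2) kn(2)] d_rel[OF k(2) kn(2)]
    show ?thesis
    proof (cases "turns_at_q k")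
      case True
      note t = turn_q[OF k(2) kn(1) True]
      show ?thesis unfolding k(1) t(6) t(7)
        using t b d_in_E[OF k(2) kn(2)] by (auto simp: insert_commute)
    next
      case False
      note t = turn_p[OF k(2) kn(1) False]
      show ?thesis unfolding k(1) t(6) t(7)
        using t b d_in_E[OF k(2) kn(2)] by (auto simp: insert_commute)
    qed
  qed
  then show "tr m = {u m, p m, q m}" "u m < N" "rel (u m) < Q m \<or> P m < rel (u m)"
    "{u m, p m} \<in> E" "{u m, q m} \<in> E" "rel (u m) \<noteq> J" by blast+
qed

lemma apex_after:
  assumes "1 \<le> m" "m < n"
  shows "tr (Suc m) = {v m, p m, q m}" "v m < N" "Q m < rel (v m)" "rel (v m) < P m"
    "{v m, p m} \<in> E" "{v m, q m} \<in> E" 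
proof -
  have "tr (Suc m) = {v m, p m, q m} \<and> v m < N \<and> Q m < rel (v m) \<and> rel (v m) < P m \<and>
    {v m, p m} \<in> E \<and> {v m, q m} \<in> E"
  proof (cases "Suc m = n")
    case True
    then have m: "m = n - 1" by simp
    have b: "1 \<le> n - 1" "p (n - 1) < N" "q (n - 1) < N" using n d_bounds[of "n - 1"] by auto
    have "{q (n - 1), j} \<in> sides N" "{j, p (n - 1)} \<in> sides N"
      by (rule side_in_E; use j b last_diagonal in simp)+
    then show ?thesis
      using True m apex_after_last j last_diagonal by (simp add: insert_commute)
  next
    case False
    then have mn: "Suc m < n" using assms by simp
    have m1: "1 \<le> Suc m" by simp
    note b = d_bounds[OF m1 mn] d_rel[OF m1 mn]
    show ?thesis
    proof (cases "turns_at_q m")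
      case True
      note t = turn_q[OF assms(1) mn True]
      show ?thesis unfolding t(6) t(8) using t b by (auto simp: insert_commute)
    next
      case False
      note t = turn_p[OF assms(1) mn False]
      show ?thesis unfolding t(6) t(8) using t b by (auto simp: insert_commute)
    qed
  qed
  then show "tr (Suc m) = {v m, p m, q m}" "v m < N" "Q m < rel (v m)" "rel (v m) < P m"
    "{v m, p m} \<in> E" "{v m, q m} \<in> E" by blast+
qed

lemma apex_ccw:
  assumes "1 \<le> m" "m < n"
  shows "ccw (u m) (q m) (p m)" "ccw (q m) (v m) (p m)"
proof -
  have "Q m < P m" using d_rel[OF assms] by linarith
  then show "ccw (u m) (q m) (p m)" "ccw (q m) (v m) (p m)"
    unfolding ccw_rel[OF apex_before(2)[OF assms] d_bounds(2,1)[OF assms]]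
      ccw_rel[OF d_bounds(2)[OF assms] apex_after(2)[OF assms] d_bounds(1)[OF assms]]
    using apex_before(3)[OF assms] apex_after(3,4)[OF assms] unfolding ccw_def by blast+
qed

text \<open>
  The triangles can be glued one after the other, each adding a new vertex; this lets vectors be
  attached successively.
\<close>

lemma apex_after_fresh:
  assumes "1 \<le> k" "k \<le> m" "m < n"
  shows "v m \<notin> tr k"
proof -
  have k: "k < n" using assms by simp
  have m: "1 \<le> m" using assms by simp
  have "rel (v m) \<noteq> P k" "rel (v m) \<noteq> Q k" "rel (v m) \<noteq> rel (u k)"
    using apex_after(3,4)[OF m assms(3)] d_mono[OF assms] apex_before(3)[OF assms(1) k] by linarith+
  then have "v m \<noteq> p k" "v m \<noteq> q k" "v m \<noteq> u k" by metis+
  then show ?thesis unfolding apex_before(1)[OF assms(1) k] by simp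
qed

lemma triangle_inj:
  assumes "1 \<le> k" "k < m" "m \<le> n"
  shows "tr k \<noteq> tr m"
proof -
  obtain m' where m': "m = Suc m'" "1 \<le> m'" "m' < n" using assms by (cases m) auto
  then have "v m' \<in> tr m" "v m' \<notin> tr k"
    using apex_after(1) apex_after_fresh[of k m'] assms by auto
  then show ?thesis by blast
qed

lemma third_side:
  assumes "1 \<le> m" "Suc m < n"
  shows "third_side n i j p q m = (if turns_at_q m then {p m, v m} else {q m, v m})"
proof (cases "turns_at_q m")
  case True
  note t = turn_q[OF assms True]
  have "d m = {q m, p m}" "d (Suc m) = {q m, p (Suc m)}" using t(1) by (auto simp: diag_def)
  then show ?thesis
    using the_third_side[OF t(5)[symmetric] t(3)[symmetric] t(4)[symmetric]] True t(8)
    unfolding third_side_def t(6) by simp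
next
  case False
  note t = turn_p[OF assms False]
  have "d m = {p m, q m}" "d (Suc m) = {p m, q (Suc m)}" using t(1) by (auto simp: diag_def)
  then show ?thesis
    using the_third_side[OF t(5) t(3)[symmetric] t(4)[symmetric]] False t(8)
    unfolding third_side_def t(6) by simp
qed

text \<open>
  The alternating exchange of sides in the definition of the snake graph cancels against the
  exchange of the odd-numbered letters, leaving a rule without case distinction on parity.
\<close>

lemma dual_word:
  assumes "1 \<le> m" "Suc m < n"
  shows "dual_word n i j p q m = (if turns_at_q m then Rt else Up)"
proof -
  have "{p m, v m} \<noteq> {q m, v m}" using pq_distinct[of m] assms by (auto simp: doubleton_eq_iff)
  then show ?thesis
    unfolding dual_word_def snake_word_def third_side[OF assms] by auto
qed

lemma dual_label:
  "dual_label n i j p q m Lft = {u m, p m}" "dual_label n i j p q m Bot = {u m, q m}"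
  "dual_label n i j p q m Top = {q m, v m}" "dual_label n i j p q m Rgt = {p m, v m}"
  by (simp_all add: dual_label_def)

lemma preceding_on_right:
  assumes "1 \<le> m" "m < n" "h (d m) \<in> d m"
  shows "preceding_on_right n i j p q h m \<longleftrightarrow> h (d m) = q m"
proof -
  have c: "ccw (p m) (u m) (q m)" "\<not> ccw (q m) (u m) (p m)"
    using apex_ccw(1)[OF assms(1,2)] ccw_cyclic ccw_asym by blast+
  show ?thesis
    unfolding preceding_on_right_def using c assms(3) pq_distinct(1)[OF assms(1,2)]
    by (auto simp: diag_def doubleton_eq_iff)
qed

text \<open>
  The end that two consecutive diagonals share, according to \<open>turn_q\<close> and \<open>turn_p\<close>.
\<close>

lemma fan_center:
  assumes "2 \<le> m" "m < n"
  shows "fan_center n p q c m = (if turns_at_q (m - 1) then q m else p m)"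
    "fan_center n p q c m \<in> d m" "fan_center n p q c m \<in> d (m - 1)"
proof -
  obtain k where k: "m = Suc k" "1 \<le> k" "Suc k < n" using assms by (cases m) auto
  have "(THE x. x \<in> d k \<inter> d (Suc k)) = (if turns_at_q k then q (Suc k) else p (Suc k))"
  proof (cases "turns_at_q k")
    case True
    note t = turn_q[OF k(2,3) True]
    show ?thesis using True t by (intro the_equality) (auto simp: diag_def)
  next
    case False
    note t = turn_p[OF k(2,3) False]
    show ?thesis using False t by (intro the_equality) (auto simp: diag_def)
  qed
  then show "fan_center n p q c m = (if turns_at_q (m - 1) then q m else p m)"
    using assms k by (simp add: fan_center_def Let_def)
  then show "fan_center n p q c m \<in> d m" "fan_center n p q c m \<in> d (m - 1)"
    using turn_q[OF k(2,3)] turn_p[OF k(2,3)] k(1) by (auto simp: diag_def)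
qed

text \<open>
  A diagonal points away from the vertex that it shares with its predecessor. If it joins two
  consecutive fan centers, the shared vertex is the earlier one; otherwise that vertex is the
  only fan center on it.
\<close>

lemma default_head:
  assumes or: "default_orientation n p q c h" and m: "1 \<le> m" "Suc m < n"
  shows "h (d (Suc m)) = (if turns_at_q m then p (Suc m) else q (Suc m))"
proof -
  let ?f = "fan_center n p q c" and ?cs = "fan_centers n p q c"
  have m2: "2 \<le> Suc m" using m by simp
  have hd: "h (d (Suc m)) \<in> d (Suc m)" using or m unfolding default_orientation_def Let_def by auto
  have "h (d (Suc m)) \<noteq> ?f (Suc m)"
  proof (cases "\<exists>s. Suc s < length ?cs \<and> d (Suc m) = {?cs ! s, ?cs ! Suc s}")
    case True
    then obtain s where s: "Suc s < length ?cs" "d (Suc m) = {?cs ! s, ?cs ! Suc s}" by blast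
    then obtain k where k: "Suc k < n" "?f (Suc k) = ?cs ! s" "?f (Suc (Suc k)) = ?cs ! Suc s"
      using remdups_adj_step[of s "map ?f [1..<n + 1]"] unfolding fan_centers_def
      by (auto simp del: upt_Suc)
    have ne: "?cs ! s \<noteq> ?cs ! Suc s" using s(1) unfolding fan_centers_def by (rule remdups_adj_adjacent)
    have "3 \<le> n" using m by simp
    then have "n - 1 \<noteq> n" "n - 1 \<noteq> 1" "n \<noteq> 1" "n \<noteq> 2" by linarith+
    then have ends: "?f 2 = ?f 1" "?f n = ?f (n - 1)" unfolding fan_center_def Let_def by simp_all
    have "k \<noteq> 0"
    proof
      assume "k = 0"
      then show False using ne k ends(1) by (simp add: numeral_2_eq_2)
    qed
    moreover have "Suc (Suc k) \<noteq> n"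
    proof
      assume "Suc (Suc k) = n"
      then have "n - 1 = Suc k" by simp
      then show False using ne k ends(2) \<open>Suc (Suc k) = n\<close> by simp
    qed
    ultimately have kk: "2 \<le> Suc k" "Suc k < n" "2 \<le> Suc (Suc k)" "Suc (Suc k) < n" using k by auto
    have "?cs ! s \<in> d (Suc k)" "?cs ! Suc s \<in> d (Suc k)"
      using fan_center(2)[OF kk(1,2), of c] fan_center(3)[OF kk(3,4), of c] k by auto
    then have "d (Suc k) = {?cs ! s, ?cs ! Suc s}" unfolding diag_def using ne by (rule doubleton_eqI)
    then have "d (Suc k) = d (Suc m)" using s(2) by simp
    then have "Suc k = Suc m"
      using d_inj[of "Suc k" "Suc m"] d_inj[of "Suc m" "Suc k"] m kk
      by (cases "Suc k" "Suc m" rule: linorder_cases) auto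
    moreover have "h (d (Suc m)) = ?cs ! Suc s"
      using or s unfolding default_orientation_def Let_def by auto
    ultimately show ?thesis using k ne by auto
  next
    case False
    then have "h (d (Suc m)) \<notin> set ?cs" using or m unfolding default_orientation_def Let_def by auto
    moreover have "?f (Suc m) \<in> set ?cs" using m unfolding fan_centers_def by auto
    ultimately show ?thesis by auto
  qed
  then show ?thesis
    using hd fan_center(1)[OF m2 m(2), of c] by (auto simp: diag_def)
qed

text \<open>
  Travelling around the polygon, the vertices q from i to j and the vertices p from j to i move in
  steps of one, and each step happens inside one triangle of the strip.
\<close>

lemma side_in_triangle:
  assumes "{x, y} \<in> sides N"
  shows "\<exists>m\<in>{1..n}. {x, y} \<subseteq> tr m"
proof -
  have xyN: "x < N" "y < N" using assms by (auto simp: sides_def doubleton_eq_iff)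
  have stepQ: "\<exists>k\<ge>1. k < m \<and> Q k = c \<and> Q (Suc k) = Suc c" if "1 \<le> m" "m < n" "1 \<le> c" "c < Q m" for m c
    using that
  proof (induction m)
    case (Suc m)
    show ?case
    proof (cases "1 \<le> m")
      case True
      then show ?thesis
        using Suc next_diagonal[of m] by (metis Suc_lessD less_Suc_eq)
    next
      case False
      then have "Suc m = 1" by simp
      then show ?thesis using Suc.prems first_diagonal by auto
    qed
  qed simp
  have stepP: "\<exists>k\<ge>1. k < m \<and> P k = Suc c \<and> P (Suc k) = c" if "1 \<le> m" "m < n" "P m \<le> c" "c < N - 1" for m c
    using that
  proof (induction m)
    case (Suc m)
    show ?case
    proof (cases "1 \<le> m")
      case True
      then show ?thesis
      proof (cases "P m \<le> c")
        case le: True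
        have "m < n" using Suc.prems by simp
        then show ?thesis using Suc.IH True le Suc.prems(4) less_SucI by blast
      next
        case False
        have "P m = Suc (P (Suc m)) \<or> P m = P (Suc m)"
          using next_diagonal[OF True] Suc.prems(2) by auto
        then have "P (Suc m) = c" "P m = Suc c" using False Suc.prems(3) by auto
        then show ?thesis using True by blast
      qed
    next
      case False
      then have "Suc m = 1" by simp
      then show ?thesis using Suc.prems first_diagonal by auto
    qed
  qed simp
  have eqI: "x = y" if "x < N" "y < N" "rel x = rel y" for x y using rel_simps(3) that by blast
  have n1: "1 \<le> n - 1" "n - 1 < n" using n by auto
  have trk: "{p k, q k, p (Suc k), q (Suc k)} \<subseteq> tr (Suc k)" if "1 \<le> k" "Suc k < n" for k
    using that by (auto simp: triangle_def diag_def)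
  have main: "\<exists>m\<in>{1..n}. {x, y} \<subseteq> tr m" if "rel y = Suc (rel x)" "x < N" "y < N" for x y
  proof -
    consider "rel x = 0" | "1 \<le> rel x" "rel x < Q (n - 1)" | "rel x = Q (n - 1)" | "rel x = J" | "J < rel x"
      using last_diagonal by linarith
    then show ?thesis
    proof cases
      case 1
      have q1: "q 1 < N" using d_bounds[of 1] n by simp
      have "rel x = rel i" using 1 rel_simps(1) by metis
      then have "x = i" by (rule eqI[OF that(2) i])
      have "rel y = Q 1" unfolding first_diagonal that(1) 1 by simp
      then have "y = q 1" by (rule eqI[OF that(3) q1])
      show ?thesis unfolding \<open>x = i\<close> \<open>y = q 1\<close>
        using apex_before_first(2) n by (intro bexI[of _ 1]) auto
    next
      case 2
      then obtain k where k: "1 \<le> k" "k < n - 1" "Q k = rel x" "Q (Suc k) = Suc (rel x)" using stepQ[OF n1] by blast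
      have kn: "k < n" "Suc k < n" "1 \<le> Suc k" using k by auto
      have "x = q k" by (rule eqI[OF that(2) d_bounds(2)[OF k(1) kn(1)] k(3)[symmetric]])
      moreover have "y = q (Suc k)"
        by (rule eqI[OF that(3) d_bounds(2)[OF kn(3,2)]]) (simp only: that(1) k(4))
      ultimately show ?thesis using trk[of k] k by (intro bexI[of _ "Suc k"]) auto
    next
      case 3
      have "x = q (n - 1)" by (rule eqI[OF that(2) d_bounds(2)[OF n1] 3])
      moreover have "y = j" by (rule eqI[OF that(3) j]) (simp only: that(1) 3 last_diagonal(1))
      ultimately show ?thesis using apex_after_last(2) n by (intro bexI[of _ n]) auto
    next
      case 4
      have "x = j" by (rule eqI[OF that(2) j 4])
      moreover have "y = p (n - 1)" by (rule eqI[OF that(3) d_bounds(1)[OF n1]]) (simp only: that(1) 4 last_diagonal(2))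
      ultimately show ?thesis using apex_after_last(2) n by (intro bexI[of _ n]) auto
    next
      case 5
      then have "P (n - 1) \<le> rel x" "rel x < N - 1" using last_diagonal that rel_simps(2)[of y] by auto
      then obtain k where k: "1 \<le> k" "k < n - 1" "P (Suc k) = rel x" "P k = Suc (rel x)" using stepP[OF n1] by blast
      have kn: "k < n" "Suc k < n" "1 \<le> Suc k" using k by auto
      have "x = p (Suc k)" by (rule eqI[OF that(2) d_bounds(1)[OF kn(3,2)] k(3)[symmetric]])
      moreover have "y = p k"
        by (rule eqI[OF that(3) d_bounds(1)[OF k(1) kn(1)]]) (simp only: that(1) k(4))
      ultimately show ?thesis using trk[of k] k by (intro bexI[of _ "Suc k"]) auto
    qed
  qed
  have wrap: "\<exists>m\<in>{1..n}. {x, y} \<subseteq> tr m" if "rel x = 0" "rel y = N - 1" "x < N" "y < N" for x y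
  proof -
    have p1: "p 1 < N" using d_bounds[of 1] n by simp
    have "rel x = rel i" using that rel_simps(1) by metis
    then have "x = i" by (rule eqI[OF that(3) i])
    have "rel y = P 1" unfolding first_diagonal that(2) by simp
    then have "y = p 1" by (rule eqI[OF that(4) p1])
    show ?thesis unfolding \<open>x = i\<close> \<open>y = p 1\<close>
      using apex_before_first(2) n by (intro bexI[of _ 1]) auto
  qed
  show ?thesis
    using assms main[of x y] main[of y x] wrap[of x y] wrap[of y x] xyN
    unfolding sides_rel[OF xyN] doubleton_eq_iff by (auto simp: insert_commute)
qed

end

section \<open>Realizing the initial triangulation\<close>

text \<open>
  With U and V fixed, the two brackets determine the even coordinates of W by Cramer's rule once the odd
  coordinate y is known. After inserting the brackets, the odd invariant is linear in y, and its
  coefficient g is the bracket of U and V without the odd term, which is invertible.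
\<close>

lemma super_vector_exists:
  fixes U V :: "'k::sqrt_field svec"
  assumes UV: "svec U" "svec V" "body (bracket U V) \<noteq> 0" and AB: "even_elem A" "even_elem B" and \<kappa>: "odd_elem \<kappa>"
  shows "\<exists>W. svec W \<and> bracket U W = A \<and> bracket V W = B \<and> odd_invariant U V W = \<kappa>"
proof -
  obtain a b x where U: "U = (a, b, x)" by (cases U)
  obtain a' b' x' where V: "V = (a', b', x')" by (cases V)
  have ev: "even_elem a" "even_elem b" "even_elem a'" "even_elem b'" and od: "odd_elem x" "odd_elem x'"
    using UV(1,2) by (auto simp: U V)
  define g where "g = a * b' - b * a'"
  have g: "even_elem g" "body g \<noteq> 0"
    using ev od UV(3) by (auto simp: g_def U V parity body_simps)
  define r where "r = inverse g"
  have r: "even_elem r" "g * r = 1" "r * g = 1" using even_inverse[OF g] by (auto simp: r_def)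
  define y where "y = (\<kappa> - x * B + x' * A) * r"
  have y: "odd_elem y" using od \<kappa> AB r by (simp add: y_def parity)
  define A' B' where AB': "A' = A + x * y" "B' = B + x' * y"
  have eAB': "even_elem A'" "even_elem B'" using AB od y by (simp_all add: AB' parity)
  define W where "W = ((A' * a' - a * B') * r, (b' * A' - b * B') * r, y)"
  have "svec W" using ev eAB' r y by (simp add: W_def parity)
  note comm = commute_if_even ev eAB' r(1)
  have solve: "a * ((b' * A' - b * B') * r) - b * ((A' * a' - a * B') * r) = A' * (g * r)"
    "a' * ((b' * A' - b * B') * r) - b' * ((A' * a' - a * B') * r) = B' * (g * r)"
    unfolding g_def by (simp_all only: algebra_simps comm HOL.simp_thms)
  have bU: "bracket U W = A" using solve(1) r(2) by (simp add: U W_def AB'(1))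
  have bV: "bracket V W = B" using solve(2) r(2) by (simp add: V W_def AB'(2))
  have "odd_invariant U V W = x * B - x' * A + (y * bracket U V + x * x' * y)"
    unfolding odd_invariant_def bV bracket_antisym[OF UV(1) \<open>svec W\<close>] bU by (simp add: U V W_def)
  also have "x * x' * y = y * (x * x')" by (rule even_commute) (simp add: od parity)
  also have "y * bracket U V + y * (x * x') = y * g"
    by (simp add: U V g_def algebra_simps)
  also have "y * g = \<kappa> - x * B + x' * A" using r(3) by (simp add: y_def mult.assoc)
  finally show ?thesis using \<open>svec W\<close> bU bV by (intro exI[of _ W]) simp
qed

lemma sides_not_crossed:
  assumes "e \<in> sides N" "f \<subseteq> {..<N}"
  shows "\<not> crosses e f"
proof
  assume "crosses e f"
  then obtain a b c d where ab: "e = {a, b}" "f = {c, d}" "ccw a c b" "ccw b d a"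
    unfolding crosses_def by blast
  have cd: "c < N" "d < N" using assms(2) ab(2) by auto
  have ne: "a \<noteq> b" using ab(3) by (auto simp: ccw_def)
  consider "b = Suc a" | "a = Suc b" | "a = 0" "b = N - 1" | "a = N - 1" "b = 0"
    using assms(1) unfolding ab(1) sides_def by (auto simp: doubleton_eq_iff)
  then show False
    by cases (use ab(3,4) cd in \<open>auto simp: ccw_def\<close>)
qed

text \<open>
  A triangle has three counterclockwise descriptions, which differ by rotation.
\<close>

lemma same_triangle:
  assumes "ccw x y z" "ccw a b c" "{x, y, z} = {a, b, c}"
  shows "x = a \<and> y = b \<and> z = c \<or> x = b \<and> y = c \<and> z = a \<or> x = c \<and> y = a \<and> z = b"
proof -
  have "x \<in> {a, b, c}" "y \<in> {a, b, c}" "z \<in> {a, b, c}" using assms(3) by blast+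
  moreover have "x \<noteq> y" "y \<noteq> z" "x \<noteq> z" using ccw_distinct[OF assms(1)] by auto
  moreover have "\<not> ccw a c b" "\<not> ccw c b a" "\<not> ccw b a c"
    using assms(2) ccw_asym ccw_cyclic by blast+
  ultimately show ?thesis using assms(1) by auto
qed

context crossing_strip
begin

lemma planar_E: "planar E"
proof -
  have vert: "e \<subseteq> {..<N}" "\<exists>u v. u \<noteq> v \<and> e = {u, v}" if "e \<in> E" for e
  proof -
    have "e \<in> diagonals N \<or> e \<in> sides N" using that tri unfolding triangulation_def by blast
    then have "\<exists>a b. a \<noteq> b \<and> a < N \<and> b < N \<and> e = {a, b}"
    proof
      assume "e \<in> sides N"
      then consider a where "Suc a < N" "e = {a, Suc a}" | "e = {0, N - 1}" by (auto simp: sides_def)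
      then show ?thesis
      proof cases
        case (1 a)
        then show ?thesis by (intro exI[of _ a] exI[of _ "Suc a"]) simp
      next
        case 2
        then show ?thesis by (intro exI[of _ 0] exI[of _ "N - 1"]) simp
      qed
    qed (auto simp: diagonals_def)
    then obtain a b where "a \<noteq> b" "a < N" "b < N" "e = {a, b}" by blast
    then show "e \<subseteq> {..<N}" "\<exists>u v. u \<noteq> v \<and> e = {u, v}" by auto
  qed
  show ?thesis
    unfolding planar_def
  proof (intro conjI ballI)
    fix e f assume e: "e \<in> E"
    show "\<exists>u v. u \<noteq> v \<and> e = {u, v}" using vert e by blast
    assume f: "f \<in> E"
    show "\<not> crosses e f"
    proof (cases "e \<in> T \<and> f \<in> T")
      case True
      then show ?thesis using tri unfolding triangulation_def by blast
    next
      case False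
      then show ?thesis using sides_not_crossed[of e N f] sides_not_crossed[of f N e] vert e f crosses_sym by blast
    qed
  qed
qed

lemma apex_of_diagonal:
  assumes m: "1 \<le> m" "m < n"
  shows "ccw (p m) (q m) z \<Longrightarrow> {q m, z} \<in> E \<Longrightarrow> {z, p m} \<in> E \<Longrightarrow> z = v m"
    and "ccw (q m) (p m) z \<Longrightarrow> {p m, z} \<in> E \<Longrightarrow> {z, q m} \<in> E \<Longrightarrow> z = u m"
proof -
  have d: "{p m, q m} \<in> E" "{q m, p m} \<in> E" using d_in_E[OF m] by (simp_all add: insert_commute)
  have b: "{u m, p m} \<in> E" "{u m, q m} \<in> E" "{p m, u m} \<in> E" "{q m, u m} \<in> E"
    "{v m, p m} \<in> E" "{v m, q m} \<in> E" "{p m, v m} \<in> E" "{q m, v m} \<in> E"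
    using apex_before(4,5)[OF m] apex_after(5,6)[OF m] by (simp_all add: insert_commute)
  have c: "ccw (p m) (q m) (v m)" "ccw (q m) (p m) (u m)" using apex_ccw[OF m] ccw_cyclic by blast+
  show "ccw (p m) (q m) z \<Longrightarrow> {q m, z} \<in> E \<Longrightarrow> {z, p m} \<in> E \<Longrightarrow> z = v m"
    by (rule planar_apex_unique[OF planar_E d(1) _ _ b(8) b(5) _ c(1)])
  show "ccw (q m) (p m) z \<Longrightarrow> {p m, z} \<in> E \<Longrightarrow> {z, q m} \<in> E \<Longrightarrow> z = u m"
    by (rule planar_apex_unique[OF planar_E d(2) _ _ b(3) b(2) _ c(2)])
qed

lemma diagonal_in_triangle:
  assumes "ccw x y z" "{x, y} \<in> T" "{y, z} \<in> E" "{z, x} \<in> E"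
  shows "\<exists>m\<in>{1..n}. {x, y, z} = tr m"
proof -
  obtain m where m: "1 \<le> m" "m < n" "{x, y} = {q m, p m}" using T_D[OF assms(2)] by blast
  from m(3) consider "x = p m" "y = q m" | "x = q m" "y = p m" by (auto simp: doubleton_eq_iff)
  then show ?thesis
  proof cases
    case 1
    then have "z = v m" using apex_of_diagonal(1)[OF m(1,2)] assms by simp
    then show ?thesis using apex_after(1)[OF m(1,2)] 1 m by (intro bexI[of _ "Suc m"]) auto
  next
    case 2
    then have "z = u m" using apex_of_diagonal(2)[OF m(1,2)] assms by simp
    then show ?thesis using apex_before(1)[OF m(1,2)] 2 m by (intro bexI[of _ m]) auto
  qed
qed

lemma triangle_in_strip:
  assumes xyz: "ccw x y z" "{x, y} \<in> E" "{y, z} \<in> E" "{z, x} \<in> E"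
  shows "\<exists>m\<in>{1..n}. {x, y, z} = tr m"
proof -
  have rot: "{y, z, x} = {x, y, z}" "{z, x, y} = {x, y, z}" by auto
  have c: "ccw y z x" "ccw z x y" using xyz(1) ccw_cyclic by blast+
  have "{x, y} \<in> T \<or> {y, z} \<in> T \<or> {z, x} \<in> T"
  proof (rule ccontr)
    assume "\<not> ?thesis"
    then have s: "{x, y} \<in> sides N" "{y, z} \<in> sides N" "{z, x} \<in> sides N" using xyz by auto
    then have b: "x < N" "y < N" "z < N" by (auto simp: sides_def doubleton_eq_iff)
    have "rel b = Suc (rel a) \<or> rel a = Suc (rel b) \<or> rel a = 0 \<and> rel b = N - 1 \<or> rel a = N - 1 \<and> rel b = 0"
      if "{a, b} \<in> sides N" "a < N" "b < N" for a b
      using that(1) unfolding sides_rel[OF that(2,3)] doubleton_eq_iff .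
    from this[OF s(1) b(1,2)] this[OF s(2) b(2,3)] this[OF s(3) b(3,1)]
    show False using n by linarith
  qed
  then show ?thesis
    using diagonal_in_triangle[OF xyz(1) _ xyz(3,4)] diagonal_in_triangle[OF c(1) _ xyz(4,2)]
      diagonal_in_triangle[OF c(2) _ xyz(2,3)] unfolding rot by blast
qed

text \<open>
  The vectors realize the triangle number m, with the sign b m for its mu-invariant.
\<close>

definition realizes_triangle :: "(nat set \<Rightarrow> 'k::sqrt_field grassmann) \<Rightarrow> (nat \<Rightarrow> bool) \<Rightarrow> (nat \<Rightarrow> 'k svec) \<Rightarrow> nat \<Rightarrow> bool"
  where
  "realizes_triangle L b V m \<longleftrightarrow>
     (\<forall>x y. x \<noteq> y \<longrightarrow> {x, y} \<subseteq> tr m \<longrightarrow> bracket (V x) (V y) = sg (x < y) * L {x, y}) \<and>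
     (\<forall>x y z. ccw x y z \<longrightarrow> {x, y, z} = tr m \<longrightarrow>
        odd_invariant (V x) (V y) (V z) = sg (b m) * (gen m * side_norm L x y z))"

lemma realizes_triangleD:
  assumes "realizes_triangle L b V m"
  shows "x \<noteq> y \<Longrightarrow> {x, y} \<subseteq> tr m \<Longrightarrow> bracket (V x) (V y) = sg (x < y) * L {x, y}"
    and "ccw x y z \<Longrightarrow> {x, y, z} = tr m \<Longrightarrow>
      odd_invariant (V x) (V y) (V z) = sg (b m) * (gen m * side_norm L x y z)"
  using assms unfolding realizes_triangle_def by simp_all

lemma realizes_triangle_upd:
  assumes "z \<notin> tr m" "realizes_triangle L b V m"
  shows "realizes_triangle L b (V(z := W)) m"
proof -
  have "(V(z := W)) x = V x" if "x \<in> tr m" for x using that assms(1) by auto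
  then show ?thesis
    using assms(2) unfolding realizes_triangle_def by (metis insert_subset insertI1 insertI2)
qed

lemma realizes_triangleI:
  fixes V :: "nat \<Rightarrow> 'k::sqrt_field svec"
  assumes svec: "\<And>x. svec (V x)" and L: "\<And>e. e \<in> {{x, y}, {y, z}, {z, x}} \<Longrightarrow> positive_even (L e)"
    and t: "tr m = {x, y, z}" "ccw x y z"
    and br: "bracket (V x) (V y) = sg (x < y) * L {x, y}" "bracket (V x) (V z) = sg (x < z) * L {x, z}"
      "bracket (V y) (V z) = sg (y < z) * L {y, z}"
    and odd: "odd_invariant (V x) (V y) (V z) = sg (b m) * (gen m * side_norm L x y z)"
  shows "realizes_triangle L b V m"
proof -
  have dist: "x \<noteq> y" "y \<noteq> z" "x \<noteq> z" using ccw_distinct[OF t(2)] by auto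
  have swap: "bracket (V b) (V a) = sg (b < a) * L {b, a}" if "bracket (V a) (V b) = sg (a < b) * L {a, b}" "a \<noteq> b" for a b
  proof -
    have "(b < a) = (\<not> a < b)" using that(2) by auto
    then show ?thesis using bracket_antisym[OF svec svec, of a b] that(1) by (simp add: sg_flip insert_commute)
  qed
  have "bracket (V a) (V b) = sg (a < b) * L {a, b}" if "a \<noteq> b" "{a, b} \<subseteq> {x, y, z}" for a b
    using that br br[THEN swap] dist by auto
  moreover have "odd_invariant (V x') (V y') (V z') = sg (b m) * (gen m * side_norm L x' y' z')"
    if c: "ccw x' y' z'" "{x', y', z'} = {x, y, z}" for x' y' z'
  proof -
    have "side_norm L y z x = side_norm L x y z" "side_norm L z x y = side_norm L y z x"
      using L by (intro side_norm_cyclic; simp)+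
    moreover have "odd_invariant (V y) (V z) (V x) = odd_invariant (V x) (V y) (V z)"
      "odd_invariant (V z) (V x) (V y) = odd_invariant (V y) (V z) (V x)"
      by (intro odd_invariant_cyclic svec)+
    ultimately show ?thesis using same_triangle[OF c(1) t(2) c(2)] odd by auto
  qed
  ultimately show ?thesis unfolding realizes_triangle_def t(1) by blast
qed

text \<open>
  The vectors are attached triangle by triangle along the strip: the first two are chosen freely up to
  their bracket, and each triangle adds one vertex, whose vector is determined by two brackets and
  the odd invariant. The signs b are propagated along the strip so that the spin condition holds at each diagonal;
  as the triangles form a chain, there is no obstruction.
\<close>

lemma realization_exists:
  fixes len :: "nat set \<Rightarrow> 'k::sqrt_field" and \<mu> :: "nat set \<Rightarrow> 'k grassmann"
  assumes len: "\<forall>e\<in>E. 0 < len e" and \<mu>: "\<forall>m\<in>{1..n}. \<mu> (tr m) = gen m"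
    and h: "\<And>m. 1 \<le> m \<Longrightarrow> m < n \<Longrightarrow> h (d m) \<in> d m"
  shows "\<exists>V. realized_by N V \<lparr>diags = T, head = h, lam = (\<lambda>e. scal (len e)), mu = \<mu>\<rparr>"
proof -
  define L where "L e = (scal (len e) :: 'k grassmann)" for e
  have L_pos: "positive_even (L e)" if "e \<in> E" for e
    using len that by (simp add: L_def positive_even_closed)
  define cond where
    "cond m = (if h (d m) = q m then (p m < u m) = (p m < v m) else (q m < v m) = (q m < u m))" for m
  define b where "b = rec_nat True (\<lambda>m x. x = cond m)"
  have b: "(b (Suc m) = b m) = cond m" for m by (auto simp: b_def)
  have attach: "\<exists>W. svec W \<and> bracket (V x) W = sg (x < z) * L {x, z} \<and> bracket (V y) W = sg (y < z) * L {y, z} \<and>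
      odd_invariant (V x) (V y) W = sg (b m) * (gen m * side_norm L x y z)"
    if V: "\<And>x. svec (V x)" "bracket (V x) (V y) = sg (x < y) * L {x, y}"
      and E: "{x, y} \<in> E" "{x, z} \<in> E" "{y, z} \<in> E" for V x y z m
  proof (rule super_vector_exists[OF V(1) V(1)])
    have pos: "positive_even (L {x, y})" "positive_even (L {x, z})" "positive_even (L {y, z})" "positive_even (L {z, x})"
      using L_pos E by (simp_all add: insert_commute)
    then show "body (bracket (V x) (V y)) \<noteq> 0" unfolding V(2) by (auto simp: positive_even_def body_simps sg_def)
    show "even_elem (sg (x < z) * L {x, z})" "even_elem (sg (y < z) * L {y, z})"
      using pos by (simp_all add: positive_even_def parity even_sg)
    have "positive_even (side_norm L x y z)" unfolding side_norm_def by (intro positive_even_closed gsqrt pos)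
    then show "odd_elem (sg (b m) * (gen m * side_norm L x y z))"
      by (intro parity even_sg positive_evenD)
  qed
  have "\<exists>V. (\<forall>x. svec (V x)) \<and> (\<forall>m\<in>{1..k}. realizes_triangle L b V m)" if "1 \<le> k" "k \<le> n" for k
    using that
  proof (induction k)
    case (Suc k)
    show ?case
    proof (cases "k = 0")
      case True
      have m: "1 \<le> (1::nat)" "1 < n" using n by auto
      have E1: "{i, q 1} \<in> E" "{i, p 1} \<in> E" "{q 1, p 1} \<in> E"
        using apex_before(4,5)[OF m] d_in_E[OF m] unfolding apex_before_first by (simp_all add: insert_commute)
      have c: "ccw i (q 1) (p 1)" using apex_ccw(1)[OF m] unfolding apex_before_first .
      note ne = ccw_distinct[OF c]
      define V0 :: "nat \<Rightarrow> 'k svec" where "V0 = (\<lambda>_. (1, 0, 0))(q 1 := (0, sg (i < q 1) * L {i, q 1}, 0 :: 'k grassmann))"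
      have "even_elem (L e)" for e by (simp add: L_def parity)
      then have V0: "svec (V0 x)" for x
        by (auto simp: V0_def parity even_sg odd_elem_def zero_grassmann.rep_eq)
      have br: "bracket (V0 i) (V0 (q 1)) = sg (i < q 1) * L {i, q 1}" using ne by (simp add: V0_def)
      obtain W where W: "svec W" "bracket (V0 i) W = sg (i < p 1) * L {i, p 1}"
          "bracket (V0 (q 1)) W = sg (q 1 < p 1) * L {q 1, p 1}"
          "odd_invariant (V0 i) (V0 (q 1)) W = sg (b 1) * (gen 1 * side_norm L i (q 1) (p 1))"
        using attach[OF V0 br E1(1,2,3)] by blast
      let ?V = "V0(p 1 := W)"
      have "realizes_triangle L b ?V 1"
      proof (rule realizes_triangleI)
        show "tr 1 = {i, q 1, p 1}" using apex_before_first(2) by auto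
        show "ccw i (q 1) (p 1)" by (rule c)
        show "positive_even (L e)" if "e \<in> {{i, q 1}, {q 1, p 1}, {p 1, i}}" for e
          using that L_pos E1 by (auto simp: insert_commute)
      qed (use W V0 br ne in auto)
      moreover have "svec (?V x)" for x using V0 W(1) by simp
      ultimately show ?thesis using True by (intro exI[of _ ?V]) (auto simp del: fun_upd_apply)
    next
      case False
      then have m: "1 \<le> k" "k < n" using Suc.prems by auto
      then obtain V where V': "\<forall>x. svec (V x)" "\<forall>m\<in>{1..k}. realizes_triangle L b V m"
        using Suc.IH Suc_leD Suc.prems(2) by blast
      then have V: "\<And>x. svec (V x)" "\<And>m. 1 \<le> m \<Longrightarrow> m \<le> k \<Longrightarrow> realizes_triangle L b V m"
        by simp_all
      have E1: "{p k, q k} \<in> E" "{p k, v k} \<in> E" "{q k, v k} \<in> E"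
        using apex_after(5,6)[OF m] d_in_E[OF m] by (simp_all add: insert_commute)
      have c: "ccw (p k) (q k) (v k)" using apex_ccw(2)[OF m] ccw_cyclic by blast
      note ne = ccw_distinct[OF c]
      have br: "bracket (V (p k)) (V (q k)) = sg (p k < q k) * L {p k, q k}"
        by (rule realizes_triangleD(1)[OF V(2)[OF m(1) le_refl]]) (use ne apex_before(1)[OF m] in auto)
      obtain W where W: "svec W" "bracket (V (p k)) W = sg (p k < v k) * L {p k, v k}"
          "bracket (V (q k)) W = sg (q k < v k) * L {q k, v k}"
          "odd_invariant (V (p k)) (V (q k)) W = sg (b (Suc k)) * (gen (Suc k) * side_norm L (p k) (q k) (v k))"
        using attach[OF V(1) br E1] by blast
      let ?V = "V(v k := W)"
      have "realizes_triangle L b ?V (Suc k)"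
      proof (rule realizes_triangleI)
        show "tr (Suc k) = {p k, q k, v k}" using apex_after(1)[OF m] by auto
        show "ccw (p k) (q k) (v k)" by (rule c)
        show "positive_even (L e)" if "e \<in> {{p k, q k}, {q k, v k}, {v k, p k}}" for e
          using that L_pos E1 by (auto simp: insert_commute)
      qed (use W V br ne in auto)
      moreover have "realizes_triangle L b ?V m'" if "1 \<le> m'" "m' \<le> k" for m'
        using V(2)[OF that] apex_after_fresh[OF that m(2)] by (rule realizes_triangle_upd[rotated])
      moreover have "svec (?V x)" for x using V(1) W(1) by simp
      ultimately show ?thesis
        by (intro exI[of _ ?V]) (auto simp: le_Suc_eq simp del: fun_upd_apply)
    qed
  qed simp
  from this[of n] n obtain V where V': "\<forall>x. svec (V x)" "\<forall>m\<in>{1..n}. realizes_triangle L b V m" by auto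
  then have V: "\<And>x. svec (V x)" "\<And>m. 1 \<le> m \<Longrightarrow> m \<le> n \<Longrightarrow> realizes_triangle L b V m"
    by simp_all
  define \<tau> where "\<tau> X = b (THE m. 1 \<le> m \<and> m \<le> n \<and> tr m = X)" for X
  have \<tau>: "\<tau> (tr m) = b m" if "1 \<le> m" "m \<le> n" for m
  proof -
    have "(THE k. 1 \<le> k \<and> k \<le> n \<and> tr k = tr m) = m"
      using that triangle_inj by (intro the_equality) (auto, metis linorder_neqE_nat)
    then show ?thesis by (simp add: \<tau>_def)
  qed
  let ?D = "\<lparr>diags = T, head = h, lam = (\<lambda>e. scal (len e)), mu = \<mu>\<rparr>"
  have edges: "edges N ?D = E" by (simp add: edges_def)
  have lamL: "(\<lambda>e. scal (len e)) = L" by (simp add: L_def fun_eq_iff)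
  have lam: "positive_even (L {x, y}) \<and> L {x, y} = bracket (V x) (V y)" if "x < y" "{x, y} \<in> E" for x y
  proof -
    have "\<exists>m\<in>{1..n}. {x, y} \<subseteq> tr m"
    proof (cases "{x, y} \<in> T")
      case True
      then obtain m where m: "1 \<le> m" "m < n" "{x, y} = {q m, p m}" using T_D by blast
      then show ?thesis using apex_before(1)[OF m(1,2)] by (intro bexI[of _ m]) auto
    next
      case False
      then show ?thesis using that side_in_triangle by blast
    qed
    then obtain m where m: "1 \<le> m" "m \<le> n" "{x, y} \<subseteq> tr m" by auto
    have "bracket (V x) (V y) = sg (x < y) * L {x, y}"
      by (rule realizes_triangleD(1)[OF V(2)[OF m(1,2)] _ m(3)]) (use that(1) in simp)
    then show ?thesis using L_pos that by simp
  qed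
  have odd: "\<mu> {x, y, z} * side_norm L x y z = sg (\<tau> {x, y, z}) * odd_invariant (V x) (V y) (V z)"
    if xyz: "ccw x y z" "{x, y} \<in> E" "{y, z} \<in> E" "{z, x} \<in> E" for x y z
  proof -
    obtain m where m: "1 \<le> m" "m \<le> n" "{x, y, z} = tr m" using triangle_in_strip[OF xyz] by auto
    note realizes_triangleD(2)[OF V(2)[OF m(1,2)] xyz(1) m(3)]
    then show ?thesis using \<mu> m \<tau>[OF m(1,2)] by simp
  qed
  have "spin_signs N ?D \<tau>"
    unfolding spin_signs_def edges
  proof (intro allI impI)
    fix l r s t
    assume lr: "{l, r} \<in> diags ?D" "head ?D {l, r} = r" and c: "ccw l s r" "ccw r t l"
      and Q: "{{l, t}, {t, r}, {r, s}, {s, l}} \<subseteq> E"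
    have Q': "{l, t} \<in> E" "{t, l} \<in> E" "{t, r} \<in> E" "{r, t} \<in> E" "{r, s} \<in> E" "{s, r} \<in> E" "{s, l} \<in> E" "{l, s} \<in> E"
      using Q by (simp_all add: insert_commute)
    have c': "ccw l r t" "ccw r l s" using c ccw_cyclic by blast+
    obtain m where m: "1 \<le> m" "m < n" "{l, r} = {q m, p m}" using T_D lr(1) by fastforce
    have hr: "h (d m) = r" using lr(2) m(3) by (simp add: diag_def insert_commute)
    have pq: "p m \<noteq> q m" using pq_distinct[OF m(1,2)] by simp
    have bs: "\<tau> (tr m) = b m" "\<tau> (tr (Suc m)) = b (Suc m)" using \<tau> m by auto
    from m(3) consider "l = p m" "r = q m" | "l = q m" "r = p m" by (auto simp: doubleton_eq_iff)
    then show "(\<tau> {l, r, t} = \<tau> {l, r, s}) = ((l < s) = (l < t))"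
    proof cases
      case 1
      then have "t = v m" "s = u m"
        using apex_of_diagonal[OF m(1,2)] c' Q' by blast+
      moreover have "{p m, q m, v m} = tr (Suc m)" "{p m, q m, u m} = tr m"
        using apex_after(1)[OF m(1,2)] apex_before(1)[OF m(1,2)] by auto
      ultimately show ?thesis using b[of m] hr 1 bs by (simp add: cond_def)
    next
      case 2
      then have "t = u m" "s = v m"
        using apex_of_diagonal[OF m(1,2)] c' Q' by blast+
      moreover have "{q m, p m, v m} = tr (Suc m)" "{q m, p m, u m} = tr m"
        using apex_after(1)[OF m(1,2)] apex_before(1)[OF m(1,2)] by auto
      ultimately show ?thesis using b[of m] hr 2 bs pq by (simp add: cond_def) blast
    qed
  qed
  moreover have "T \<inter> sides N = {}" using tri unfolding triangulation_def diagonals_def by blast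
  moreover have "\<forall>e\<in>T. h e \<in> e" using T_D h by (fastforce simp: diag_def insert_commute)
  ultimately have "realized_by N V ?D"
    unfolding realized_by_def edges unfolding decorated.select_convs unfolding L_def[symmetric]
  proof (intro conjI exI[of _ \<tau>])
    show "\<forall>x y. x < y \<longrightarrow> {x, y} \<in> E \<longrightarrow> positive_even (L {x, y}) \<and> L {x, y} = bracket (V x) (V y)"
      using lam by blast
    show "\<forall>x y z. ccw x y z \<longrightarrow> {x, y} \<in> E \<longrightarrow> {y, z} \<in> E \<longrightarrow> {z, x} \<in> E \<longrightarrow>
        \<mu> {x, y, z} * side_norm L x y z = sg (\<tau> {x, y, z}) * odd_invariant (V x) (V y) (V z)"
      using odd by blast
  qed (use planar_E V(1) lamL in \<open>simp_all add: lamL\<close>)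
  then show ?thesis by blast
qed

end

section \<open>Double lattice paths\<close>

text \<open>
  A path on a snake graph passes every tile either above it or below it, visiting its upper left
  or its lower right corner. Since the level \<open>x + y\<close> of these corners is the number of the tile, the
  m-th vertex of a path is one of two points, and paths are functions to the booleans.
\<close>

locale snake =
  fixes w :: "nat \<Rightarrow> step" and k :: nat
  assumes k: "1 \<le> k"
begin

definition vertex :: "nat \<Rightarrow> bool \<Rightarrow> point" where
  "vertex m b = (if m = 0 then (0, 0)
     else if k < m then (case tile_pos w k of (x, y) \<Rightarrow> (Suc x, Suc y))
     else (case tile_pos w m of (x, y) \<Rightarrow> if b then (x, Suc y) else (Suc x, y)))"

text \<open>
  Between two tiles next to each other, a path above the first one is above the second; between two
  tiles on top of each other, the converse holds. The type is polymorphic because the same relation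
  on numbers of paths describes double paths.
\<close>

definition allowed :: "nat \<Rightarrow> 'a::linorder \<Rightarrow> 'a \<Rightarrow> bool" where
  "allowed m x y \<longleftrightarrow> (1 \<le> m \<longrightarrow> m < k \<longrightarrow> (if w m = Rt then x \<le> y else y \<le> x))"

text \<open>
  One of the tiles and sides to which the m-th edge of a path belongs, used to read off its label.
  The edge depends only on b' for m = 0 and only on b for m = k.
\<close>

definition edge_side :: "nat \<Rightarrow> bool \<Rightarrow> bool \<Rightarrow> nat \<times> side" where
  "edge_side m b b' = (if m = 0 then (1, if b' then Lft else Bot)
     else if m = k then (k, if b then Top else Rgt)
     else if w m = Rt then (if b then (m, Top) else if b' then (m, Rgt) else (Suc m, Bot))
     else (if b' then (Suc m, Lft) else if b then (m, Top) else (m, Rgt)))"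

definition step_edge :: "nat \<Rightarrow> bool \<Rightarrow> bool \<Rightarrow> point \<times> point" where
  "step_edge m b b' = (vertex m b, vertex (Suc m) b')"

lemma tile_pos_1: "tile_pos w 1 = (0, 0)" "tile_pos w (Suc 0) = (0, 0)"
  by (simp_all add: tile_pos_def)

lemma tile_pos_Suc:
  assumes "1 \<le> m"
  shows "tile_pos w (Suc m) = (case tile_pos w m of (x, y) \<Rightarrow> if w m = Rt then (Suc x, y) else (x, Suc y))"
proof -
  have s: "{1..<Suc m} = insert m {1..<m}" using assms by auto
  have R: "{l \<in> {1..<Suc m}. w l = Rt} = (if w m = Rt then insert m {l \<in> {1..<m}. w l = Rt} else {l \<in> {1..<m}. w l = Rt})"
    and U: "{l \<in> {1..<Suc m}. w l = Up} = (if w m = Up then insert m {l \<in> {1..<m}. w l = Up} else {l \<in> {1..<m}. w l = Up})"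
    unfolding s by auto
  show ?thesis unfolding tile_pos_def R U by (cases "w m") auto
qed

lemma tile_pos_level: "1 \<le> m \<Longrightarrow> fst (tile_pos w m) + snd (tile_pos w m) = m - 1"
proof (induction m)
  case (Suc m)
  then show ?case
    by (cases "m = 0") (auto simp: tile_pos_1 tile_pos_Suc split: prod.splits)
qed simp

lemma vertex_level: "m \<le> Suc k \<Longrightarrow> fst (vertex m b) + snd (vertex m b) = m"
  using tile_pos_level[of m] tile_pos_level[of k] k
  by (auto simp: vertex_def split: prod.splits)

lemma vertex_eq_iff:
  assumes "1 \<le> m" "m \<le> k" "m' \<le> Suc k"
  shows "vertex m b = vertex m' b' \<longleftrightarrow> m = m' \<and> b = b'"
proof
  assume eq: "vertex m b = vertex m' b'"
  then have "m = m'" using vertex_level[of m b] vertex_level[of m' b'] assms by simp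
  with eq show "m = m' \<and> b = b'"
    using assms by (auto simp: vertex_def split: prod.splits if_splits)
qed simp

lemma lower_left: "1 \<le> m \<Longrightarrow> m \<le> k \<Longrightarrow> vertex (m - 1) (w (m - 1) \<noteq> Rt) = tile_pos w m"
  by (cases "m = 1") (auto simp: vertex_def tile_pos_1 tile_pos_Suc[of "m - 1", simplified] split: prod.splits)

lemma upper_right:
  assumes "1 \<le> m" "m \<le> k"
  shows "vertex (Suc m) (w m = Rt) = (Suc (fst (tile_pos w m)), Suc (snd (tile_pos w m)))"
  using assms by (cases "m = k") (auto simp: vertex_def tile_pos_Suc split: prod.splits)

text \<open>
  The four sides of a tile as the two possible first and the two possible second steps around it.
\<close>

lemma side_edges:
  assumes "1 \<le> m" "m \<le> k"
  shows "side_edge (tile_pos w m) Lft = step_edge (m - 1) (w (m - 1) \<noteq> Rt) True"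
    "side_edge (tile_pos w m) Bot = step_edge (m - 1) (w (m - 1) \<noteq> Rt) False"
    "side_edge (tile_pos w m) Top = step_edge m True (w m = Rt)"
    "side_edge (tile_pos w m) Rgt = step_edge m False (w m = Rt)"
  using assms unfolding step_edge_def upper_right[OF assms] lower_left[OF assms]
  by (auto simp: vertex_def split: prod.splits)

lemma vertex_end: "vertex 0 b = vertex 0 b'" "vertex (Suc k) b = vertex (Suc k) b'"
  by (simp_all add: vertex_def)

lemma step_edge_side:
  assumes "m \<le> k" "allowed m b b'"
  shows "step_edge m b b' = side_edge (tile_pos w (fst (edge_side m b b'))) (snd (edge_side m b b'))"
    "fst (edge_side m b b') \<in> {1..k}"
proof -
  have "step_edge m b b' = side_edge (tile_pos w (fst (edge_side m b b'))) (snd (edge_side m b b')) \<and>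
    fst (edge_side m b b') \<in> {1..k}"
  proof (cases "m = 0")
    case True
    have "step_edge 0 b b' = step_edge 0 (w 0 \<noteq> Rt) b'" by (simp add: step_edge_def vertex_def)
    then show ?thesis using True k side_edges(1,2)[of 1] by (cases b') (simp_all add: edge_side_def)
  next
    case False
    note m0 = this
    show ?thesis
    proof (cases "m = k")
      case True
      have "step_edge k b b' = step_edge k b (w k = Rt)" by (simp add: step_edge_def vertex_def)
      then show ?thesis using True k side_edges(3,4)[of k] by (cases b) (simp_all add: edge_side_def)
    next
      case False
      then have m: "1 \<le> m" "m \<le> k" "1 \<le> Suc m" "Suc m \<le> k" using m0 assms(1) by auto
      show ?thesis
        using assms(2) m False side_edges[OF m(1,2)] side_edges(1,2)[OF m(3,4)]
        by (cases "w m"; cases b; cases b') (simp_all add: edge_side_def allowed_def)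
    qed
  qed
  then show "step_edge m b b' = side_edge (tile_pos w (fst (edge_side m b b'))) (snd (edge_side m b b'))"
    "fst (edge_side m b b') \<in> {1..k}" by auto
qed

lemma snake_edges_iff:
  "e \<in> snake_edges w k \<longleftrightarrow> (\<exists>m\<le>k. \<exists>b b'. allowed m b b' \<and> e = step_edge m b b')"
proof
  assume "e \<in> snake_edges w k"
  then obtain m s where m: "1 \<le> m" "m \<le> k" "e = side_edge (tile_pos w m) s"
    unfolding snake_edges_def by auto
  have "m - 1 \<le> k" using m by simp
  moreover have "allowed (m - 1) (w (m - 1) \<noteq> Rt) b'" "allowed m b (w m = Rt)" for b b'
    by (simp_all add: allowed_def)
  ultimately show "\<exists>m\<le>k. \<exists>b b'. allowed m b b' \<and> e = step_edge m b b'"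
    using side_edges[OF m(1,2)] m(2,3) by (cases s) metis+
next
  assume "\<exists>m\<le>k. \<exists>b b'. allowed m b b' \<and> e = step_edge m b b'"
  then obtain m b b' where m: "m \<le> k" "allowed m b b'" "e = step_edge m b b'" by blast
  show "e \<in> snake_edges w k"
    using step_edge_side[OF m(1,2)] unfolding m(3) snake_edges_def by blast
qed

definition path :: "(nat \<Rightarrow> bool) \<Rightarrow> point list" where
  "path S = map (\<lambda>m. vertex m (S m)) [0..<Suc (Suc k)]"

definition path_mset :: "(nat \<Rightarrow> bool) \<Rightarrow> (point \<times> point) multiset" where
  "path_mset S = image_mset (\<lambda>m. step_edge m (S m) (S (Suc m))) (mset_set {..k})"

definition admissible :: "(nat \<Rightarrow> 'a::linorder) \<Rightarrow> bool" where
  "admissible f \<longleftrightarrow> (\<forall>m. allowed m (f m) (f (Suc m)))"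

lemma path_edges_path: "path_edges (path S) = path_mset S"
proof -
  let ?g = "\<lambda>m. vertex m (S m)"
  have "zip (path S) (tl (path S)) = map (\<lambda>m. step_edge m (S m) (S (Suc m))) [0..<Suc k]"
    by (rule nth_equalityI) (simp_all add: path_def step_edge_def nth_tl del: upt_Suc)
  then show ?thesis
    unfolding path_edges_def path_mset_def by (simp add: atLeast0LessThan lessThan_Suc_atMost del: upt_Suc)
qed

lemma lattice_path_path:
  assumes "admissible S"
  shows "lattice_path w k (path S)"
proof -
  have "vertex (Suc k) (S (Suc k)) = snd (side_edge (tile_pos w k) Top)"
    by (simp add: vertex_def split: prod.splits)
  moreover have "hd (path S) = vertex 0 (S 0)" "last (path S) = vertex (Suc k) (S (Suc k))" "path S \<noteq> []"
    by (simp_all add: path_def hd_map last_map del: upt_Suc)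
  moreover have "set_mset (path_edges (path S)) \<subseteq> snake_edges w k"
  proof
    fix e assume "e \<in># path_edges (path S)"
    then obtain m where "m \<le> k" "e = step_edge m (S m) (S (Suc m))"
      unfolding path_edges_path path_mset_def by auto
    then show "e \<in> snake_edges w k"
      using assms unfolding snake_edges_iff admissible_def by blast
  qed
  ultimately show ?thesis unfolding lattice_path_def by (simp add: vertex_def)
qed

text \<open>
  The level increases by one in each step, so the m-th vertex of the path has level m.
\<close>

lemma lattice_path_imp_path:
  assumes "lattice_path w k vs"
  obtains S where "admissible S" "vs = path S"
proof -
  have vs: "vs \<noteq> []" "hd vs = (0, 0)" "last vs = vertex (Suc k) True"
    and es: "\<And>t. Suc t < length vs \<Longrightarrow> (vs ! t, vs ! Suc t) \<in> snake_edges w k"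
  proof -
    have s: "set (zip vs (tl vs)) \<subseteq> snake_edges w k" using assms by (simp add: lattice_path_def path_edges_def)
    show "(vs ! t, vs ! Suc t) \<in> snake_edges w k" if "Suc t < length vs" for t
    proof -
      have "zip vs (tl vs) ! t = (vs ! t, vs ! Suc t)" using that by (simp add: nth_tl)
      moreover have "t < length (zip vs (tl vs))" using that by simp
      ultimately have "(vs ! t, vs ! Suc t) \<in> set (zip vs (tl vs))" by (metis nth_mem)
      then show ?thesis using s by blast
    qed
  qed (use assms in \<open>auto simp: lattice_path_def vertex_def split: prod.splits\<close>)
  have lev: "t \<le> Suc k \<and> (\<exists>b. vs ! t = vertex t b)" if "t < length vs" for t
    using that
  proof (induction t)
    case 0
    then show ?case using vs by (simp add: hd_conv_nth vertex_def)
  next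
    case (Suc t)
    then obtain b where b: "t \<le> Suc k" "vs ! t = vertex t b" by auto
    obtain m c c' where m: "m \<le> k" "(vs ! t, vs ! Suc t) = step_edge m c c'"
      using es[OF Suc.prems] unfolding snake_edges_iff by blast
    then have "vertex t b = vertex m c" "vs ! Suc t = vertex (Suc m) c'" using b by (simp_all add: step_edge_def)
    then show ?case using vertex_level[of t b] vertex_level[of m c] b m by auto
  qed
  have len: "length vs = Suc (Suc k)"
  proof -
    have l: "length vs - 1 < length vs" using vs(1) by simp
    then obtain b where "length vs - 1 \<le> Suc k" "last vs = vertex (length vs - 1) b"
      using lev[OF l] vs(1) by (auto simp: last_conv_nth)
    then have "length vs - 1 = Suc k"
      using vertex_level[of "length vs - 1" b] vertex_level[of "Suc k" True] vs(3) by simp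
    then show ?thesis using l by simp
  qed
  define S where "S t = (if t = 0 \<or> k < t then True else vs ! t = vertex t True)" for t
  have nth: "vs ! t = vertex t (S t)" if t: "t \<le> Suc k" for t
  proof -
    have "t < length vs" using t len by simp
    then obtain b where b: "vs ! t = vertex t b" using lev by blast
    show ?thesis
    proof (cases "1 \<le> t \<and> t \<le> k")
      case True
      then show ?thesis using b vertex_eq_iff[of t t b True] by (cases b) (auto simp: S_def)
    next
      case False
      then show ?thesis using b t by (auto simp: vertex_def)
    qed
  qed
  have "allowed t (S t) (S (Suc t))" for t
  proof (cases "1 \<le> t \<and> t < k")
    case True
    then obtain m c c' where m: "m \<le> k" "allowed m c c'" "(vs ! t, vs ! Suc t) = step_edge m c c'"
      using es[of t] len unfolding snake_edges_iff by auto
    then have "vertex t (S t) = vertex m c" "vertex (Suc t) (S (Suc t)) = vertex (Suc m) c'"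
      using nth[of t] nth[of "Suc t"] True by (simp_all add: step_edge_def)
    then show ?thesis using vertex_eq_iff[of t m "S t" c] vertex_eq_iff[of "Suc t" "Suc m" "S (Suc t)" c'] True m by auto
  qed (auto simp: allowed_def)
  then have "admissible S" by (simp add: admissible_def)
  moreover have "vs = path S"
    by (rule nth_equalityI) (use len nth in \<open>auto simp: path_def simp del: upt_Suc\<close>)
  ultimately show ?thesis using that by blast
qed

lemma path_mono:
  assumes S: "admissible S" and t: "t \<le> t'" "t' \<le> Suc k"
  shows "fst (vertex t (S t)) \<le> fst (vertex t' (S t')) \<and> snd (vertex t (S t)) \<le> snd (vertex t' (S t'))"
  using t
proof (induction t' rule: dec_induct)
  case (step t')
  have a: "t' \<le> k" "allowed t' (S t') (S (Suc t'))" using step S by (auto simp: admissible_def)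
  obtain x y s where e: "step_edge t' (S t') (S (Suc t')) = side_edge (x, y) s"
    using step_edge_side(1)[OF a] by (metis surj_pair)
  have "fst (vertex t' (S t')) \<le> fst (vertex (Suc t') (S (Suc t'))) \<and>
      snd (vertex t' (S t')) \<le> snd (vertex (Suc t') (S (Suc t')))"
    using e unfolding step_edge_def by (cases s) auto
  then show ?case using step by auto
qed simp

lemma path_position:
  assumes S: "admissible S" and m: "1 \<le> m" "m \<le> k"
  shows "tile_below w m (path S) \<longleftrightarrow> S m" "tile_above w m (path S) \<longleftrightarrow> \<not> S m"
proof -
  obtain x y where xy: "tile_pos w m = (x, y)" by (cases "tile_pos w m")
  have vm: "vertex m b = (if b then (x, Suc y) else (Suc x, y))" for b using m xy by (simp add: vertex_def)
  have mem: "z \<in> set (path S) \<longleftrightarrow> (\<exists>t\<le>Suc k. z = vertex t (S t))" for z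
    by (auto simp: path_def less_Suc_eq_le simp del: upt_Suc)
  have cmp: "fst (vertex t (S t)) \<le> fst (vertex m (S m)) \<and> snd (vertex t (S t)) \<le> snd (vertex m (S m)) \<or>
      fst (vertex m (S m)) \<le> fst (vertex t (S t)) \<and> snd (vertex m (S m)) \<le> snd (vertex t (S t))" if "t \<le> Suc k" for t
    using path_mono[OF S, of t m] path_mono[OF S, of m t] that m by (cases "t \<le> m") auto
  have mm: "vertex m (S m) \<in> set (path S)" unfolding mem using m by (intro exI[of _ m]) simp
  show "tile_below w m (path S) \<longleftrightarrow> S m"
  proof
    assume "tile_below w m (path S)"
    then obtain z where z: "z \<in> set (path S)" "fst z \<le> x" "Suc y \<le> snd z"
      unfolding tile_below_def xy by auto
    from z(1) obtain t where "t \<le> Suc k" "z = vertex t (S t)" unfolding mem by blast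
    then show "S m" using cmp[of t] vm z(2,3) by (cases "S m") auto
  next
    assume "S m"
    then show "tile_below w m (path S)" using mm vm unfolding tile_below_def xy by fastforce
  qed
  show "tile_above w m (path S) \<longleftrightarrow> \<not> S m"
  proof
    assume "tile_above w m (path S)"
    then obtain z where z: "z \<in> set (path S)" "Suc x \<le> fst z" "snd z \<le> y"
      unfolding tile_above_def xy by auto
    from z(1) obtain t where "t \<le> Suc k" "z = vertex t (S t)" unfolding mem by blast
    then show "\<not> S m" using cmp[of t] vm z(2,3) by (cases "S m") auto
  next
    assume "\<not> S m"
    then show "tile_above w m (path S)" using mm vm unfolding tile_above_def xy by fastforce
  qed
qed

section \<open>Double paths as monotone functions\<close>

text \<open>
  Double paths beyond the tile m: f t is the number of the two paths above the tile t, starting with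
  f m = x. The values off the range of tiles are fixed to make the function unique.
\<close>

definition fillings :: "nat \<Rightarrow> nat \<Rightarrow> (nat \<Rightarrow> nat) set" where
  "fillings m x = {f. (\<forall>t\<ge>m. allowed t (f t) (f (Suc t))) \<and> f m = x \<and> (\<forall>t. f t \<le> 2) \<and>
     (\<forall>t. t < m \<or> k < t \<longrightarrow> f t = 0)}"

definition double_mset :: "(nat \<Rightarrow> nat) \<Rightarrow> (point \<times> point) multiset" where
  "double_mset f = path_mset (\<lambda>m. 1 \<le> f m) + path_mset (\<lambda>m. 2 \<le> f m)"

text \<open>
  How often the upper left corner of a tile is visited; this recovers the function from the multiset.
\<close>

definition upper_count :: "nat \<Rightarrow> (point \<times> point) multiset \<Rightarrow> nat" where
  "upper_count m M = size {#e \<in># M. snd e = vertex m True#}"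

lemma upper_count_path:
  assumes "1 \<le> m" "m \<le> k"
  shows "upper_count m (path_mset S) = (if S m then 1 else 0)"
proof -
  have eq: "vertex (Suc t) b = vertex m True \<longleftrightarrow> t = m - 1 \<and> b" if "t \<le> k" for t b
    using vertex_eq_iff[OF assms, of "Suc t" True b] that assms by auto
  have "upper_count m (path_mset S) = size {#t \<in># mset_set {..k}. vertex (Suc t) (S (Suc t)) = vertex m True#}"
    by (simp add: upper_count_def path_mset_def filter_mset_image_mset step_edge_def)
  also have "{#t \<in># mset_set {..k}. vertex (Suc t) (S (Suc t)) = vertex m True#} = mset_set {t \<in> {..k}. t = m - 1 \<and> S (Suc t)}"
    using eq by (simp add: filter_mset_mset_set) (metis (mono_tags, lifting) atMost_iff)
  also have "{t \<in> {..k}. t = m - 1 \<and> S (Suc t)} = (if S m then {m - 1} else {})"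
    using assms by auto
  finally show ?thesis by simp
qed

lemma upper_count_add: "upper_count m (A + B) = upper_count m A + upper_count m B"
  by (simp add: upper_count_def)

lemma upper_count_double:
  assumes "1 \<le> m" "m \<le> k" "f m \<le> 2"
  shows "upper_count m (double_mset f) = f m"
  using assms(3) unfolding double_mset_def upper_count_add upper_count_path[OF assms(1,2)] by auto

lemma fillingsD:
  assumes "f \<in> fillings 0 0"
  shows "admissible f" "f t \<le> 2" "\<not> (1 \<le> t \<and> t \<le> k) \<Longrightarrow> f t = 0"
  using assms unfolding fillings_def admissible_def by (cases "t = 0"; auto)+

lemma inj_double_mset: "inj_on double_mset (fillings 0 0)"
proof (rule inj_onI, rule ext)
  fix f g t assume fg: "f \<in> fillings 0 0" "g \<in> fillings 0 0" "double_mset f = double_mset g"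
  show "f t = g t"
  proof (cases "1 \<le> t \<and> t \<le> k")
    case True
    then show ?thesis using upper_count_double[of t f] upper_count_double[of t g] fg fillingsD(2) by metis
  qed (use fg fillingsD(3) in metis)
qed

lemma admissible_threshold: "admissible f \<Longrightarrow> admissible (\<lambda>m. c \<le> f m)"
  unfolding admissible_def allowed_def by (auto simp: le_bool_def intro: order_trans)

text \<open>
  Two paths may be replaced by their upper and lower envelopes: admissible paths cannot cross
  within a single step.
\<close>

lemma path_mset_envelope:
  assumes "admissible A" "admissible B"
  shows "path_mset A + path_mset B = path_mset (\<lambda>m. A m \<or> B m) + path_mset (\<lambda>m. A m \<and> B m)"
proof -
  have "{#step_edge m (A m) (A (Suc m))#} + {#step_edge m (B m) (B (Suc m))#} =
      {#step_edge m (A m \<or> B m) (A (Suc m) \<or> B (Suc m))#} + {#step_edge m (A m \<and> B m) (A (Suc m) \<and> B (Suc m))#}"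
    if "m \<le> k" for m
  proof -
    consider "m = 0" | "m = k" | "1 \<le> m" "m < k" using \<open>m \<le> k\<close> by linarith
    then show ?thesis
    proof cases
      case 1
      have e: "step_edge m b c = step_edge m False c" for b c
        unfolding 1 step_edge_def using vertex_end(1)[of b False] by simp
      show ?thesis
        unfolding e[of "A m"] e[of "B m"] e[of "A m \<or> B m"] e[of "A m \<and> B m"]
        by (cases "A (Suc m)"; cases "B (Suc m)") (simp_all add: add_mset_commute)
    next
      case 2
      have e: "step_edge m b c = step_edge m b False" for b c
        unfolding 2 step_edge_def using vertex_end(2)[of c False] by simp
      show ?thesis
        unfolding e[of _ "A (Suc m)"] e[of _ "B (Suc m)"] e[of _ "A (Suc m) \<or> B (Suc m)"] e[of _ "A (Suc m) \<and> B (Suc m)"]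
        by (cases "A m"; cases "B m") (simp_all add: add_mset_commute)
    next
      case 3
      then have "if w m = Rt then A m \<le> A (Suc m) \<and> B m \<le> B (Suc m) else A (Suc m) \<le> A m \<and> B (Suc m) \<le> B m"
        using assms unfolding admissible_def allowed_def by metis
      then show ?thesis
        by (cases "w m = Rt"; cases "A m"; cases "B m"; cases "A (Suc m)"; cases "B (Suc m)")
          (simp_all add: add_mset_commute)
    qed
  qed
  then have "(\<Sum>m\<in>{..k}. {#step_edge m (A m) (A (Suc m))#} + {#step_edge m (B m) (B (Suc m))#}) =
     (\<Sum>m\<in>{..k}. {#step_edge m (A m \<or> B m) (A (Suc m) \<or> B (Suc m))#} + {#step_edge m (A m \<and> B m) (A (Suc m) \<and> B (Suc m))#})"
    by (intro sum.cong) auto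
  moreover have "path_mset S = (\<Sum>m\<in>{..k}. {#step_edge m (S m) (S (Suc m))#})" for S
  proof -
    have "image_mset g (mset_set {..l}) = (\<Sum>m\<in>{..l}. {#g m#})" for g :: "nat \<Rightarrow> point \<times> point" and l :: nat
      by (induction l) (simp_all add: atMost_Suc)
    then show ?thesis unfolding path_mset_def .
  qed
  ultimately show ?thesis by (simp only: sum.distrib)
qed

lemma path_mset_cong: "(\<And>m. 1 \<le> m \<Longrightarrow> m \<le> k \<Longrightarrow> A m = B m) \<Longrightarrow> path_mset A = path_mset B"
  unfolding path_mset_def
proof (intro image_mset_cong)
  fix m assume AB: "\<And>m. 1 \<le> m \<Longrightarrow> m \<le> k \<Longrightarrow> A m = B m" and "m \<in># mset_set {..k}"
  then have m: "m \<le> k" by simp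
  have "vertex t (A t) = vertex t (B t)" if "t \<le> Suc k" for t
    using AB[of t] vertex_end that by (cases "t = 0"; cases "t = Suc k") auto
  then show "step_edge m (A m) (A (Suc m)) = step_edge m (B m) (B (Suc m))"
    using m by (simp add: step_edge_def)
qed

text \<open>
  A double path has a unique non-crossing decomposition, given by the thresholds 1 and 2 of f.
\<close>

lemma double_paths_eq: "double_paths w k = double_mset ` fillings 0 0"
proof (intro set_eqI iffI)
  fix M assume "M \<in> double_paths w k"
  then obtain A B where AB: "lattice_path w k A" "lattice_path w k B" "M = path_edges A + path_edges B"
    unfolding double_paths_def by blast
  obtain S where S: "admissible S" "A = path S" using AB(1) by (rule lattice_path_imp_path)
  obtain S' where S': "admissible S'" "B = path S'" using AB(2) by (rule lattice_path_imp_path)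
  define f where "f m = (if 1 \<le> m \<and> m \<le> k then of_bool (S m) + of_bool (S' m) else 0 :: nat)" for m
  have "allowed m (f m) (f (Suc m))" for m
    using S(1) S'(1) unfolding admissible_def allowed_def f_def
    by (auto simp: le_bool_def split: if_splits)
  then have "f \<in> fillings 0 0" by (auto simp: fillings_def admissible_def f_def)
  moreover have "path_mset (\<lambda>m. 1 \<le> f m) = path_mset (\<lambda>m. S m \<or> S' m)"
    "path_mset (\<lambda>m. 2 \<le> f m) = path_mset (\<lambda>m. S m \<and> S' m)"
    by (rule path_mset_cong, simp add: f_def)+
  then have "M = double_mset f"
    using AB(3) S S' path_mset_envelope by (simp add: path_edges_path double_mset_def)
  ultimately show "M \<in> double_mset ` fillings 0 0" by blast
next
  fix M assume "M \<in> double_mset ` fillings 0 0"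
  then obtain f where f: "admissible f" "M = double_mset f" using fillingsD(1) by blast
  have "lattice_path w k (path (\<lambda>m. 1 \<le> f m))" "lattice_path w k (path (\<lambda>m. 2 \<le> f m))"
    by (rule lattice_path_path[OF admissible_threshold[OF f(1)]])+
  moreover have "M = path_edges (path (\<lambda>m. 1 \<le> f m)) + path_edges (path (\<lambda>m. 2 \<le> f m))"
    using f(2) by (simp add: double_mset_def path_edges_path)
  ultimately show "M \<in> double_paths w k" unfolding double_paths_def by blast
qed

text \<open>
  Both descriptions count the visits to the upper left corner: a tile lies between the paths
  if and only if precisely one of them visits it.
\<close>

lemma tiles_between_double:
  assumes f: "f \<in> fillings 0 0"
  shows "tiles_between w k (double_mset f) = {m \<in> {1..k}. f m = 1}"
proof (intro set_eqI iffI)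
  fix m assume "m \<in> tiles_between w k (double_mset f)"
  then obtain A B where m: "1 \<le> m" "m \<le> k" and AB: "lattice_path w k A" "lattice_path w k B"
      "double_mset f = path_edges A + path_edges B" "tile_below w m A" "tile_above w m B"
    unfolding tiles_between_def by auto
  obtain S where S: "admissible S" "A = path S" using AB(1) by (rule lattice_path_imp_path)
  obtain S' where S': "admissible S'" "B = path S'" using AB(2) by (rule lattice_path_imp_path)
  have "S m" "\<not> S' m" using AB path_position[OF S(1) m] path_position[OF S'(1) m] S S' by auto
  then have "f m = 1"
    using arg_cong[OF AB(3), of "upper_count m"] upper_count_double[where f = f, OF m fillingsD(2)[OF f]]
    by (simp add: upper_count_add S S' path_edges_path upper_count_path[OF m])
  then show "m \<in> {m \<in> {1..k}. f m = 1}" using m by simp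
next
  fix m assume "m \<in> {m \<in> {1..k}. f m = 1}"
  then have m: "1 \<le> m" "m \<le> k" "f m = 1" by auto
  let ?A = "\<lambda>m. 1 \<le> f m" and ?B = "\<lambda>m. 2 \<le> f m"
  have a: "admissible ?A" "admissible ?B" using admissible_threshold fillingsD(1)[OF f] by auto
  have "weakly_above w k (path ?A) (path ?B)"
    unfolding weakly_above_def using path_position(1)[OF a(1)] path_position(1)[OF a(2)] by auto
  moreover have "double_mset f = path_edges (path ?A) + path_edges (path ?B)"
    by (simp add: double_mset_def path_edges_path)
  moreover have "tile_below w m (path ?A)" "tile_above w m (path ?B)"
    using path_position(1)[OF a(1) m(1,2)] path_position(2)[OF a(2) m(1,2)] m(3) by auto
  moreover have "m \<in> {1..k}" using m by simp
  ultimately show "m \<in> tiles_between w k (double_mset f)"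
    unfolding tiles_between_def using lattice_path_path[OF a(1)] lattice_path_path[OF a(2)] by blast
qed

text \<open>
  The places beyond m where a run of the value 1 begins or has just ended.
\<close>

definition toggles :: "(nat \<Rightarrow> nat) \<Rightarrow> nat \<Rightarrow> nat set" where
  "toggles f m = {t. m < t \<and> t \<le> Suc k \<and> (f (t - 1) = 1) \<noteq> (f t = 1)}"

text \<open>
  A maximal run s, ..., t of the value 1 contributes the indices s and t + 1. Each toggle is the beginning or
  the end of such a run.
\<close>

lemma odd_indices_double:
  assumes f: "f \<in> fillings 0 0"
  shows "odd_indices w k (double_mset f) = toggles f 0"
proof -
  define B where "B = {m \<in> {1..k}. f m = 1}"
  have "f t = 1 \<longleftrightarrow> t \<in> B" for t
    using fillingsD(3)[OF f, of t] by (cases "1 \<le> t \<and> t \<le> k") (auto simp: B_def)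
  then have tog: "x \<in> toggles f 0 \<longleftrightarrow> 0 < x \<and> x \<le> Suc k \<and> (x - 1 \<in> B) \<noteq> (x \<in> B)" for x
    by (simp add: toggles_def)
  have B: "1 \<le> t" "t \<le> k" if "t \<in> B" for t using that by (auto simp: B_def)
  have run: "\<exists>b\<ge>a. {a..b} \<subseteq> B \<and> Suc b \<notin> B" if "a \<in> B" for a
  proof -
    have ex: "\<exists>b. a \<le> b \<and> b \<notin> B" using that B(2)[of a] B(2)[of "Suc k"] by (intro exI[of _ "Suc k"]) auto
    define b where "b = (LEAST b. a \<le> b \<and> b \<notin> B)"
    have b: "a \<le> b" "b \<notin> B" using LeastI_ex[OF ex] by (auto simp: b_def)
    moreover have "a \<noteq> b" using that b by blast
    moreover have "t \<in> B" if "a \<le> t" "t < b" for t using not_less_Least[of t] that unfolding b_def by blast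
    ultimately show ?thesis by (intro exI[of _ "b - 1"]) auto
  qed
  have run': "\<exists>a\<le>b. {a..b} \<subseteq> B \<and> a - 1 \<notin> B" if "b \<in> B" for b
  proof -
    define a where "a = (LEAST a. {a..b} \<subseteq> B)"
    have ex: "\<exists>a. {a..b} \<subseteq> B" using that by (intro exI[of _ b]) auto
    have a: "{a..b} \<subseteq> B" using LeastI_ex[OF ex] by (simp add: a_def)
    have "a \<le> b" unfolding a_def by (rule Least_le) (use that in auto)
    moreover have "a - 1 \<notin> B"
    proof
      assume "a - 1 \<in> B"
      then have "1 \<le> a" using B(1) by (cases a) force+
      have "{a - 1..b} \<subseteq> insert (a - 1) {a..b}" by auto
      then have "{a - 1..b} \<subseteq> B" using a \<open>a - 1 \<in> B\<close> by blast
      then have "a \<le> a - 1" unfolding a_def by (rule Least_le)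
      then show False using \<open>1 \<le> a\<close> by simp
    qed
    ultimately show ?thesis using a by blast
  qed
  show ?thesis
    unfolding odd_indices_def cycles_def tiles_between_double[OF f] B_def[symmetric]
  proof (intro set_eqI iffI)
    fix x assume "x \<in> (\<Union>(s, t)\<in>{(s, t). s \<le> t \<and> {s..t} \<subseteq> B \<and> s - 1 \<notin> B \<and> Suc t \<notin> B}. {s, Suc t})"
    then obtain s t where st: "s \<le> t" "{s..t} \<subseteq> B" "s - 1 \<notin> B" "Suc t \<notin> B" "x = s \<or> x = Suc t" by auto
    then have "s \<in> B" "t \<in> B" by auto
    then show "x \<in> toggles f 0" using st(3-5) B[of s] B[of t] unfolding tog by (elim disjE) simp_all
  next
    fix x assume "x \<in> toggles f 0"
    then have x: "0 < x" "x \<le> Suc k" "(x - 1 \<in> B) \<noteq> (x \<in> B)" unfolding tog by auto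
    show "x \<in> (\<Union>(s, t)\<in>{(s, t). s \<le> t \<and> {s..t} \<subseteq> B \<and> s - 1 \<notin> B \<and> Suc t \<notin> B}. {s, Suc t})"
    proof (cases "x \<in> B")
      case True
      then obtain b where "x \<le> b" "{x..b} \<subseteq> B" "Suc b \<notin> B" using run by blast
      then show ?thesis using True x by (intro UN_I[of "(x, b)"]) auto
    next
      case False
      then have "x - 1 \<in> B" using x by blast
      then obtain a where "a \<le> x - 1" "{a..x - 1} \<subseteq> B" "a - 1 \<notin> B" using run' by blast
      then show ?thesis using False x by (intro UN_I[of "(a, x - 1)"]) auto
    qed
  qed
qed

end

section \<open>Products in the positive order\<close>

text \<open>
  The positive order, as a function of the directions in which the indices are placed.
\<close>

definition priority :: "(nat \<Rightarrow> bool) \<Rightarrow> nat \<Rightarrow> nat \<Rightarrow> bool" where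
  "priority \<epsilon> m s \<longleftrightarrow> m < s \<and> \<epsilon> m \<or> s < m \<and> \<not> \<epsilon> s"

definition ordered_product :: "(nat \<Rightarrow> bool) \<Rightarrow> nat set \<Rightarrow> 'k::comm_ring_1 grassmann" where
  "ordered_product \<epsilon> S = prod_list (map gen (THE ms. set ms = S \<and> sorted_wrt (priority \<epsilon>) ms))"

lemma priority_asym: "priority \<epsilon> m s \<Longrightarrow> \<not> priority \<epsilon> s m"
  by (auto simp: priority_def)

lemma priority_irrefl: "\<not> priority \<epsilon> m m"
  by (simp add: priority_def)

lemma sorted_priority_unique:
  "sorted_wrt (priority \<epsilon>) xs \<Longrightarrow> sorted_wrt (priority \<epsilon>) ys \<Longrightarrow> set xs = set ys \<Longrightarrow> xs = ys"
proof (induction xs arbitrary: ys)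
  case (Cons x xs)
  then obtain y ys' where ys: "ys = y # ys'" by (cases ys) auto
  have "x = y"
  proof (rule ccontr)
    assume "x \<noteq> y"
    then have "x \<in> set ys'" "y \<in> set xs" using Cons.prems(3) ys by auto
    then show False using Cons.prems(1,2) ys priority_asym[of \<epsilon> x y] by auto
  qed
  moreover have "x \<notin> set xs" "y \<notin> set ys'" using Cons.prems(1,2) ys priority_irrefl by auto
  ultimately have "set xs = set ys'" using Cons.prems(3) ys by auto
  then show ?case using Cons ys \<open>x = y\<close> by auto
qed simp

lemma sorted_priority_insert:
  assumes "sorted_wrt (priority \<epsilon>) ms" "\<forall>s\<in>set ms. m < s"
  shows "sorted_wrt (priority \<epsilon>) (if \<epsilon> m then m # ms else ms @ [m])"
  using assms by (auto simp: sorted_wrt_append priority_def)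

lemma sorted_priority_exists: "finite S \<Longrightarrow> \<exists>ms. set ms = S \<and> sorted_wrt (priority \<epsilon>) ms"
proof (induction S rule: finite_linorder_min_induct)
  case (insert m S)
  then obtain ms where "set ms = S" "sorted_wrt (priority \<epsilon>) ms" by blast
  then show ?case using sorted_priority_insert[of \<epsilon> ms m] insert
    by (intro exI[of _ "if \<epsilon> m then m # ms else ms @ [m]"]) auto
qed simp

lemma ordered_product_eqI:
  assumes "set ms = S" "sorted_wrt (priority \<epsilon>) ms"
  shows "ordered_product \<epsilon> S = prod_list (map gen ms)"
proof -
  have "(THE ms. set ms = S \<and> sorted_wrt (priority \<epsilon>) ms) = ms"
    using assms sorted_priority_unique by (intro the_equality) blast+
  then show ?thesis by (simp add: ordered_product_def)
qed

lemma ordered_product_empty [simp]: "ordered_product \<epsilon> {} = 1"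
  using ordered_product_eqI[of "[]" "{}" \<epsilon>] by simp

text \<open>
  A new smallest index is the greatest or the least variable in the positive order.
\<close>

lemma ordered_product_insert_min:
  assumes "finite S" "\<forall>s\<in>S. m < s"
  shows "ordered_product \<epsilon> (insert m S) =
    (if \<epsilon> m then gen m * ordered_product \<epsilon> S else ordered_product \<epsilon> S * gen m)"
proof -
  obtain ms where ms: "set ms = S" "sorted_wrt (priority \<epsilon>) ms" using sorted_priority_exists[OF assms(1)] by blast
  then have "sorted_wrt (priority \<epsilon>) (if \<epsilon> m then m # ms else ms @ [m])"
    using sorted_priority_insert assms(2) by blast
  moreover have "set (if \<epsilon> m then m # ms else ms @ [m]) = insert m S" using ms(1) by auto
  ultimately show ?thesis
    using ordered_product_eqI[OF ms] ordered_product_eqI[of _ "insert m S" \<epsilon>] by (metis (mono_tags, lifting)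
      list.simps(8,9) map_append prod_list.Cons prod_list.Nil prod_list.append mult_1_right)
qed

lemma ordered_product_parity:
  "finite S \<Longrightarrow> if even (card S) then even_elem (ordered_product \<epsilon> S :: 'k::comm_ring_1 grassmann)
     else odd_elem (ordered_product \<epsilon> S :: 'k grassmann)"
proof (induction S rule: finite_linorder_min_induct)
  case (insert m S)
  then have "m \<notin> S" by auto
  then show ?case using insert by (auto simp: ordered_product_insert_min parity split: if_splits)
qed (simp add: parity)

text \<open>
  Moving the new variable to the front costs a sign only past an odd product.
\<close>

lemma ordered_product_insert:
  fixes \<epsilon> :: "nat \<Rightarrow> bool"
  assumes "finite S" "\<forall>s\<in>S. m < s"
  shows "ordered_product \<epsilon> (insert m S) = (if even (card S) \<or> \<epsilon> m then gen m * ordered_product \<epsilon> S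
    else - (gen m * ordered_product \<epsilon> S :: 'k::comm_ring_1 grassmann))"
proof -
  have "ordered_product \<epsilon> S * gen m = (gen m * ordered_product \<epsilon> S :: 'k grassmann)" if "even (card S)"
    using that ordered_product_parity[OF assms(1), of \<epsilon>, where 'k = 'k] by (intro even_commute) simp
  moreover have "ordered_product \<epsilon> S * gen m = - (gen m * ordered_product \<epsilon> S :: 'k grassmann)" if "odd (card S)"
    using that ordered_product_parity[OF assms(1), of \<epsilon>, where 'k = 'k] by (intro odd_anticommute parity) simp
  ultimately show ?thesis unfolding ordered_product_insert_min[OF assms] by auto
qed

section \<open>The weighted sum as a transfer matrix product\<close>

context snake
begin

text \<open>
  Neighbouring tiles agree on the label of their common edge.
\<close>

definition consistent :: "(nat \<Rightarrow> side \<Rightarrow> 'l) \<Rightarrow> bool" where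
  "consistent lab \<longleftrightarrow> (\<forall>m. 1 \<le> m \<longrightarrow> m < k \<longrightarrow>
     (if w m = Rt then lab m Rgt = lab (Suc m) Lft else lab m Top = lab (Suc m) Bot))"

lemma step_edge_eqD:
  assumes "step_edge a b c = step_edge a' b' c'" "a \<le> k" "a' \<le> k"
  shows "a = a'" "1 \<le> a \<Longrightarrow> b = b'" "a < k \<Longrightarrow> c = c'"
proof -
  have v: "vertex a b = vertex a' b'" "vertex (Suc a) c = vertex (Suc a') c'"
    using assms(1) by (simp_all add: step_edge_def)
  then show a: "a = a'" using vertex_level[of a b] vertex_level[of a' b'] assms by simp
  show "1 \<le> a \<Longrightarrow> b = b'" using v(1) vertex_eq_iff[of a a' b b'] assms by simp
  show "a < k \<Longrightarrow> c = c'" using v(2) vertex_eq_iff[of "Suc a" "Suc a'" c c'] assms by simp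
qed

text \<open>
  An edge has the same label for all tiles that contain it: on one tile its level and ends determine
  the side, and if two tiles share it, then it joins consecutive tiles.
\<close>

lemma edge_label_side:
  assumes lab: "consistent lab" and m: "1 \<le> m" "m \<le> k"
  shows "edge_label w k lab (side_edge (tile_pos w m) s) = lab m s"
proof -
  define lower where "lower s = (s = Lft \<or> s = Bot)" for s
  define lev where "lev m s = (if lower s then m - 1 else m)" for m :: nat and s
  define b where "b m s = (if lower s then w (m - 1) \<noteq> Rt else s = Top)" for m s
  define c where "c m s = (if lower s then s = Lft else w m = Rt)" for m s
  have se: "side_edge (tile_pos w m) s = step_edge (lev m s) (b m s) (c m s)" "lev m s \<le> k" if "1 \<le> m" "m \<le> k" for m s
    using side_edges[OF that] that by (cases s; simp add: lev_def lower_def b_def c_def)+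
  have D: "lev m s = lev m' s'" "1 \<le> lev m s \<Longrightarrow> b m s = b m' s'" "lev m s < k \<Longrightarrow> c m s = c m' s'"
    if "1 \<le> m" "m \<le> k" "1 \<le> m'" "m' \<le> k" "side_edge (tile_pos w m) s = side_edge (tile_pos w m') s'" for m m' s s'
  proof -
    have "step_edge (lev m s) (b m s) (c m s) = step_edge (lev m' s') (b m' s') (c m' s')"
      using that(5) unfolding se(1)[OF that(1,2)] se(1)[OF that(3,4)] .
    from step_edge_eqD[OF this se(2)[OF that(1,2)] se(2)[OF that(3,4)]]
    show "lev m s = lev m' s'" "1 \<le> lev m s \<Longrightarrow> b m s = b m' s'" "lev m s < k \<Longrightarrow> c m s = c m' s'" by blast+
  qed
  have shared: "lab m s = lab m' s'"
    if m: "1 \<le> m" "m \<le> k" "1 \<le> m'" "m' \<le> k" and e: "side_edge (tile_pos w m) s = side_edge (tile_pos w m') s'"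
      and l: "lower s" "\<not> lower s'" for m m' s s'
  proof -
    have m': "m = Suc m'" "m' < k" using D(1)[OF m e] l m by (auto simp: lev_def)
    have "(w m' \<noteq> Rt) = (s' = Top)" using D(2)[OF m e] l m m' by (simp add: lev_def b_def)
    moreover have "(s = Lft) = (w m' = Rt)" using D(3)[OF m e] l m m' by (simp add: lev_def c_def)
    ultimately have "s = (if w m' = Rt then Lft else Bot)" "s' = (if w m' = Rt then Rgt else Top)"
      using l by (cases s; cases s'; simp add: lower_def)+
    then show ?thesis using lab m(3) m' unfolding consistent_def by (auto split: if_splits)
  qed
  have eq: "lab m s = lab m' s'"
    if m: "1 \<le> m" "m \<le> k" "1 \<le> m'" "m' \<le> k" and e: "side_edge (tile_pos w m) s = side_edge (tile_pos w m') s'" for m m' s s'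
  proof -
    consider "lower s" "\<not> lower s'" | "lower s'" "\<not> lower s" | "lower s" "lower s'" | "\<not> lower s" "\<not> lower s'" by blast
    then show ?thesis
    proof cases
      case 1
      then show ?thesis using shared[OF m e] by blast
    next
      case 2
      then show ?thesis using shared[OF m(3,4,1,2) e[symmetric]] by simp
    next
      case 3
      then have "m = m'" using D(1)[OF m e] m by (simp add: lev_def)
      moreover have "(s = Lft) = (s' = Lft)" using D(3)[OF m e] 3 m by (simp add: lev_def c_def)
      then have "s = s'" using 3 by (cases s; cases s'; simp add: lower_def)
      ultimately show ?thesis by simp
    next
      case 4
      then have "m = m'" using D(1)[OF m e] by (simp add: lev_def)
      moreover have "(s = Top) = (s' = Top)" using D(2)[OF m e] 4 m by (simp add: lev_def b_def)
      then have "s = s'" using 4 by (cases s; cases s'; simp add: lower_def)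
      ultimately show ?thesis by simp
    qed
  qed
  show ?thesis
    unfolding edge_label_def
  proof (rule the_equality)
    show "\<exists>m'\<in>{1..k}. \<exists>s'. side_edge (tile_pos w m) s = side_edge (tile_pos w m') s' \<and> lab m s = lab m' s'"
      using m by (intro bexI[of _ m] exI[of _ s]) simp_all
  next
    fix l assume "\<exists>m'\<in>{1..k}. \<exists>s'. side_edge (tile_pos w m) s = side_edge (tile_pos w m') s' \<and> l = lab m' s'"
    then obtain m' s' where m': "m' \<in> {1..k}" "side_edge (tile_pos w m) s = side_edge (tile_pos w m') s'" "l = lab m' s'"
      by blast
    from m'(1) have "1 \<le> m'" "m' \<le> k" by simp_all
    from eq[OF m this m'(2)] show "l = lab m s" using m'(3) by simp
  qed
qed

definition step_weight :: "(nat \<Rightarrow> side \<Rightarrow> 'k::sqrt_field) \<Rightarrow> nat \<Rightarrow> nat \<Rightarrow> nat \<Rightarrow> 'k" where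
  "step_weight lab m x y = psqrt (case_prod lab (edge_side m (1 \<le> x) (1 \<le> y))) *
     psqrt (case_prod lab (edge_side m (2 \<le> x) (2 \<le> y)))"

lemma prod_path_mset:
  assumes "consistent lab" "admissible S"
  shows "(\<Prod>e\<in>#path_mset S. psqrt (edge_label w k lab e)) =
    (\<Prod>m\<le>k. psqrt (case_prod lab (edge_side m (S m) (S (Suc m)))))"
proof -
  have "edge_label w k lab (step_edge m (S m) (S (Suc m))) = case_prod lab (edge_side m (S m) (S (Suc m)))" if "m \<le> k" for m
  proof -
    have a: "allowed m (S m) (S (Suc m))" using assms(2) by (simp add: admissible_def)
    show ?thesis
      unfolding step_edge_side(1)[OF that a]
      using edge_label_side[OF assms(1)] step_edge_side(2)[OF that a] by (simp add: case_prod_beta)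
  qed
  then show ?thesis
    unfolding path_mset_def prod_unfold_prod_mset image_mset.compositionality comp_def
    by (intro arg_cong[of _ _ prod_mset] image_mset_cong) simp
qed

lemma weight_double:
  assumes "consistent lab" "f \<in> fillings 0 0"
  shows "weight w k lab (priority \<epsilon>) (double_mset f) =
    scal (\<Prod>m\<le>k. step_weight lab m (f m) (f (Suc m))) * ordered_product \<epsilon> (toggles f 0)"
proof -
  note a = admissible_threshold[OF fillingsD(1)[OF assms(2)]]
  have "(\<Prod>e\<in>#double_mset f. psqrt (edge_label w k lab e)) = (\<Prod>m\<le>k. step_weight lab m (f m) (f (Suc m)))"
    unfolding double_mset_def
    by (simp add: prod_path_mset[OF assms(1) a] step_weight_def prod.distrib)
  then show ?thesis
    unfolding weight_def odd_indices_double[OF assms(2)] ordered_product_def by simp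
qed

lemma finite_fillings: "finite (fillings m x)"
proof (rule finite_subset)
  show "fillings m x \<subseteq> {f. \<forall>t. (t \<in> {..k} \<longrightarrow> f t \<in> {..2}) \<and> (t \<notin> {..k} \<longrightarrow> f t = 0)}"
    by (auto simp: fillings_def)
qed (rule finite_set_of_finite_funs, simp_all)

lemma fillings_last:
  assumes "x \<le> 2" shows "fillings k x = {(\<lambda>_. 0)(k := x)}"
proof (intro set_eqI iffI)
  fix f assume f: "f \<in> fillings k x"
  have "f t = ((\<lambda>_. 0)(k := x)) t" for t
    using f unfolding fillings_def by (cases t k rule: linorder_cases) auto
  then show "f \<in> {(\<lambda>_. 0)(k := x)}" by auto
next
  fix f assume "f \<in> {(\<lambda>_. 0)(k := x)}"
  then show "f \<in> fillings k x" using assms by (auto simp: fillings_def allowed_def)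
qed

text \<open>
  The function is split into its value at m and its continuation from m + 1.
\<close>

lemma sum_fillings:
  assumes "m < k" "x \<le> 2"
  shows "(\<Sum>f\<in>fillings m x. H f) =
    (\<Sum>y | y \<le> 2 \<and> allowed m x y. \<Sum>g\<in>fillings (Suc m) y. H (g(m := x)))"
proof -
  have fin: "finite {y :: nat. y \<le> 2 \<and> allowed m x y}" by (rule finite_subset[of _ "{..2}"]) auto
  have "(\<Sum>f\<in>fillings m x. H f) =
      (\<Sum>(y, g)\<in>(SIGMA y:{y. y \<le> 2 \<and> allowed m x y}. fillings (Suc m) y). H (g(m := x)))"
  proof (rule sum.reindex_bij_witness[of _ "\<lambda>(y, g). g(m := x)" "\<lambda>f. (f (Suc m), f(m := 0))"], goal_cases)
    case (1 f)
    then have "f m = x" by (simp add: fillings_def)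
    then show ?case by auto
  next
    case (2 f)
    then show ?case using assms by (auto simp: fillings_def less_Suc_eq)
  next
    case (3 yg)
    then obtain y g where yg: "yg = (y, g)" "g \<in> fillings (Suc m) y" by auto
    then have "g m = 0" "g (Suc m) = y" by (auto simp: fillings_def)
    then show ?case using yg(1) by auto
  next
    case (4 yg)
    then obtain y g where yg: "yg = (y, g)" "y \<le> 2" "allowed m x y" "g \<in> fillings (Suc m) y" by auto
    have "allowed t ((g(m := x)) t) ((g(m := x)) (Suc t))" if "m \<le> t" for t
      using yg that by (cases "t = m") (auto simp: fillings_def)
    then show ?case using yg assms by (auto simp: fillings_def)
  next
    case (5 f)
    then have "f m = x" by (simp add: fillings_def)
    then show ?case by auto
  qed
  also have "\<dots> = (\<Sum>y | y \<le> 2 \<and> allowed m x y. \<Sum>g\<in>fillings (Suc m) y. H (g(m := x)))"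
    by (subst sum.Sigma) (use fin finite_fillings in auto)
  finally show ?thesis .
qed

lemma toggles_finite: "finite (toggles f m)"
  by (rule finite_subset[of _ "{..Suc k}"]) (auto simp: toggles_def)

lemma toggles_Suc:
  assumes "m \<le> k"
  shows "toggles f m = (if (f m = 1) = (f (Suc m) = 1) then toggles f (Suc m) else insert (Suc m) (toggles f (Suc m)))"
proof (intro set_eqI)
  fix t
  show "t \<in> toggles f m \<longleftrightarrow>
      t \<in> (if (f m = 1) = (f (Suc m) = 1) then toggles f (Suc m) else insert (Suc m) (toggles f (Suc m)))"
  proof (cases "t = Suc m")
    case True
    then show ?thesis using assms by (simp add: toggles_def)
  next
    case False
    then have "m < t \<longleftrightarrow> Suc m < t" by linarith
    then show ?thesis using False by (simp add: toggles_def)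
  qed
qed

text \<open>
  Each toggle changes whether the value is 1, and the final value is 0.
\<close>

lemma toggles_parity:
  assumes "f (Suc k) = 0" "m \<le> Suc k"
  shows "odd (card (toggles f m)) \<longleftrightarrow> f m = 1"
  using assms(2)
proof (induction m rule: inc_induct)
  case base
  have "toggles f (Suc k) = {}" by (auto simp: toggles_def)
  then show ?case using assms(1) by simp
next
  case (step m)
  have "Suc m \<notin> toggles f (Suc m)" by (simp add: toggles_def)
  then show ?case using step toggles_Suc[of m f] toggles_finite[of f "Suc m"] by auto
qed

definition partial_sum :: "(nat \<Rightarrow> side \<Rightarrow> 'k::sqrt_field) \<Rightarrow> (nat \<Rightarrow> bool) \<Rightarrow> nat \<Rightarrow> nat \<Rightarrow> 'k grassmann" where
  "partial_sum lab \<epsilon> m x = (\<Sum>f\<in>fillings m x.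
     scal (\<Prod>t\<in>{m..k}. step_weight lab t (f t) (f (Suc t))) * ordered_product \<epsilon> (toggles f m))"

text \<open>
  The odd variable contributed between the values x and y. The sign is that of \<open>ordered_product_insert\<close>: for
  x = 1 a run ends here and an even number of toggles follows; for y = 1 a run begins and
  an odd number follows.
\<close>

definition odd_factor :: "(nat \<Rightarrow> bool) \<Rightarrow> nat \<Rightarrow> nat \<Rightarrow> nat \<Rightarrow> 'k::comm_ring_1 grassmann" where
  "odd_factor \<epsilon> m x y = (if (x = 1) = (y = 1) then 1 else if x = 1 \<or> \<epsilon> m then gen m else - gen m)"

lemma sum_weight_eq_partial_sum:
  assumes "consistent lab"
  shows "(\<Sum>M\<in>double_paths w k. weight w k lab (priority \<epsilon>) M) = partial_sum lab \<epsilon> 0 0"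
  unfolding double_paths_eq partial_sum_def
  by (subst sum.reindex[OF inj_double_mset])
    (simp add: weight_double[OF assms] atLeast0AtMost cong: sum.cong)

lemma partial_sum_last:
  assumes "x \<le> 2"
  shows "partial_sum lab \<epsilon> k x = scal (step_weight lab k x 0) * (if x = 1 then gen (Suc k) else 1)"
proof -
  let ?f = "(\<lambda>_. 0)(k := x) :: nat \<Rightarrow> nat"
  have "toggles ?f k = (if x = 1 then {Suc k} else {})" by (auto simp: toggles_def)
  then show ?thesis
    unfolding partial_sum_def fillings_last[OF assms]
    using ordered_product_insert[of "{}" "Suc k" \<epsilon>, where 'k = 'a] by simp
qed

text \<open>
  The transfer matrix. A sum from the last tile down to m makes the new index the smallest one, so its variable
  can be factored out on the left.
\<close>

lemma partial_sum_step:
  assumes "m < k" "x \<le> 2"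
  shows "partial_sum lab \<epsilon> m x = (\<Sum>y | y \<le> 2 \<and> allowed m x y.
     scal (step_weight lab m x y) * (odd_factor \<epsilon> (Suc m) x y * partial_sum lab \<epsilon> (Suc m) y))"
  unfolding partial_sum_def sum_fillings[OF assms] sum_distrib_left
proof (intro sum.cong refl)
  fix y g assume y: "y \<in> {y. y \<le> 2 \<and> allowed m x y}" and g: "g \<in> fillings (Suc m) y"
  let ?f = "g(m := x)"
  have gv: "g (Suc m) = y" "g (Suc k) = 0" using g by (auto simp: fillings_def)
  have "{m..k} = insert m {Suc m..k}" using assms(1) by auto
  then have "(\<Prod>t\<in>{m..k}. step_weight lab t (?f t) (?f (Suc t))) =
      step_weight lab m x y * (\<Prod>t\<in>{Suc m..k}. step_weight lab t (?f t) (?f (Suc t)))"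
    using gv by simp
  also have "(\<Prod>t\<in>{Suc m..k}. step_weight lab t (?f t) (?f (Suc t))) = (\<Prod>t\<in>{Suc m..k}. step_weight lab t (g t) (g (Suc t)))"
    by (rule prod.cong) auto
  finally have weight: "(\<Prod>t\<in>{m..k}. step_weight lab t (?f t) (?f (Suc t))) =
      step_weight lab m x y * (\<Prod>t\<in>{Suc m..k}. step_weight lab t (g t) (g (Suc t)))" .
  have "toggles ?f (Suc m) = toggles g (Suc m)" by (auto simp: toggles_def)
  then have tg: "toggles ?f m = (if (x = 1) = (y = 1) then toggles g (Suc m) else insert (Suc m) (toggles g (Suc m)))"
    using toggles_Suc[of m ?f] assms gv by simp
  have odd: "odd (card (toggles g (Suc m))) \<longleftrightarrow> y = 1"
    using toggles_parity[of g, OF gv(2), of "Suc m"] assms gv by simp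
  have "ordered_product \<epsilon> (insert (Suc m) (toggles g (Suc m))) =
      (if y \<noteq> 1 \<or> \<epsilon> (Suc m) then gen (Suc m) * ordered_product \<epsilon> (toggles g (Suc m))
       else - (gen (Suc m) * ordered_product \<epsilon> (toggles g (Suc m)) :: 'a grassmann))"
    using ordered_product_insert[OF toggles_finite, of g "Suc m" "Suc m" \<epsilon>] odd by (auto simp: toggles_def)
  then have op: "ordered_product \<epsilon> (toggles ?f m) = (odd_factor \<epsilon> (Suc m) x y * ordered_product \<epsilon> (toggles g (Suc m)) :: 'a grassmann)"
    unfolding tg odd_factor_def by auto
  let ?s = "scal (\<Prod>t\<in>{Suc m..k}. step_weight lab t (g t) (g (Suc t)))"
  have "?s * odd_factor \<epsilon> (Suc m) x y = odd_factor \<epsilon> (Suc m) x y * ?s" by (rule even_commute) (rule parity)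
  then have "?s * (odd_factor \<epsilon> (Suc m) x y * ordered_product \<epsilon> (toggles g (Suc m))) =
      odd_factor \<epsilon> (Suc m) x y * (?s * ordered_product \<epsilon> (toggles g (Suc m)))"
    by (simp only: mult.assoc[symmetric])
  then show "scal (\<Prod>t\<in>{m..k}. step_weight lab t (?f t) (?f (Suc t))) * ordered_product \<epsilon> (toggles ?f m) =
      scal (step_weight lab m x y) * (odd_factor \<epsilon> (Suc m) x y * (?s * ordered_product \<epsilon> (toggles g (Suc m))))"
    unfolding weight op scal_mult by (simp only: mult.assoc)
qed

end

section \<open>Flipping the diagonals from j to i\<close>

lemma flip_exists:
  fixes D :: "'k::sqrt_field decorated"
  assumes "{l, r} \<in> diags D" "head D {l, r} = r" "ccw l s r" "ccw r t l"
    "{{l, t}, {t, r}, {r, s}, {s, l}} \<subseteq> diags D \<union> sides N"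
    and "a = lam D {l, t}" "b = lam D {t, r}" "c = lam D {r, s}" "d = lam D {s, l}" "e = lam D {l, r}"
    "\<theta> = mu D {l, r, t}" "\<sigma> = mu D {l, r, s}"
  obtains D' f where "flip N D D'" "diags D' = insert {s, t} (diags D - {{l, r}})"
    "head D' = (head D)({s, t} := t, {t, r} := (if head D {t, r} = t then r else t))"
    "f = (a * c + b * d + gsqrt (a * b * c * d) * \<sigma> * \<theta>) / e"
    "lam D' = (lam D)({s, t} := f)"
    "mu D' = (mu D)({l, s, t} := (\<theta> * gsqrt (b * d) + \<sigma> * gsqrt (a * c)) / gsqrt (e * f),
       {r, s, t} := (\<sigma> * gsqrt (b * d) - \<theta> * gsqrt (a * c)) / gsqrt (e * f))"
proof -
  define f where "f = (a * c + b * d + gsqrt (a * b * c * d) * \<sigma> * \<theta>) / e"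
  define D' where "D' = \<lparr>diags = insert {s, t} (diags D - {{l, r}}),
      head = (head D)({s, t} := t, {t, r} := (if head D {t, r} = t then r else t)),
      lam = (lam D)({s, t} := f),
      mu = (mu D)({l, s, t} := (\<theta> * gsqrt (b * d) + \<sigma> * gsqrt (a * c)) / gsqrt (e * f),
        {r, s, t} := (\<sigma> * gsqrt (b * d) - \<theta> * gsqrt (a * c)) / gsqrt (e * f))\<rparr>"
  have "flip N D D'"
    unfolding flip_def Let_def
    by (rule exI[of _ l], rule exI[of _ r], rule exI[of _ s], rule exI[of _ t]) (use assms(1-5) in \<open>simp add: D'_def f_def assms(6-12)\<close>)
  then show ?thesis by (rule that) (simp_all add: D'_def f_def)
qed

text \<open>
  The flip of the diagonal from w to r in a form that does not refer to left and right: x and y are the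
  other two corners, and x lies to the right of the diagonal iff \<open>right\<close> holds. In both cases the
  new triangle at the tail w is the left one, and its mu-invariant has the
  same expression; only the order of the two odd factors in the lambda-length differs.
\<close>

lemma flip_diagonal:
  fixes D :: "'k::sqrt_field decorated"
  assumes wr: "{w, r} \<in> diags D" "head D {w, r} = r"
    and edges: "{{w, x}, {x, r}, {r, y}, {y, w}} \<subseteq> diags D \<union> sides N"
    and side: "if right then ccw w x r \<and> ccw r y w else ccw r x w \<and> ccw w y r"
    and vals: "A = lam D {w, y}" "B = lam D {y, r}" "C = lam D {x, r}" "G = lam D {w, x}" "e = lam D {w, r}"
      "\<Theta> = mu D {w, r, x}" "Z = mu D {w, r, y}"
    and pos: "positive_even A" "positive_even B" "positive_even C" "positive_even G" "positive_even e"
    and odd: "odd_elem \<Theta>" "odd_elem Z"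
  obtains D' F Z' where "flip N D D'" "diags D' = insert {x, y} (diags D - {{w, r}})"
    "\<And>E. E \<noteq> {x, y} \<Longrightarrow> E \<noteq> {y, r} \<Longrightarrow> E \<noteq> {x, r} \<Longrightarrow> head D' E = head D E"
    "\<And>E. E \<noteq> {x, y} \<Longrightarrow> lam D' E = lam D E" "\<And>X. \<not> {x, y} \<subseteq> X \<Longrightarrow> mu D' X = mu D X"
    "F = lam D' {x, y}" "Z' = mu D' {w, x, y}" "positive_even F" "odd_elem Z'"
    "F * e = A * C + B * G + gsqrt A * gsqrt B * gsqrt C * gsqrt G * (if right then \<Theta> * Z else Z * \<Theta>)"
    "Z' * (gsqrt e * gsqrt F) = Z * (gsqrt B * gsqrt G) + \<Theta> * (gsqrt A * gsqrt C)"
proof -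
  note ev = pos[THEN positive_evenD] gsqrt(1)[OF pos(1), THEN positive_evenD] gsqrt(1)[OF pos(2), THEN positive_evenD]
    gsqrt(1)[OF pos(3), THEN positive_evenD] gsqrt(1)[OF pos(4), THEN positive_evenD] gsqrt(1)[OF pos(5), THEN positive_evenD]
  note comm = commute_if_even ev
  have \<theta>\<sigma>: "even_elem (\<Theta> * Z)" "even_elem (Z * \<Theta>)" using odd parity by auto
  have main: "\<exists>D' F Z'. flip N D D' \<and> diags D' = insert {x, y} (diags D - {{w, r}}) \<and>
    (\<forall>E. E \<noteq> {x, y} \<longrightarrow> E \<noteq> {y, r} \<longrightarrow> E \<noteq> {x, r} \<longrightarrow> head D' E = head D E) \<and>
    (\<forall>E. E \<noteq> {x, y} \<longrightarrow> lam D' E = lam D E) \<and> (\<forall>X. \<not> {x, y} \<subseteq> X \<longrightarrow> mu D' X = mu D X) \<and>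
    F = lam D' {x, y} \<and> Z' = mu D' {w, x, y} \<and>
    F = (A * C + B * G + gsqrt A * gsqrt B * gsqrt C * gsqrt G * (if right then \<Theta> * Z else Z * \<Theta>)) / e \<and>
    Z' = (Z * (gsqrt B * gsqrt G) + \<Theta> * (gsqrt A * gsqrt C)) / gsqrt (e * F)"
  proof (cases right)
    case True
    then have c: "ccw w x r" "ccw r y w" using side by auto
    have ed: "{{w, y}, {y, r}, {r, x}, {x, w}} \<subseteq> diags D \<union> sides N" using edges by (simp add: insert_commute)
    have v: "A = lam D {w, y}" "B = lam D {y, r}" "C = lam D {r, x}" "G = lam D {x, w}"
      using vals by (simp_all add: insert_commute)
    obtain D' f where D': "flip N D D'" "diags D' = insert {x, y} (diags D - {{w, r}})"
      "head D' = (head D)({x, y} := y, {y, r} := (if head D {y, r} = y then r else y))"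
      "f = (A * C + B * G + gsqrt (A * B * C * G) * \<Theta> * Z) / e"
      "lam D' = (lam D)({x, y} := f)"
      "mu D' = (mu D)({w, x, y} := (Z * gsqrt (B * G) + \<Theta> * gsqrt (A * C)) / gsqrt (e * f),
         {r, x, y} := (\<Theta> * gsqrt (B * G) - Z * gsqrt (A * C)) / gsqrt (e * f))"
      by (rule flip_exists[OF wr c ed v vals(5,7,6)])
    have "w \<notin> {r, x, y}" using ccw_distinct[OF c(1)] ccw_distinct[OF c(2)] by simp
    then have "{w, x, y} \<noteq> {r, x, y}" by blast
    then have mu_new: "mu D' {w, x, y} = (Z * (gsqrt B * gsqrt G) + \<Theta> * (gsqrt A * gsqrt C)) / gsqrt (e * f)"
      by (simp add: D'(6) gsqrt_mult pos)
    have f: "f = (A * C + B * G + gsqrt A * gsqrt B * gsqrt C * gsqrt G * (\<Theta> * Z)) / e"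
      unfolding D'(4) by (simp add: gsqrt_mult pos positive_even_closed mult.assoc)
    show ?thesis
    proof (rule exI[of _ D'], rule exI[of _ f], rule exI[of _ "mu D' {w, x, y}"], intro conjI)
      show "flip N D D'" by (rule D'(1))
      show "diags D' = insert {x, y} (diags D - {{w, r}})" using D'(2) .
      show "\<forall>E. E \<noteq> {x, y} \<longrightarrow> E \<noteq> {y, r} \<longrightarrow> E \<noteq> {x, r} \<longrightarrow> head D' E = head D E" using D'(3) by simp
      show "\<forall>E. E \<noteq> {x, y} \<longrightarrow> lam D' E = lam D E" "f = lam D' {x, y}" using D'(5) by simp_all
      show "\<forall>X. \<not> {x, y} \<subseteq> X \<longrightarrow> mu D' X = mu D X" by (auto simp: D'(6))
      show "mu D' {w, x, y} = (Z * (gsqrt B * gsqrt G) + \<Theta> * (gsqrt A * gsqrt C)) / gsqrt (e * f)" by (rule mu_new)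
      show "f = (A * C + B * G + gsqrt A * gsqrt B * gsqrt C * gsqrt G * (if right then \<Theta> * Z else Z * \<Theta>)) / e"
        using f True by simp
    qed (rule refl)
  next
    case False
    then have c: "ccw w y r" "ccw r x w" using side by auto
    have ed: "{{w, x}, {x, r}, {r, y}, {y, w}} \<subseteq> diags D \<union> sides N" by (rule edges)
    have v: "G = lam D {w, x}" "C = lam D {x, r}" "B = lam D {r, y}" "A = lam D {y, w}"
      using vals by (simp_all add: insert_commute)
    obtain D' f where D': "flip N D D'" "diags D' = insert {y, x} (diags D - {{w, r}})"
      "head D' = (head D)({y, x} := x, {x, r} := (if head D {x, r} = x then r else x))"
      "f = (G * B + C * A + gsqrt (G * C * B * A) * Z * \<Theta>) / e"
      "lam D' = (lam D)({y, x} := f)"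
      "mu D' = (mu D)({w, y, x} := (\<Theta> * gsqrt (C * A) + Z * gsqrt (G * B)) / gsqrt (e * f),
         {r, y, x} := (Z * gsqrt (C * A) - \<Theta> * gsqrt (G * B)) / gsqrt (e * f))"
      by (rule flip_exists[OF wr c ed v vals(5,6,7)])
    have yx: "{y, x} = {x, y}" "{w, y, x} = {w, x, y}" by auto
    have "w \<notin> {r, y, x}" using ccw_distinct[OF c(1)] ccw_distinct[OF c(2)] by simp
    then have "{w, y, x} \<noteq> {r, y, x}" by blast
    then have "mu D' {w, y, x} = (\<Theta> * gsqrt (C * A) + Z * gsqrt (G * B)) / gsqrt (e * f)"
      by (simp add: D'(6))
    moreover have "\<Theta> * gsqrt (C * A) + Z * gsqrt (G * B) = Z * (gsqrt B * gsqrt G) + \<Theta> * (gsqrt A * gsqrt C)"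
      using even_commute[OF ev(6), of "gsqrt C"] even_commute[OF ev(7), of "gsqrt G"]
      by (simp add: gsqrt_mult pos)
    ultimately have mu_new: "mu D' {w, x, y} = (Z * (gsqrt B * gsqrt G) + \<Theta> * (gsqrt A * gsqrt C)) / gsqrt (e * f)"
      unfolding yx by simp
    have "G * B + C * A + gsqrt (G * C * B * A) * Z * \<Theta> =
        A * C + B * G + gsqrt A * gsqrt B * gsqrt C * gsqrt G * (Z * \<Theta>)"
    proof -
      have "G * B = B * G" "C * A = A * C" using even_commute[OF ev(2), of G] even_commute[OF ev(1), of C] by simp_all
      moreover have "gsqrt (G * C * B * A) = gsqrt A * gsqrt B * gsqrt C * gsqrt G"
        by (simp add: gsqrt_mult pos positive_even_closed mult.assoc) (simp only: comm HOL.simp_thms)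
      ultimately show ?thesis by (simp add: mult.assoc add.commute)
    qed
    then have f: "f = (A * C + B * G + gsqrt A * gsqrt B * gsqrt C * gsqrt G * (Z * \<Theta>)) / e"
      using D'(4) by simp
    show ?thesis
    proof (rule exI[of _ D'], rule exI[of _ f], rule exI[of _ "mu D' {w, x, y}"], intro conjI)
      show "flip N D D'" by (rule D'(1))
      show "diags D' = insert {x, y} (diags D - {{w, r}})" using D'(2) unfolding yx .
      show "\<forall>E. E \<noteq> {x, y} \<longrightarrow> E \<noteq> {y, r} \<longrightarrow> E \<noteq> {x, r} \<longrightarrow> head D' E = head D E" using D'(3) unfolding yx by simp
      show "\<forall>E. E \<noteq> {x, y} \<longrightarrow> lam D' E = lam D E" "f = lam D' {x, y}" using D'(5) unfolding yx by simp_all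
      show "\<forall>X. \<not> {x, y} \<subseteq> X \<longrightarrow> mu D' X = mu D X" by (auto simp: D'(6))
      show "mu D' {w, x, y} = (Z * (gsqrt B * gsqrt G) + \<Theta> * (gsqrt A * gsqrt C)) / gsqrt (e * f)" by (rule mu_new)
      show "f = (A * C + B * G + gsqrt A * gsqrt B * gsqrt C * gsqrt G * (if right then \<Theta> * Z else Z * \<Theta>)) / e"
        using f False by simp
    qed (rule refl)
  qed
  obtain D' F Z' where D': "flip N D D'" "diags D' = insert {x, y} (diags D - {{w, r}})"
    "\<forall>E. E \<noteq> {x, y} \<longrightarrow> E \<noteq> {y, r} \<longrightarrow> E \<noteq> {x, r} \<longrightarrow> head D' E = head D E"
    "\<forall>E. E \<noteq> {x, y} \<longrightarrow> lam D' E = lam D E" "\<forall>X. \<not> {x, y} \<subseteq> X \<longrightarrow> mu D' X = mu D X"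
    "F = lam D' {x, y}" "Z' = mu D' {w, x, y}"
    "F = (A * C + B * G + gsqrt A * gsqrt B * gsqrt C * gsqrt G * (if right then \<Theta> * Z else Z * \<Theta>)) / e"
    "Z' = (Z * (gsqrt B * gsqrt G) + \<Theta> * (gsqrt A * gsqrt C)) / gsqrt (e * F)"
    using main by (elim exE conjE) (rule that)
  let ?num = "A * C + B * G + gsqrt A * gsqrt B * gsqrt C * gsqrt G * (if right then \<Theta> * Z else Z * \<Theta>)"
  have "even_elem ?num" using ev \<theta>\<sigma> by (cases right) (simp_all add: parity_mult(1) parity_add(1))
  moreover have "0 < body ?num"
    using pos odd by (auto simp: body_simps positive_even_def intro!: add_pos_pos)
  ultimately have num: "positive_even ?num" by (simp add: positive_even_def)
  have pF: "positive_even F"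
    unfolding D'(8) divide_grassmann_def
    by (rule positive_even_closed(1)[OF num positive_even_inverse(1)[OF pos(5)]])
  have Fe: "F * e = ?num" unfolding D'(8) by (rule positive_even_divide(1)[OF pos(5)])
  have peF: "positive_even (gsqrt (e * F))" by (intro gsqrt positive_even_closed pos pF)
  have ZF: "Z' * (gsqrt e * gsqrt F) = Z * (gsqrt B * gsqrt G) + \<Theta> * (gsqrt A * gsqrt C)"
    using positive_even_divide(1)[OF peF] D'(9) gsqrt_mult[OF pos(5) pF] by metis
  have "odd_elem (Z * (gsqrt B * gsqrt G) + \<Theta> * (gsqrt A * gsqrt C))"
    by (intro parity_add(2) parity_mult(4) odd parity_mult(1) ev)
  then have "odd_elem (Z' * (gsqrt e * gsqrt F))" unfolding ZF .
  then have "odd_elem Z'"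
    by (rule odd_cancel[OF positive_even_closed(1)[OF gsqrt(1)[OF pos(5)] gsqrt(1)[OF pF]]])
  then show ?thesis
    using D'(3-5) by (intro that[of D' F Z'] D'(1,2,6,7) pF Fe ZF) blast+
qed

text \<open>
  Here e is the flipped diagonal with sides c, g towards the start and A, B towards j; F is the new
  edge to j. The sides of length A and g meet at the tail of e. Multiplied by the product P of the diagonals
  flipped so far, the triple \<open>(A, \<surd>A \<surd>B Z, B)\<close> is the vector of partial sums at e, and the
  conclusions are the two rows of the transfer matrix in which several terms occur.
\<close>

lemma transfer_algebra:
  fixes A B :: "'k::sqrt_field grassmann"
  assumes pos: "positive_even A" "positive_even B" "positive_even F" "0 < g" "0 < c" "0 < e"
    and F: "F * scal e = A * scal c + B * scal g + gsqrt A * gsqrt B * gsqrt (scal c) * gsqrt (scal g) * t"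
    and Z': "Z' * (gsqrt (scal e) * gsqrt F) = Z * (gsqrt B * gsqrt (scal g)) + \<Theta> * (gsqrt A * gsqrt (scal c))"
    and t: "t = \<Theta>' * Z"
    and S: "SA = scal P * A" "SB = scal P * B" "SC = scal P * (gsqrt A * gsqrt B * Z)"
  shows "scal (psqrt g * psqrt g) * SB + scal (psqrt c * psqrt g) * (\<Theta>' * SC) + scal (psqrt c * psqrt c) * SA =
      scal (e * P) * F"
    and "scal (psqrt e * psqrt g) * SC + scal (psqrt e * psqrt c) * (\<Theta> * SA) =
      scal (e * P) * (gsqrt F * gsqrt A * Z')"
proof -
  define a b f where abf: "a = gsqrt A" "b = gsqrt B" "f = gsqrt F"
  define g' c' e' p where gcep: "g' = (scal (psqrt g) :: 'k grassmann)" "c' = (scal (psqrt c) :: 'k grassmann)"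
    "e' = (scal (psqrt e) :: 'k grassmann)" "p = (scal P :: 'k grassmann)"
  have ev: "even_elem a" "even_elem b" "even_elem f" "even_elem g'" "even_elem c'" "even_elem e'" "even_elem p"
    using gsqrt(1)[OF pos(1)] gsqrt(1)[OF pos(2)] gsqrt(1)[OF pos(3)]
    by (auto simp: abf gcep parity positive_even_def)
  note comm = commute_if_even ev HOL.simp_thms
  have sq: "A = a * a" "B = b * b" "F = f * f" unfolding abf by (rule gsqrt(2)[symmetric], rule pos)+
  have sc: "scal g = g' * g'" "scal c = c' * c'" "scal e = e' * e'"
    unfolding gcep scal_mult[symmetric] psqrt(2)[OF pos(4)] psqrt(2)[OF pos(5)] psqrt(2)[OF pos(6)] by (rule refl)+
  have gs: "gsqrt (scal g) = g'" "gsqrt (scal c) = c'" "gsqrt (scal e) = e'" 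
    using pos by (simp_all add: gcep gsqrt_scal)
  have ss: "scal (psqrt g * psqrt g) = g' * g'" "scal (psqrt c * psqrt g) = c' * g'" "scal (psqrt c * psqrt c) = c' * c'"
    "scal (psqrt e * psqrt g) = e' * g'" "scal (psqrt e * psqrt c) = e' * c'" "scal (e * P) = e' * e' * p"
    unfolding scal_mult sc(3) by (simp_all add: gcep)
  have F': "f * (f * (e' * e')) = a * (a * (c' * c')) + b * (b * (g' * g')) + a * (b * (c' * (g' * (\<Theta>' * Z))))"
    using F unfolding t gs abf[symmetric] unfolding sq sc by (simp only: mult.assoc)
  have Z'': "Z' * (e' * f) = Z * (b * g') + \<Theta> * (a * c')"
    using Z' unfolding gs abf[symmetric] .
  have "g' * g' * (p * (b * b)) + c' * g' * (\<Theta>' * (p * (a * b * Z))) + c' * c' * (p * (a * a)) =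
      p * (a * (a * (c' * c')) + b * (b * (g' * g')) + a * (b * (c' * (g' * (\<Theta>' * Z)))))"
    by (simp only: distrib_left mult.assoc comm add_ac)
  also have "\<dots> = e' * e' * p * (f * f)" unfolding F'[symmetric] by (simp only: mult.assoc comm)
  finally show "scal (psqrt g * psqrt g) * SB + scal (psqrt c * psqrt g) * (\<Theta>' * SC) + scal (psqrt c * psqrt c) * SA =
      scal (e * P) * F"
    unfolding ss S unfolding abf[symmetric] gcep(4)[symmetric] unfolding sq .
  have "e' * g' * (p * (a * b * Z)) + e' * c' * (\<Theta> * (p * (a * a))) = p * (e' * (a * (Z * (b * g') + \<Theta> * (a * c'))))"
    by (simp only: distrib_left mult.assoc comm add_ac)
  also have "\<dots> = e' * e' * p * (f * a * Z')" unfolding Z''[symmetric] by (simp only: mult.assoc comm)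
  finally show "scal (psqrt e * psqrt g) * SC + scal (psqrt e * psqrt c) * (\<Theta> * SA) =
      scal (e * P) * (gsqrt F * gsqrt A * Z')"
    unfolding ss S unfolding abf[symmetric] gcep(4)[symmetric] unfolding sq(1) .
qed

locale decorated_strip = crossing_strip +
  fixes h :: "nat set \<Rightarrow> nat" and len :: "nat set \<Rightarrow> 'k::sqrt_field" and \<mu> :: "nat set \<Rightarrow> 'k grassmann"
  assumes head_in: "1 \<le> m \<Longrightarrow> m < n \<Longrightarrow> h (d m) \<in> d m"
    and head_turn: "1 \<le> m \<Longrightarrow> Suc m < n \<Longrightarrow> h (d (Suc m)) = (if turns_at_q m then p (Suc m) else q (Suc m))"
    and len: "\<forall>e\<in>E. 0 < len e" and mu: "\<forall>m\<in>{1..n}. \<mu> (tr m) = gen m"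
begin

sublocale S: snake "dual_word n i j p q" "n - 1"
  using n by unfold_locales simp

abbreviation "lab \<equiv> \<lambda>m s. len (dual_label n i j p q m s)"
abbreviation "\<epsilon> \<equiv> preceding_on_right n i j p q h"
abbreviation "PS \<equiv> S.partial_sum lab \<epsilon>"
abbreviation "D0 \<equiv> \<lparr>diags = T, head = h, lam = (\<lambda>e. scal (len e)), mu = \<mu>\<rparr>"

definition tail_prod :: "nat \<Rightarrow> 'k" where
  "tail_prod m = (\<Prod>k\<in>{Suc m..n - 1}. len (d k))"

definition signed_gen :: "nat \<Rightarrow> 'k grassmann" where
  "signed_gen m = (if \<epsilon> m then gen m else - gen m)"

lemma tail_prod_Suc: "Suc m < n \<Longrightarrow> tail_prod m = len (d (Suc m)) * tail_prod (Suc m)"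
proof -
  assume "Suc m < n"
  then have "{Suc m..n - 1} = insert (Suc m) {Suc (Suc m)..n - 1}" by auto
  then show ?thesis by (simp add: tail_prod_def)
qed

lemma dual_word_eq: "1 \<le> m \<Longrightarrow> m < n - 1 \<Longrightarrow> dual_word n i j p q m = (if turns_at_q m then Rt else Up)"
  using dual_word[of m] by simp

lemma consistent_lab: "S.consistent lab"
  unfolding S.consistent_def
proof (intro allI impI)
  fix m assume m: "1 \<le> m" "m < n - 1"
  then have mn: "Suc m < n" by simp
  show "if dual_word n i j p q m = Rt then lab m Rgt = lab (Suc m) Lft else lab m Top = lab (Suc m) Bot"
    using turn_q[OF m(1) mn] turn_p[OF m(1) mn] by (simp add: dual_word_eq[OF m] dual_label)
qed

text \<open>
  In terms of the triangle between two consecutive crossed diagonals: g is the earlier diagonal, e the later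
  one and c the third side.
\<close>

lemma edge_weights:
  assumes "1 \<le> m" "Suc m < n" "g = len {p m, q m}" "e = len (d (Suc m))"
    "c = len (if turns_at_q m then {p m, p (Suc m)} else {q m, q (Suc m)})"
  shows "case_prod lab (S.edge_side m b b') = (if turns_at_q m then (if b then e else if b' then c else g)
     else (if b' then g else if b then c else e))"
proof -
  have m: "m \<noteq> 0" "m \<noteq> n - 1" "m < n - 1" using assms by auto
  show ?thesis
  proof (cases "turns_at_q m")
    case True
    note t = turn_q[OF assms(1,2) True]
    have "{q m, p (Suc m)} = d (Suc m)" using t(1) by (simp add: diag_def insert_commute)
    then show ?thesis using True m assms(3-5) t(1,7,8)
      unfolding S.edge_side_def dual_word_eq[OF assms(1) m(3)] by (simp add: dual_label)
  next
    case False
    note t = turn_p[OF assms(1,2) False]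
    have "{p m, q (Suc m)} = d (Suc m)" "{q m, p m} = {p m, q m}" using t(1) by (simp_all add: diag_def insert_commute)
    then show ?thesis using False m assms(3-5) t(1,7,8)
      unfolding S.edge_side_def dual_word_eq[OF assms(1) m(3)] by (simp add: dual_label)
  qed
qed

lemma partial_sum_turn_q:
  assumes m: "1 \<le> m" "Suc m < n" and t: "turns_at_q m"
    and g: "g = len {p m, q m}" and e: "e = len (d (Suc m))" and c: "c = len {p m, p (Suc m)}"
  shows "PS m 2 = scal (psqrt e * psqrt e) * PS (Suc m) 2"
    "PS m 0 = scal (psqrt g * psqrt g) * PS (Suc m) 0 + scal (psqrt c * psqrt g) * (signed_gen (Suc m) * PS (Suc m) 1) +
       scal (psqrt c * psqrt c) * PS (Suc m) 2"
    "PS m 1 = scal (psqrt e * psqrt g) * PS (Suc m) 1 + scal (psqrt e * psqrt c) * (gen (Suc m) * PS (Suc m) 2)"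
proof -
  have mn: "m < n - 1" using m by simp
  have al: "S.allowed m x y \<longleftrightarrow> x \<le> y" for x y :: nat
    using m mn t unfolding S.allowed_def dual_word_eq[OF m(1) mn] by simp
  have sets: "{y. y \<le> 2 \<and> S.allowed m 2 y} = {2 :: nat}" "{y. y \<le> 2 \<and> S.allowed m 0 y} = {0, 1, 2 :: nat}"
    "{y. y \<le> 2 \<and> S.allowed m 1 y} = {1, 2 :: nat}"
    unfolding al by auto
  have c': "c = len (if turns_at_q m then {p m, p (Suc m)} else {q m, q (Suc m)})" using t c by simp
  note w = edge_weights[OF m g e c']
  show "PS m 2 = scal (psqrt e * psqrt e) * PS (Suc m) 2"
    unfolding S.partial_sum_step[OF mn order_refl] sets S.step_weight_def w
    by (simp add: S.odd_factor_def t)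
  show "PS m 0 = scal (psqrt g * psqrt g) * PS (Suc m) 0 + scal (psqrt c * psqrt g) * (signed_gen (Suc m) * PS (Suc m) 1) +
       scal (psqrt c * psqrt c) * PS (Suc m) 2"
    unfolding S.partial_sum_step[OF mn le0] sets S.step_weight_def w
    by (simp add: S.odd_factor_def t signed_gen_def add.assoc)
  show "PS m 1 = scal (psqrt e * psqrt g) * PS (Suc m) 1 + scal (psqrt e * psqrt c) * (gen (Suc m) * PS (Suc m) 2)"
    unfolding S.partial_sum_step[OF mn one_le_numeral] sets S.step_weight_def w
    by (simp add: S.odd_factor_def t)
qed

lemma partial_sum_turn_p:
  assumes m: "1 \<le> m" "Suc m < n" and t: "\<not> turns_at_q m"
    and g: "g = len {p m, q m}" and e: "e = len (d (Suc m))" and c: "c = len {q m, q (Suc m)}"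
  shows "PS m 0 = scal (psqrt e * psqrt e) * PS (Suc m) 0"
    "PS m 2 = scal (psqrt g * psqrt g) * PS (Suc m) 2 + scal (psqrt c * psqrt g) * (signed_gen (Suc m) * PS (Suc m) 1) +
       scal (psqrt c * psqrt c) * PS (Suc m) 0"
    "PS m 1 = scal (psqrt e * psqrt g) * PS (Suc m) 1 + scal (psqrt e * psqrt c) * (gen (Suc m) * PS (Suc m) 0)"
proof -
  have mn: "m < n - 1" using m by simp
  have al: "S.allowed m x y \<longleftrightarrow> y \<le> x" for x y :: nat
    using m mn t unfolding S.allowed_def dual_word_eq[OF m(1) mn] by simp
  have sets: "{y. y \<le> 2 \<and> S.allowed m 2 y} = {0, 1, 2 :: nat}" "{y. y \<le> 2 \<and> S.allowed m 0 y} = {0 :: nat}"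
    "{y. y \<le> 2 \<and> S.allowed m 1 y} = {0, 1 :: nat}"
    unfolding al by auto
  have c': "c = len (if turns_at_q m then {p m, p (Suc m)} else {q m, q (Suc m)})" using t c by simp
  note w = edge_weights[OF m g e c']
  show "PS m 0 = scal (psqrt e * psqrt e) * PS (Suc m) 0"
    unfolding S.partial_sum_step[OF mn le0] sets S.step_weight_def w
    by (simp add: S.odd_factor_def t)
  show "PS m 2 = scal (psqrt g * psqrt g) * PS (Suc m) 2 + scal (psqrt c * psqrt g) * (signed_gen (Suc m) * PS (Suc m) 1) +
       scal (psqrt c * psqrt c) * PS (Suc m) 0"
    unfolding S.partial_sum_step[OF mn order_refl] sets S.step_weight_def w
    by (simp add: S.odd_factor_def t signed_gen_def add_ac mult.commute[of "psqrt g" "psqrt c"])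
  show "PS m 1 = scal (psqrt e * psqrt g) * PS (Suc m) 1 + scal (psqrt e * psqrt c) * (gen (Suc m) * PS (Suc m) 0)"
    unfolding S.partial_sum_step[OF mn one_le_numeral] sets S.step_weight_def w
    by (simp add: S.odd_factor_def t add_ac mult.commute[of "psqrt e"])
qed

lemma partial_sum_first:
  assumes a: "a = len {i, p 1}" and b: "b = len {i, q 1}"
  shows "PS 0 0 = scal (psqrt b * psqrt b) * PS 1 0 + scal (psqrt a * psqrt b) * (signed_gen 1 * PS 1 1) +
    scal (psqrt a * psqrt a) * PS 1 2"
proof -
  have mn: "0 < n - 1" using n by simp
  have sets: "{y. y \<le> 2 \<and> S.allowed 0 0 y} = {0, 1, 2 :: nat}" unfolding S.allowed_def by auto
  have u1: "u (Suc 0) = i" using apex_before_first(1) by simp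
  show ?thesis
    unfolding S.partial_sum_step[OF mn le0] sets S.step_weight_def S.edge_side_def
    by (simp add: S.odd_factor_def dual_label u1 signed_gen_def add.assoc a b)
qed

lemma partial_sum_last:
  shows "PS (n - 1) 2 = scal (len {q (n - 1), j})" "PS (n - 1) 0 = scal (len {p (n - 1), j})"
    "PS (n - 1) 1 = scal (psqrt (len {q (n - 1), j}) * psqrt (len {p (n - 1), j})) * gen n"
proof -
  have k: "n - 1 \<noteq> 0" "Suc (n - 1) = n" "1 \<le> n - 1" "n - 1 < n" using n by auto
  have "0 < len {q (n - 1), j}" "0 < len {p (n - 1), j}"
    using apex_after(5,6)[OF k(3,4)] len unfolding apex_after_last(1) by (auto simp: insert_commute)
  note sq = psqrt(2)[OF this(1)] psqrt(2)[OF this(2)]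
  have w: "case_prod lab (S.edge_side (n - 1) b b') = (if b then len {q (n - 1), j} else len {p (n - 1), j})" for b b'
    using k(1) unfolding S.edge_side_def by (simp add: dual_label apex_after_last(1)[simplified])
  show "PS (n - 1) 2 = scal (len {q (n - 1), j})" "PS (n - 1) 0 = scal (len {p (n - 1), j})"
    "PS (n - 1) 1 = scal (psqrt (len {q (n - 1), j}) * psqrt (len {p (n - 1), j})) * gen n"
    using S.partial_sum_last[of 2 lab \<epsilon>] S.partial_sum_last[of 0 lab \<epsilon>] S.partial_sum_last[of 1 lab \<epsilon>]
    unfolding S.step_weight_def w k(2) by (simp_all add: sq[simplified])
qed

end

context decorated_strip
begin

text \<open>
  The situation after the flips of all diagonals beyond \<open>x\<^sub>m\<close>: the triangle on \<open>x\<^sub>m\<close> with apex j is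
  present, everything away from j is unchanged, and the triple of the partial sums is proportional to the triple of
  that triangle.
\<close>

definition flipped :: "nat \<Rightarrow> 'k decorated \<Rightarrow> bool" where
  "flipped m D \<longleftrightarrow> (flip N)\<^sup>*\<^sup>* D0 D \<and>
     (\<forall>k. 1 \<le> k \<longrightarrow> k \<le> m \<longrightarrow> d k \<in> diags D \<and> head D (d k) = h (d k)) \<and>
     {p m, j} \<in> edges N D \<and> {q m, j} \<in> edges N D \<and>
     (\<forall>e. j \<notin> e \<longrightarrow> lam D e = scal (len e)) \<and> (\<forall>X. j \<notin> X \<longrightarrow> mu D X = \<mu> X) \<and>
     positive_even (lam D {p m, j}) \<and> positive_even (lam D {q m, j}) \<and> odd_elem (mu D {p m, q m, j}) \<and>
     PS m 0 = scal (tail_prod m) * lam D {p m, j} \<and> PS m 2 = scal (tail_prod m) * lam D {q m, j} \<and>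
     PS m 1 = scal (tail_prod m) * (gsqrt (lam D {p m, j}) * gsqrt (lam D {q m, j}) * mu D {p m, q m, j})"

text \<open>
  One more flip. The old edge that it reverses is a side of the polygon or an edge at j, so the
  heads of the remaining crossed diagonals persist.
\<close>

lemma flip_towards_start:
  assumes m: "1 \<le> m" "m < n" and D: "flipped m D"
    and wr: "w = q m \<and> r = p m \<or> w = p m \<and> r = q m" and hr: "h (d m) = r"
    and edges: "{w, u m} \<in> edges N D" "{u m, r} \<in> sides N"
    and AB: "A = lam D {w, j}" "B = lam D {r, j}" and Z: "Z = mu D {p m, q m, j}"
  obtains D' F Z' where "(flip N)\<^sup>*\<^sup>* D0 D'" "diags D' = insert {u m, j} (diags D - {d m})"
    "\<And>e. j \<notin> e \<Longrightarrow> e \<notin> sides N \<Longrightarrow> head D' e = head D e"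
    "\<And>e. e \<noteq> {u m, j} \<Longrightarrow> lam D' e = lam D e" "\<And>X. j \<notin> X \<Longrightarrow> mu D' X = mu D X"
    "F = lam D' {u m, j}" "Z' = mu D' {w, u m, j}" "positive_even F" "odd_elem Z'"
    "F * scal (len (d m)) = A * scal (len {u m, r}) + B * scal (len {w, u m}) +
      gsqrt A * gsqrt B * gsqrt (scal (len {u m, r})) * gsqrt (scal (len {w, u m})) * (signed_gen m * Z)"
    "Z' * (gsqrt (scal (len (d m))) * gsqrt F) =
      Z * (gsqrt B * gsqrt (scal (len {w, u m}))) + gen m * (gsqrt A * gsqrt (scal (len {u m, r})))"
proof -
  have Dm: "(flip N)\<^sup>*\<^sup>* D0 D" "d m \<in> diags D" "head D (d m) = h (d m)" "{p m, j} \<in> edges N D" "{q m, j} \<in> edges N D"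
    "\<And>e. j \<notin> e \<Longrightarrow> lam D e = scal (len e)" "\<And>X. j \<notin> X \<Longrightarrow> mu D X = \<mu> X"
    "positive_even (lam D {p m, j})" "positive_even (lam D {q m, j})" "odd_elem (mu D {p m, q m, j})"
    using D m unfolding flipped_def by auto
  have dm: "{w, r} = d m" using wr by (auto simp: diag_def)
  have ne: "p m \<noteq> q m" "p m \<noteq> j" "q m \<noteq> j" using pq_distinct[OF m] by auto
  have uj: "u m \<noteq> j" using apex_before(6)[OF m] by auto
  have um: "{u m, p m} \<in> E" "{u m, q m} \<in> E" using apex_before(4,5)[OF m] by auto
  have \<epsilon>: "\<epsilon> m \<longleftrightarrow> r = q m" using preceding_on_right[of m h, OF m head_in[OF m]] hr by simp
  have cu: "ccw (p m) (u m) (q m)" using apex_ccw(1)[OF m] ccw_cyclic by blast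
  have cj: "ccw (q m) j (p m)"
    unfolding ccw_rel[OF d_bounds(2)[OF m] j d_bounds(1)[OF m]] unfolding ccw_def using d_rel[OF m] by simp
  have "{w, r} \<in> diags D" "head D {w, r} = r" unfolding dm using Dm(2,3) hr by auto
  note wrD = this
  have ed: "{{w, u m}, {u m, r}, {r, j}, {j, w}} \<subseteq> diags D \<union> sides N"
    using edges Dm(4,5) wr unfolding edges_def by (auto simp: insert_commute)
  have side: "if \<epsilon> m then ccw w (u m) r \<and> ccw r j w else ccw r (u m) w \<and> ccw w j r"
    using wr \<epsilon> ne(1) cu cj by auto
  have inE: "{w, u m} \<in> E" "{u m, r} \<in> E" using um wr by (auto simp: insert_commute)
  have lens: "scal (len {u m, r}) = lam D {u m, r}" "scal (len {w, u m}) = lam D {w, u m}" "scal (len (d m)) = lam D {w, r}"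
    unfolding dm[symmetric] using Dm(6) wr ne uj by (auto simp del: insert_commute)
  have pos: "positive_even (scal (len {u m, r}))" "positive_even (scal (len {w, u m}))" "positive_even (scal (len (d m)))"
    using len inE d_in_E[OF m] by (auto simp: positive_even_closed diag_def)
  have posAB: "positive_even A" "positive_even B" using Dm(8,9) wr by (auto simp: AB)
  have "{w, r, u m} = tr m" using wr apex_before(1)[OF m] by auto
  moreover have "j \<notin> tr m" unfolding apex_before(1)[OF m] using ne uj by auto
  moreover have "\<mu> (tr m) = gen m" using mu m by simp
  ultimately have gm: "gen m = mu D {w, r, u m}" using Dm(7) by simp
  have Zm: "Z = mu D {w, r, j}"
  proof -
    have "{w, r, j} = {p m, q m, j}" using wr by auto
    then show ?thesis using Z by simp
  qed
  have B': "B = lam D {j, r}" using AB(2) by (simp add: insert_commute)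
  obtain D' F Z' where D': "flip N D D'" "diags D' = insert {u m, j} (diags D - {{w, r}})"
    "\<And>e. e \<noteq> {u m, j} \<Longrightarrow> e \<noteq> {j, r} \<Longrightarrow> e \<noteq> {u m, r} \<Longrightarrow> head D' e = head D e"
    "\<And>e. e \<noteq> {u m, j} \<Longrightarrow> lam D' e = lam D e" "\<And>X. \<not> {u m, j} \<subseteq> X \<Longrightarrow> mu D' X = mu D X"
    "F = lam D' {u m, j}" "Z' = mu D' {w, u m, j}" "positive_even F" "odd_elem Z'"
    "F * scal (len (d m)) = A * scal (len {u m, r}) + B * scal (len {w, u m}) +
      gsqrt A * gsqrt B * gsqrt (scal (len {u m, r})) * gsqrt (scal (len {w, u m})) * (if \<epsilon> m then gen m * Z else Z * gen m)"
    "Z' * (gsqrt (scal (len (d m))) * gsqrt F) =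
      Z * (gsqrt B * gsqrt (scal (len {w, u m}))) + gen m * (gsqrt A * gsqrt (scal (len {u m, r})))"
    by (rule flip_diagonal[OF wrD ed side AB(1) B' lens gm Zm posAB pos])
      (use Dm(10) Z in \<open>auto simp: parity\<close>)
  have "Z * gen m = - (gen m * Z)" using Dm(10) Z by (intro odd_anticommute parity) auto
  then have sg: "(if \<epsilon> m then gen m * Z else Z * gen m) = signed_gen m * Z" by (simp add: signed_gen_def)
  show ?thesis
  proof (rule that[of D' F Z'])
    show "(flip N)\<^sup>*\<^sup>* D0 D'" using Dm(1) D'(1) by (rule rtranclp.rtrancl_into_rtrancl)
    show "diags D' = insert {u m, j} (diags D - {d m})" using D'(2) unfolding dm .
    show "head D' e = head D e" if "j \<notin> e" "e \<notin> sides N" for e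
      using D'(3)[of e] that edges(2) by auto
    show "mu D' X = mu D X" if "j \<notin> X" for X using D'(5)[of X] that by auto
    show "F * scal (len (d m)) = A * scal (len {u m, r}) + B * scal (len {w, u m}) +
      gsqrt A * gsqrt B * gsqrt (scal (len {u m, r})) * gsqrt (scal (len {w, u m})) * (signed_gen m * Z)"
      using D'(10) unfolding sg .
  qed (fact D'(4,6-9,11))+
qed

lemma flipped_initial: "flipped (n - 1) D0"
proof -
  have m: "1 \<le> n - 1" "n - 1 < n" using n by auto
  have n1: "Suc (n - 1) = n" using n by simp
  have E: "{p (n - 1), j} \<in> E" "{q (n - 1), j} \<in> E"
    using apex_after(5,6)[OF m] unfolding apex_after_last(1) by (auto simp: insert_commute)
  have pos: "0 < len {p (n - 1), j}" "0 < len {q (n - 1), j}" using len E by auto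
  have tn: "{p (n - 1), q (n - 1), j} = tr n" using apex_after_last(2) by auto
  have mun: "\<mu> {p (n - 1), q (n - 1), j} = gen n" unfolding tn using mu n by simp
  have "tail_prod (n - 1) = 1" unfolding tail_prod_def n1 using n by simp
  then show ?thesis
    unfolding flipped_def partial_sum_last
    using E pos m mun by (auto simp: edges_def positive_even_closed parity gsqrt_scal T_eq scal_mult mult.commute
      even_commute[OF parity_const(3), of "psqrt (len {p (n - 1), j})"])
qed

text \<open>
  The next diagonal \<open>x\<^sub>m\<^sub>+\<^sub>1\<close> points away from its common end with \<open>x\<^sub>m\<close>, so that \<open>x\<^sub>m\<close> is a side of the
  triangle at its tail; this is the triangle whose mu-invariant \<open>flip_towards_start\<close> computes. The two cases
  exchange p and q.
\<close>

lemma flipped_step: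
  assumes m: "1 \<le> m" "Suc m < n" and D: "flipped (Suc m) D"
  shows "\<exists>D'. flipped m D'"
proof -
  let ?M = "Suc m"
  have M: "1 \<le> ?M" "?M < n" and mn: "m < n" using m by auto
  have Ddiag: "\<And>k. 1 \<le> k \<Longrightarrow> k \<le> ?M \<Longrightarrow> d k \<in> diags D \<and> head D (d k) = h (d k)"
    and De: "{p ?M, j} \<in> edges N D" "{q ?M, j} \<in> edges N D"
    and Dl: "\<And>e. j \<notin> e \<Longrightarrow> lam D e = scal (len e)" and Dmu: "\<And>X. j \<notin> X \<Longrightarrow> mu D X = \<mu> X"
    and Dpos: "positive_even (lam D {p ?M, j})" "positive_even (lam D {q ?M, j})" "odd_elem (mu D {p ?M, q ?M, j})"
    and DPS: "PS ?M 0 = scal (tail_prod ?M) * lam D {p ?M, j}" "PS ?M 2 = scal (tail_prod ?M) * lam D {q ?M, j}"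
     "PS ?M 1 = scal (tail_prod ?M) * (gsqrt (lam D {p ?M, j}) * gsqrt (lam D {q ?M, j}) * mu D {p ?M, q ?M, j})"
    using D unfolding flipped_def by auto
  have ne: "p m \<noteq> q m" "p m \<noteq> j" "q m \<noteq> j" "p ?M \<noteq> j" "q ?M \<noteq> j"
    using pq_distinct[OF m(1) mn] pq_distinct[OF M] by auto
  have jd: "j \<notin> d k" if "1 \<le> k" "k < n" for k using pq_distinct[OF that] by (auto simp: diag_def)
  have dT: "d k \<in> T" if "1 \<le> k" "k < n" for k using that by (auto simp: T_eq)
  have Tside: "d k \<notin> sides N" if "1 \<le> k" "k < n" for k
    using dT[OF that] tri unfolding triangulation_def diagonals_def by blast
  have keep: "d k \<in> diags D' \<and> head D' (d k) = h (d k)"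
    if "1 \<le> k" "k \<le> m" "diags D' = insert {u ?M, j} (diags D - {d ?M})"
      "\<And>e. j \<notin> e \<Longrightarrow> e \<notin> sides N \<Longrightarrow> head D' e = head D e" for k D'
    using Ddiag[of k] that jd[of k] Tside[of k] d_inj[of k ?M] m by auto
  have pos_e: "0 < len (d ?M)" "0 < len {p m, q m}" using len dT[OF M] d_in_E[OF m(1) mn] by auto
  have tp: "tail_prod m = len (d ?M) * tail_prod ?M" by (rule tail_prod_Suc[OF m(2)])
  show ?thesis
  proof (cases "turns_at_q m")
    case True
    note t = turn_q[OF m True]
    have hr: "h (d ?M) = p ?M" using head_turn[OF m] True by simp
    have x: "u ?M = p m" by (rule t(7))
    have ed: "{q ?M, u ?M} \<in> edges N D" "{u ?M, p ?M} \<in> sides N"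
      using Ddiag[of m] m(1) t(1,9) unfolding x edges_def by (auto simp: diag_def insert_commute)
    have wu: "{q ?M, u ?M} = {p m, q m}" "{u ?M, p ?M} = {p m, p ?M}" unfolding x t(1) by auto
    obtain D' F Z' where D': "(flip N)\<^sup>*\<^sup>* D0 D'" "diags D' = insert {u ?M, j} (diags D - {d ?M})"
      "\<And>e. j \<notin> e \<Longrightarrow> e \<notin> sides N \<Longrightarrow> head D' e = head D e"
      "\<And>e. e \<noteq> {u ?M, j} \<Longrightarrow> lam D' e = lam D e" "\<And>X. j \<notin> X \<Longrightarrow> mu D' X = mu D X"
      "F = lam D' {u ?M, j}" "Z' = mu D' {q ?M, u ?M, j}" "positive_even F" "odd_elem Z'"
      "F * scal (len (d ?M)) = lam D {q ?M, j} * scal (len {u ?M, p ?M}) + lam D {p ?M, j} * scal (len {q ?M, u ?M}) +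
        gsqrt (lam D {q ?M, j}) * gsqrt (lam D {p ?M, j}) * gsqrt (scal (len {u ?M, p ?M})) * gsqrt (scal (len {q ?M, u ?M})) * (signed_gen ?M * mu D {p ?M, q ?M, j})"
      "Z' * (gsqrt (scal (len (d ?M))) * gsqrt F) = mu D {p ?M, q ?M, j} * (gsqrt (lam D {p ?M, j}) * gsqrt (scal (len {q ?M, u ?M}))) +
        gen ?M * (gsqrt (lam D {q ?M, j}) * gsqrt (scal (len {u ?M, p ?M})))"
      by (rule flip_towards_start[OF M D disjI1[OF conjI[OF refl refl]] hr ed refl refl refl]) (rule that; assumption)
    have Z'_eq: "Z' = mu D' {p m, q m, j}" unfolding D'(7) x t(1) by (simp add: insert_commute)
    have F_eq: "F = lam D' {p m, j}" using D'(6) unfolding x .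
    have qj: "lam D' {q m, j} = lam D {q ?M, j}"
      using D'(4)[of "{q m, j}"] ne unfolding x t(1) by (auto simp: doubleton_eq_iff)
    have pos_c: "0 < len {p m, p ?M}" using len t(9) by (auto simp: insert_commute)
    have swap: "gsqrt (lam D {p ?M, j}) * gsqrt (lam D {q ?M, j}) = gsqrt (lam D {q ?M, j}) * gsqrt (lam D {p ?M, j})"
      by (rule even_commute[OF positive_evenD[OF gsqrt(1)[OF Dpos(1)]]])
    note alg = transfer_algebra[OF Dpos(2,1) D'(8) pos_e(2) pos_c pos_e(1) D'(10)[unfolded wu] D'(11)[unfolded wu] refl
      DPS(2,1) DPS(3)[unfolded swap]]
    note ps = partial_sum_turn_q[OF m True refl refl refl]
    have "flipped m D'"
      unfolding flipped_def
    proof (intro conjI allI impI)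
      show "(flip N)\<^sup>*\<^sup>* D0 D'" by (rule D'(1))
      show "d k \<in> diags D'" "head D' (d k) = h (d k)" if "1 \<le> k" "k \<le> m" for k
        using keep[OF that D'(2,3)] by auto
      show "{p m, j} \<in> edges N D'" using D'(2) unfolding x edges_def by simp
      have "{q m, j} \<noteq> d ?M" using jd[OF M] by auto
      then show "{q m, j} \<in> edges N D'" using De(2) unfolding edges_def D'(2) t(1) by auto
      show "lam D' e = scal (len e)" if "j \<notin> e" for e using D'(4)[of e] Dl[OF that] that by auto
      show "mu D' X = \<mu> X" if "j \<notin> X" for X using D'(5) Dmu that by auto
      show "positive_even (lam D' {p m, j})" "positive_even (lam D' {q m, j})" "odd_elem (mu D' {p m, q m, j})"
        using D'(8,9) F_eq Z'_eq qj Dpos(2) by simp_all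
      show "PS m 0 = scal (tail_prod m) * lam D' {p m, j}"
        unfolding ps(2) tp F_eq[symmetric] by (rule alg(1))
      show "PS m 2 = scal (tail_prod m) * lam D' {q m, j}"
        unfolding ps(1) tp qj DPS(2) psqrt(2)[OF pos_e(1)] scal_mult by (simp add: mult.assoc)
      show "PS m 1 = scal (tail_prod m) * (gsqrt (lam D' {p m, j}) * gsqrt (lam D' {q m, j}) * mu D' {p m, q m, j})"
        unfolding ps(3) tp F_eq[symmetric] qj Z'_eq[symmetric] by (rule alg(2))
    qed
    then show ?thesis by blast
  next
    case False
    note t = turn_p[OF m False]
    have hr: "h (d ?M) = q ?M" using head_turn[OF m] False by simp
    have x: "u ?M = q m" by (rule t(7))
    have ed: "{p ?M, u ?M} \<in> edges N D" "{u ?M, q ?M} \<in> sides N"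
      using Ddiag[of m] m(1) t(1,9) unfolding x edges_def by (auto simp: diag_def insert_commute)
    have wu: "{p ?M, u ?M} = {p m, q m}" "{u ?M, q ?M} = {q m, q ?M}" unfolding x t(1) by auto
    obtain D' F Z' where D': "(flip N)\<^sup>*\<^sup>* D0 D'" "diags D' = insert {u ?M, j} (diags D - {d ?M})"
      "\<And>e. j \<notin> e \<Longrightarrow> e \<notin> sides N \<Longrightarrow> head D' e = head D e"
      "\<And>e. e \<noteq> {u ?M, j} \<Longrightarrow> lam D' e = lam D e" "\<And>X. j \<notin> X \<Longrightarrow> mu D' X = mu D X"
      "F = lam D' {u ?M, j}" "Z' = mu D' {p ?M, u ?M, j}" "positive_even F" "odd_elem Z'"
      "F * scal (len (d ?M)) = lam D {p ?M, j} * scal (len {u ?M, q ?M}) + lam D {q ?M, j} * scal (len {p ?M, u ?M}) +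
        gsqrt (lam D {p ?M, j}) * gsqrt (lam D {q ?M, j}) * gsqrt (scal (len {u ?M, q ?M})) * gsqrt (scal (len {p ?M, u ?M})) * (signed_gen ?M * mu D {p ?M, q ?M, j})"
      "Z' * (gsqrt (scal (len (d ?M))) * gsqrt F) = mu D {p ?M, q ?M, j} * (gsqrt (lam D {q ?M, j}) * gsqrt (scal (len {p ?M, u ?M}))) +
        gen ?M * (gsqrt (lam D {p ?M, j}) * gsqrt (scal (len {u ?M, q ?M})))"
      by (rule flip_towards_start[OF M D disjI2[OF conjI[OF refl refl]] hr ed refl refl refl]) (rule that; assumption)
    have Z'_eq: "Z' = mu D' {p m, q m, j}" unfolding D'(7) x t(1) by (simp add: insert_commute)
    have F_eq: "F = lam D' {q m, j}" using D'(6) unfolding x .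
    have pj: "lam D' {p m, j} = lam D {p ?M, j}"
      using D'(4)[of "{p m, j}"] ne unfolding x t(1) by (auto simp: doubleton_eq_iff)
    have pos_c: "0 < len {q m, q ?M}" using len t(9) by auto
    have swap: "gsqrt (lam D' {p m, j}) * gsqrt (lam D' {q m, j}) = gsqrt (lam D' {q m, j}) * gsqrt (lam D' {p m, j})"
      unfolding pj by (rule even_commute[OF positive_evenD[OF gsqrt(1)[OF Dpos(1)]]])
    note alg = transfer_algebra[OF Dpos(1,2) D'(8) pos_e(2) pos_c pos_e(1) D'(10)[unfolded wu] D'(11)[unfolded wu] refl
      DPS(1,2,3)]
    note ps = partial_sum_turn_p[OF m False refl refl refl]
    have "flipped m D'"
      unfolding flipped_def
    proof (intro conjI allI impI)
      show "(flip N)\<^sup>*\<^sup>* D0 D'" by (rule D'(1))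
      show "d k \<in> diags D'" "head D' (d k) = h (d k)" if "1 \<le> k" "k \<le> m" for k
        using keep[OF that D'(2,3)] by auto
      show "{q m, j} \<in> edges N D'" using D'(2) unfolding x edges_def by simp
      have "{p m, j} \<noteq> d ?M" using jd[OF M] by auto
      then show "{p m, j} \<in> edges N D'" using De(1) unfolding edges_def D'(2) t(1) by auto
      show "lam D' e = scal (len e)" if "j \<notin> e" for e using D'(4)[of e] Dl[OF that] that by auto
      show "mu D' X = \<mu> X" if "j \<notin> X" for X using D'(5) Dmu that by auto
      show "positive_even (lam D' {p m, j})" "positive_even (lam D' {q m, j})" "odd_elem (mu D' {p m, q m, j})"
        using D'(8,9) F_eq Z'_eq pj Dpos(1) by simp_all
      show "PS m 2 = scal (tail_prod m) * lam D' {q m, j}"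
        unfolding ps(2) tp F_eq[symmetric] by (rule alg(1))
      show "PS m 0 = scal (tail_prod m) * lam D' {p m, j}"
        unfolding ps(1) tp pj DPS(1) psqrt(2)[OF pos_e(1)] scal_mult by (simp add: mult.assoc)
      show "PS m 1 = scal (tail_prod m) * (gsqrt (lam D' {p m, j}) * gsqrt (lam D' {q m, j}) * mu D' {p m, q m, j})"
        unfolding swap unfolding ps(3) tp F_eq[symmetric] pj Z'_eq[symmetric] by (rule alg(2))
    qed
    then show ?thesis by blast
  qed
qed

lemma flipped_first: "\<exists>D. flipped 1 D"
proof -
  have "\<exists>D. flipped m D" if "1 \<le> m" "m \<le> n - 1" for m
    using that(2,1)
  proof (induction m rule: inc_induct)
    case base
    show ?case using flipped_initial by blast
  next
    case (step m)
    then have "1 \<le> Suc m" "Suc m < n" by auto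
    then show ?case using step flipped_step[of m] by auto
  qed
  then show ?thesis using n by auto
qed

text \<open>
  The last flip creates the edge from i to j. Only its lambda-length matters, which has the same
  form for both orientations of the first diagonal.
\<close>

lemma super_lambda_eq:
  "super_lambda N D0 {i, j} = scal (1 / (\<Prod>m = 1..n - 1. len (d m))) * PS 0 0"
proof -
  obtain D where D: "flipped 1 D" using flipped_first by blast
  then have Dv: "positive_even (lam D {p 1, j})" "positive_even (lam D {q 1, j})" "odd_elem (mu D {p 1, q 1, j})"
     "PS 1 0 = scal (tail_prod 1) * lam D {p 1, j}" "PS 1 2 = scal (tail_prod 1) * lam D {q 1, j}"
     "PS 1 1 = scal (tail_prod 1) * (gsqrt (lam D {p 1, j}) * gsqrt (lam D {q 1, j}) * mu D {p 1, q 1, j})"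
    unfolding flipped_def by auto
  have m: "1 \<le> (1::nat)" "1 < n" using n by auto
  have b: "p 1 < N" "q 1 < N" using d_bounds[OF m] by auto
  have side: "{i, p 1} \<in> sides N" "{i, q 1} \<in> sides N"
    unfolding sides_rel[OF i b(1)] sides_rel[OF i b(2)] first_diagonal rel_simps(1) by auto
  then have side': "{p 1, i} \<in> sides N" "{q 1, i} \<in> sides N" by (simp_all add: insert_commute)
  have pos: "0 < len {i, p 1}" "0 < len {i, q 1}" "0 < len (d 1)" using len side d_in_E[OF m] by (auto simp: diag_def)
  have x: "u 1 = i" by (rule apex_before_first(1))
  have swap: "{q 1, i} = {i, q 1}" "{p 1, i} = {i, p 1}" by auto
  have gswap: "gsqrt (lam D {p 1, j}) * gsqrt (lam D {q 1, j}) = gsqrt (lam D {q 1, j}) * gsqrt (lam D {p 1, j})"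
    by (rule even_commute[OF positive_evenD[OF gsqrt(1)[OF Dv(1)]]])
  have "\<exists>D' F. (flip N)\<^sup>*\<^sup>* D0 D' \<and> {i, j} \<in> diags D' \<and> lam D' {i, j} = F \<and> PS 0 0 = scal (len (d 1) * tail_prod 1) * F"
  proof -
    have "h (d 1) = p 1 \<or> h (d 1) = q 1" using head_in[OF m] by (auto simp: diag_def)
    then show ?thesis
    proof
      assume hr: "h (d 1) = p 1"
      have ed: "{q 1, u 1} \<in> edges N D" "{u 1, p 1} \<in> sides N" using side side' unfolding x edges_def by auto
      obtain D' F Z' where D': "(flip N)\<^sup>*\<^sup>* D0 D'" "diags D' = insert {u 1, j} (diags D - {d 1})"
        "F = lam D' {u 1, j}" "positive_even F"
        "F * scal (len (d 1)) = lam D {q 1, j} * scal (len {u 1, p 1}) + lam D {p 1, j} * scal (len {q 1, u 1}) +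
          gsqrt (lam D {q 1, j}) * gsqrt (lam D {p 1, j}) * gsqrt (scal (len {u 1, p 1})) * gsqrt (scal (len {q 1, u 1})) * (signed_gen 1 * mu D {p 1, q 1, j})"
        "Z' * (gsqrt (scal (len (d 1))) * gsqrt F) = mu D {p 1, q 1, j} * (gsqrt (lam D {p 1, j}) * gsqrt (scal (len {q 1, u 1}))) +
          gen 1 * (gsqrt (lam D {q 1, j}) * gsqrt (scal (len {u 1, p 1})))"
        by (rule flip_towards_start[OF m D disjI1[OF conjI[OF refl refl]] hr ed refl refl refl]) (rule that; assumption)
      have "PS 0 0 = scal (len (d 1) * tail_prod 1) * F"
        unfolding partial_sum_first[OF refl refl]
        by (rule transfer_algebra(1)[OF Dv(2,1) D'(4) pos(2,1,3) D'(5,6)[unfolded x swap] refl Dv(5,4) Dv(6)[unfolded gswap]])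
      then show ?thesis using D'(1-3) unfolding x by blast
    next
      assume hr: "h (d 1) = q 1"
      have ed: "{p 1, u 1} \<in> edges N D" "{u 1, q 1} \<in> sides N" using side side' unfolding x edges_def by auto
      obtain D' F Z' where D': "(flip N)\<^sup>*\<^sup>* D0 D'" "diags D' = insert {u 1, j} (diags D - {d 1})"
        "F = lam D' {u 1, j}" "positive_even F"
        "F * scal (len (d 1)) = lam D {p 1, j} * scal (len {u 1, q 1}) + lam D {q 1, j} * scal (len {p 1, u 1}) +
          gsqrt (lam D {p 1, j}) * gsqrt (lam D {q 1, j}) * gsqrt (scal (len {u 1, q 1})) * gsqrt (scal (len {p 1, u 1})) * (signed_gen 1 * mu D {p 1, q 1, j})"
        "Z' * (gsqrt (scal (len (d 1))) * gsqrt F) = mu D {p 1, q 1, j} * (gsqrt (lam D {q 1, j}) * gsqrt (scal (len {p 1, u 1}))) +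
          gen 1 * (gsqrt (lam D {p 1, j}) * gsqrt (scal (len {u 1, q 1})))"
        by (rule flip_towards_start[OF m D disjI2[OF conjI[OF refl refl]] hr ed refl refl refl]) (rule that; assumption)
      have "scal (psqrt (len {i, p 1}) * psqrt (len {i, p 1})) * PS 1 2 +
          scal (psqrt (len {i, q 1}) * psqrt (len {i, p 1})) * (signed_gen 1 * PS 1 1) +
          scal (psqrt (len {i, q 1}) * psqrt (len {i, q 1})) * PS 1 0 = scal (len (d 1) * tail_prod 1) * F"
        by (rule transfer_algebra(1)[OF Dv(1,2) D'(4) pos(1,2,3) D'(5,6)[unfolded x swap] refl Dv(4,5,6)])
      then have "PS 0 0 = scal (len (d 1) * tail_prod 1) * F"
        unfolding partial_sum_first[OF refl refl] mult.commute[of "psqrt (len {i, q 1})" "psqrt (len {i, p 1})"]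
        by (simp only: add_ac)
      then show ?thesis using D'(1-3) unfolding x by blast
    qed
  qed
  then obtain D' F where D': "(flip N)\<^sup>*\<^sup>* D0 D'" "{i, j} \<in> diags D'" "lam D' {i, j} = F"
      "PS 0 0 = scal (len (d 1) * tail_prod 1) * F" by blast
  obtain V where "realized_by N V D0" using realization_exists[OF len mu head_in] by blast
  then have "super_lambda N D0 {i, j} = F" using super_lambda_eqI D'(1-3) by blast
  moreover have prod: "len (d 1) * tail_prod 1 = (\<Prod>m = 1..n - 1. len (d m))"
  proof -
    have "{1..n - 1} = insert 1 {Suc 1..n - 1}" using n by auto
    then show ?thesis by (simp add: tail_prod_def)
  qed
  have "0 < (\<Prod>m = 1..n - 1. len (d m))" using len T_eq by (intro prod_pos) auto
  then have scal_cancel: "1 / (\<Prod>m = 1..n - 1. len (d m)) * (\<Prod>m = 1..n - 1. len (d m)) = 1"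
    using nonzero_divide_eq_eq order_less_imp_not_eq2 by (metis)
  then have "scal (1 / (\<Prod>m = 1..n - 1. len (d m))) * PS 0 0 = F"
    unfolding D'(4) prod mult.assoc[symmetric] scal_mult[symmetric] by (simp only: scal_cancel scal_1 mult_1_left)
  ultimately show ?thesis by simp
qed

end

theorem theorem8p8:
  fixes n i j c :: nat
    and T :: "nat set set"
    and p q :: "nat \<Rightarrow> nat"
    and h :: "nat set \<Rightarrow> nat"
    and len :: "nat set \<Rightarrow> 'k::sqrt_field"
    and \<mu> :: "nat set \<Rightarrow> 'k grassmann"
  assumes "2 \<le> n"
    and "triangulation (n + 2) T"
    and "i < n + 2" and "j < n + 2"
    and "\<forall>e\<in>T. crosses e {i, j}"
    and "crossing_sequence n i j p q T"
    and "n = 2 \<longrightarrow> c \<in> diag p q 1"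
    and "default_orientation n p q c h"
    and "\<forall>e\<in>T \<union> sides (n + 2). 0 < len e"
    and "\<forall>m\<in>{1..n}. \<mu> (triangle n i j p q m) = gen m"
  shows "super_lambda (n + 2) \<lparr>diags = T, head = h, lam = (\<lambda>e. scal (len e)), mu = \<mu>\<rparr> {i, j} =
      scal (1 / (\<Prod>m = 1..n - 1. len (diag p q m))) *
      (\<Sum>P\<in>double_paths (dual_word n i j p q) (n - 1).
         weight (dual_word n i j p q) (n - 1) (\<lambda>m s. len (dual_label n i j p q m s))
           (positive_order n i j p q h) P)"
proof -
  interpret crossing_strip n i j p q T using assms by unfold_locales
  interpret decorated_strip n i j p q T h len \<mu>
  proof unfold_locales
    show "h (d m) \<in> d m" if "1 \<le> m" "m < n" for m
      using assms(8) that unfolding default_orientation_def Let_def by auto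
    show "h (d (Suc m)) = (if turns_at_q m then p (Suc m) else q (Suc m))" if "1 \<le> m" "Suc m < n" for m
      by (rule default_head[OF assms(8) that])
  qed (use assms(9,10) in auto)
  have "positive_order n i j p q h = priority (preceding_on_right n i j p q h)"
    by (intro ext) (auto simp: positive_order_def priority_def)
  then show ?thesis
    using super_lambda_eq S.sum_weight_eq_partial_sum[OF consistent_lab] by simp
qed

end
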